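(* Let $A$ be a positive even integer and let $\mathcal T_A,\mathcal O_A$ be the perfect t-embedding and origami map of the reduced hexagon $H_A'$ described in the context. The position of the face $(x,n)$ of $H_A'$ under the t-embedding is $$\mathcal T_A(x,n)=\mathcal T_A(v_1)+\mathcal F^\bullet(b_1)\mathcal F^\circ(w_1)+\frac{(2A-1)!}{\Delta(A)}\frac1{(2\pi\mathrm i)^2}\int_{\{0,1,\dots,A-1\}}\int_{\{\infty\}}\frac{1}{z_1-z_2}\left(\frac{(z_1-x+1)_{2A-n}}{(z_2-x+1)_{2A-n}}-\frac{(z_1+1)_{2A-1}}{(z_2+1)_{2A-1}}\right)\frac{(-2A-z_2)_A(-z_2)_A}{(-2A-z_1)_A(-z_1)_A}f_A(z_2)g_A(z_1)\,dz_2\,dz_1,$$ and the origami map evaluated at the corresponding face is $$\mathcal O_A(x,n)=\mathcal O_A(v_1)+\mathcal F^\bullet(b_1)\overline{\mathcal F^\circ(w_1)}+\frac{(2A-1)!}{\Delta(A)}\frac1{(2\pi\mathrm i)^2}\int_{\{0,1,\dots,A-1\}}\int_{\{\infty\}}\frac{1}{z_1-z_2}\left(\frac{(z_1-x+1)_{2A-n}}{(z_2-x+1)_{2A-n}}-\frac{(z_1+1)_{2A-1}}{(z_2+1)_{2A-1}}\right)\frac{(-2A-z_2)_A(-z_2)_A}{(-2A-z_1)_A(-z_1)_A}f_A(z_2)\overline{g_A}(z_1)\,dz_2\,dz_1.$$ Here the $z_1$-contour $\{0,1,\dots,A-1\}$ is a counterclockwise contour containing the points $0,1,\dots,A-1$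 and no other poles in $z_1$ of the integrand; the $z_2$-contour $\{\infty\}$ is a counterclockwise contour that contains the $z_1$-contour and is sufficiently large, i.e. contains all poles of the integrand in $z_2$; $(a)_p=a(a+1)\cdots(a+p-1)$, $(a)_0=1$; $\overline{g_A}(z)=\overline{g_A(\bar z)}$; and $f_A$, $g_A$ are the functions, holomorphic away from their singularities, given by $$g_A(z)=-1+\frac{A}{1+z}e^{\mathrm i\pi/3}+\frac{A}{-A-z}e^{-\mathrm i\pi/3},$$ $$f_A(z)=\frac{\mathrm ie^{\mathrm i\pi/6}}{(2A)_A(A-1)!}\frac1{z-(A-1)}+\frac1{2\pi\mathrm i}\int_{\{0,1,\dots,A-1\}}\frac{1}{(-2A-u)_A(-u)_A}\frac{du}{z-u}-\frac{\mathrm ie^{-\mathrm i\pi/6}}{(2A)_A(A-1)!}\frac1{z+2A},$$ where the contour in $f_A$ is counterclockwise, contains $0,1,\dots,A-1$, and contains neither $z$ nor any of $-2A,\dots,-A-1$.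
   Context: **Hexagon $H_A$.** $H_A$ is the bipartite planar graph with white vertices $w(y,m)$, $0\le m\le 2A-1$, $\max(-m,-A)\le y\le\min(A-1,2A-1-m)$, and black vertices $b(x,n)$, $1\le n\le 2A$, $\max(-n,-A)\le x\le\min(A-1,2A-1-n)$ (integer coordinates); $b(x,n)$ is adjacent to those of $w(x,n),w(x,n-1),w(x+1,n-1)$ that belong to $H_A$. Its inner faces are labelled by $(x,n)$, the face $(x,n)$ being the hexagon with vertices $w(x-1,n),b(x-1,n),w(x,n-1),b(x,n),w(x,n),b(x-1,n+1)$ (all in $H_A$), drawn with centre $(\frac{\sqrt3}{2}x,\frac x2+n)\in\mathbb R^2$; $w(x,n)$ is at the centroid of the centres of $(x,n),(x+1,n),(x,n+1)$ and $b(x,n)$ at the centroid of the centres of $(x,n),(x+1,n),(x+1,n-1)$. **Reduced hexagon $H_A'$.** It is obtained from $H_A$ by contracting six boundary strings of vertices to single vertices (the degree-two vertices between consecutive vertices of a string disappear): $b_1$: $b(k,1)$, $-1\le k\le A-1$; $b_2$: $b(k,2A-1-k)$, $-1\le k\le A-1$; $b_3$: $b(-A,k)$, $A\le k\le 2A$; $w_1$: $w(-k,k)$, $1\le k\le A-1$; $w_2$: $w(A-1,k)$, $1\le k\le A-1$; $w_3$: $w(k,2A-1)$, $-A+1\le k\le -1$. The other (inner) vertices are $w(y,m)$ with $1\le m\le 2A-2$, $\max(-m,-A)<y<\min(A-1,2A-1-m)$, and $b(x,n)$ with $2\le n\le 2A-1$, $\max(-n,-A)<x<\min(A-1,2A-1-n)$.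 The outer face has boundary cycle $b_1,w_1,b_3,w_3,b_2,w_2$. Inner faces of $H_A'$ correspond naturally to inner faces of $H_A$ and are labelled by the same $(x,n)$. **Kasteleyn matrix.** $K_{\mathrm{red}}$ (rows black, columns white) has entries: $1$ for adjacent inner vertices; $1$ for each of the pairs $b_1w_1,b_1w_2,b_2w_2,b_2w_3,b_3w_3,b_3w_1$; and $K_{\mathrm{red}}(b_1,w(k,1))=(-1)^{k+1}$ for $0\le k\le A-2$; $K_{\mathrm{red}}(b_2,w(k,2A-2-k))=(-1)^{k+1}$ for $0\le k\le A-2$; $K_{\mathrm{red}}(b_3,w(-A+1,n-1))=(-1)^n$ for $A+1\le n\le 2A-1$; $K_{\mathrm{red}}(b(-k,k+1),w_1)=(-1)^{k+1}$ and $K_{\mathrm{red}}(b(A-2,k+1),w_2)=(-1)^{k+1}$ for $1\le k\le A-1$; $K_{\mathrm{red}}(b(k,2A-1),w_3)=(-1)^{k+1}$ for $-A+1\le k\le-1$; all other entries $0$. The nonzero entries are exactly the edges of $H_A'$. Write $R=K_{\mathrm{red}}^{-1}$. **Gauge functions, t-embedding, origami map.** $\Delta(A)=|R(w_1,b_1)-R(w_1,b_2)|>0$, and $\mathcal F^\bullet(b)=\frac1{\Delta(A)}(\mathrm ie^{\mathrm i\pi/6}R(w_2,b)+R(w_3,b)-\mathrm ie^{-\mathrm i\pi/6}R(w_1,b))$, $\mathcal F^\circ(w)=-R(w,b_1)+e^{\mathrm i\pi/3}R(w,b_2)+e^{-\mathrm i\pi/3}R(w,b_3)$. The augmented dual $(H_A')^*$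 has one inner vertex for each inner face $(x,n)$ of $H_A'$ and six outer vertices, one for each edge of the outer face; $v_1$ is the outer vertex at the edge $b_1w_1$. $\mathcal T_A,\mathcal O_A$ are the complex functions on vertices of $(H_A')^*$ with $\mathcal T_A(v')-\mathcal T_A(v)=\mathcal F^\bullet(b)K_{\mathrm{red}}(b,w)\mathcal F^\circ(w)$ and $\mathcal O_A(v')-\mathcal O_A(v)=\mathcal F^\bullet(b)K_{\mathrm{red}}(b,w)\overline{\mathcal F^\circ(w)}$ for each edge $bw$ whose dual edge, oriented with $w$ on its left, is $vv'$, normalised by $\mathcal T_A(v_1)=-e^{\mathrm i\pi/3}$, $\mathcal O_A(v_1)=-\frac12$. $\mathcal T_A(x,n)$, $\mathcal O_A(x,n)$ denote values at the dual vertex of the face $(x,n)$.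
   Formalization: For faces with x<0 the z_1-contour must also contain the pole -1 of g_A; with -1 excluded, as the English says, the formulas fail (e.g. A=2, (x,n)=(-1,2)). For x≥0 the point -1 may lie inside or outside. The points -2A,…,-A are always outside. *)

theory Defs
  imports "HOL-Complex_Analysis.Complex_Analysis"
begin

section \<open>The hexagon and its reduction\<close>

datatype hvertex = HW int int | HB int int

definition hexagon :: "nat \<Rightarrow> hvertex set" where
  "hexagon A =
     {HW y m | y m. 0 \<le> m \<and> m \<le> 2 * int A - 1 \<and>
        max (- m) (- int A) \<le> y \<and> y \<le> min (int A - 1) (2 * int A - 1 - m)} \<union>
     {HB x n | x n. 1 \<le> n \<and> n \<le> 2 * int A \<and>
        max (- n) (- int A) \<le> x \<and> x \<le> min (int A - 1) (2 * int A - 1 - n)}"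

definition hex_adj :: "int \<times> int \<Rightarrow> int \<times> int \<Rightarrow> bool" where
  "hex_adj = (\<lambda>(x, n) (y, m). (y, m) \<in> {(x, n), (x, n - 1), (x + 1, n - 1)})"

text \<open>
  With the given drawing (the face \<open>(x, n)\<close> is centred at \<open>(sqrt 3 / 2 * x, x / 2 + n)\<close>) this
  list runs counterclockwise around the face.
\<close>

definition face_boundary :: "int \<Rightarrow> int \<Rightarrow> hvertex list" where
  "face_boundary x n =
     [HW (x - 1) n, HB (x - 1) n, HW x (n - 1), HB x n, HW x n, HB (x - 1) (n + 1)]"

definition faces :: "nat \<Rightarrow> (int \<times> int) set" where
  "faces A = {(x, n). set (face_boundary x n) \<subseteq> hexagon A}"

datatype black = B int int | B1 | B2 | B3
datatype white = W int int | W1 | W2 | W3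

definition inner_black :: "nat \<Rightarrow> int \<Rightarrow> int \<Rightarrow> bool" where
  "inner_black A x n \<longleftrightarrow> 2 \<le> n \<and> n \<le> 2 * int A - 1 \<and>
     max (- n) (- int A) < x \<and> x < min (int A - 1) (2 * int A - 1 - n)"

definition inner_white :: "nat \<Rightarrow> int \<Rightarrow> int \<Rightarrow> bool" where
  "inner_white A y m \<longleftrightarrow> 1 \<le> m \<and> m \<le> 2 * int A - 2 \<and>
     max (- m) (- int A) < y \<and> y < min (int A - 1) (2 * int A - 1 - m)"

definition blacks :: "nat \<Rightarrow> black set" where
  "blacks A = {B x n | x n. inner_black A x n} \<union> {B1, B2, B3}"

definition whites :: "nat \<Rightarrow> white set" where
  "whites A = {W y m | y m. inner_white A y m} \<union> {W1, W2, W3}"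

text \<open>
  The vertices of the hexagon that are contracted to a given vertex of the reduced hexagon. In
  the six boundary cases these are the string together with the degree-two vertices (of the
  opposite colour) between its consecutive members.
\<close>

fun fibre :: "nat \<Rightarrow> black + white \<Rightarrow> hvertex set" where
  "fibre A (Inl (B x n)) = (if inner_black A x n then {HB x n} else {})"
| "fibre A (Inr (W y m)) = (if inner_white A y m then {HW y m} else {})"
| "fibre A (Inl B1) = (\<lambda>k. HB k 1) ` {-1..int A - 1} \<union> (\<lambda>k. HW k 0) ` {0..int A - 1}"
| "fibre A (Inl B2) =
     (\<lambda>k. HB k (2 * int A - 1 - k)) ` {-1..int A - 1} \<union>
     (\<lambda>k. HW k (2 * int A - 1 - k)) ` {0..int A - 1}"
| "fibre A (Inl B3) =
     HB (- int A) ` {int A..2 * int A} \<union> HW (- int A) ` {int A..2 * int A - 1}"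
| "fibre A (Inr W1) = (\<lambda>k. HW (- k) k) ` {1..int A - 1} \<union> (\<lambda>k. HB (- k) k) ` {2..int A - 1}"
| "fibre A (Inr W2) = HW (int A - 1) ` {1..int A - 1} \<union> HB (int A - 1) ` {2..int A - 1}"
| "fibre A (Inr W3) =
     (\<lambda>k. HW k (2 * int A - 1)) ` {- int A + 1..-1} \<union> (\<lambda>k. HB k (2 * int A)) ` {- int A + 1..-2}"


section \<open>The Kasteleyn matrix and its inverse\<close>

fun Kred :: "nat \<Rightarrow> black \<Rightarrow> white \<Rightarrow> complex" where
  "Kred A (B x n) (W y m) =
     (if inner_black A x n \<and> inner_white A y m \<and> hex_adj (x, n) (y, m) then 1 else 0)"
| "Kred A B1 (W k m) =
     (if 0 \<le> k \<and> k \<le> int A - 2 \<and> m = 1 then (-1) powi (k + 1) else 0)"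
| "Kred A B2 (W k m) =
     (if 0 \<le> k \<and> k \<le> int A - 2 \<and> m = 2 * int A - 2 - k then (-1) powi (k + 1) else 0)"
| "Kred A B3 (W y m) =
     (let n = m + 1 in
      if y = - int A + 1 \<and> int A + 1 \<le> n \<and> n \<le> 2 * int A - 1 then (-1) powi n else 0)"
| "Kred A (B x n) W1 =
     (let k = n - 1 in if 1 \<le> k \<and> k \<le> int A - 1 \<and> x = - k then (-1) powi (k + 1) else 0)"
| "Kred A (B x n) W2 =
     (let k = n - 1 in if 1 \<le> k \<and> k \<le> int A - 1 \<and> x = int A - 2 then (-1) powi (k + 1) else 0)"
| "Kred A (B k n) W3 =
     (if - int A + 1 \<le> k \<and> k \<le> -1 \<and> n = 2 * int A - 1 then (-1) powi (k + 1) else 0)"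
| "Kred A B1 W1 = 1" | "Kred A B1 W2 = 1" | "Kred A B1 W3 = 0"
| "Kred A B2 W1 = 0" | "Kred A B2 W2 = 1" | "Kred A B2 W3 = 1"
| "Kred A B3 W1 = 1" | "Kred A B3 W2 = 0" | "Kred A B3 W3 = 1"

text \<open>
  The two-sided inverse matrix; the value \<open>0\<close> outside the index sets only makes it unique as a
  total function.
\<close>

definition Kinv :: "nat \<Rightarrow> white \<Rightarrow> black \<Rightarrow> complex" where
  "Kinv A = (THE R.
     (\<forall>w b. \<not> (w \<in> whites A \<and> b \<in> blacks A) \<longrightarrow> R w b = 0) \<and>
     (\<forall>b\<in>blacks A. \<forall>b'\<in>blacks A.
        (\<Sum>w\<in>whites A. Kred A b w * R w b') = (if b = b' then 1 else 0)) \<and>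
     (\<forall>w\<in>whites A. \<forall>w'\<in>whites A.
        (\<Sum>b\<in>blacks A. R w b * Kred A b w') = (if w = w' then 1 else 0)))"


section \<open>Gauge functions, t-embedding and origami map\<close>

definition Delta :: "nat \<Rightarrow> real" where
  "Delta A = cmod (Kinv A W1 B1 - Kinv A W1 B2)"

definition F_black :: "nat \<Rightarrow> black \<Rightarrow> complex" where
  "F_black A b = 1 / of_real (Delta A) *
     (\<i> * cis (pi / 6) * Kinv A W2 b + Kinv A W3 b - \<i> * cis (- pi / 6) * Kinv A W1 b)"

definition F_white :: "nat \<Rightarrow> white \<Rightarrow> complex" where
  "F_white A w = - Kinv A w B1 + cis (pi / 3) * Kinv A w B2 + cis (- pi / 3) * Kinv A w B3"

datatype dual_vertex = Face int int | Outer black white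

definition dual_vertices :: "nat \<Rightarrow> dual_vertex set" where
  "dual_vertices A = (\<lambda>(x, n). Face x n) ` faces A \<union>
     {Outer B1 W1, Outer B3 W1, Outer B3 W3, Outer B2 W3, Outer B2 W2, Outer B1 W2}"

text \<open>This cycle runs clockwise around the reduced hexagon, so the outer face is on its left.\<close>

definition outer_boundary :: "(black + white) list" where
  "outer_boundary = [Inl B1, Inr W1, Inl B3, Inr W3, Inl B2, Inr W2]"

text \<open>
  \<open>on_left A p q v\<close>: the dual vertex \<open>v\<close> lies on the left of the edge of the reduced hexagon
  traversed from \<open>p\<close> to \<open>q\<close>. The outer face is split into the six outer vertices.
\<close>

fun on_left :: "nat \<Rightarrow> black + white \<Rightarrow> black + white \<Rightarrow> dual_vertex \<Rightarrow> bool" where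
  "on_left A p q (Face x n) \<longleftrightarrow> (x, n) \<in> faces A \<and>
     (\<exists>i<6. face_boundary x n ! i \<in> fibre A p \<and> face_boundary x n ! ((i + 1) mod 6) \<in> fibre A q)"
| "on_left A p q (Outer b w) \<longleftrightarrow> {p, q} = {Inl b, Inr w} \<and>
     (\<exists>i<6. outer_boundary ! i = p \<and> outer_boundary ! ((i + 1) mod 6) = q)"

text \<open>
  The function on the augmented dual with prescribed increments \<open>\<omega> b w\<close> across the edges
  \<open>b w\<close> and value \<open>c\<close> at the outer vertex at \<open>b\<^sub>1w\<^sub>1\<close>. The dual edge \<open>v v'\<close> crosses \<open>b w\<close> with
  \<open>w\<close> on its left iff \<open>v\<close> is on the left when going from \<open>b\<close> to \<open>w\<close> and \<open>v'\<close> is on the left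
  when going from \<open>w\<close> to \<open>b\<close>.
\<close>

definition dual_primitive ::
    "nat \<Rightarrow> complex \<Rightarrow> (black \<Rightarrow> white \<Rightarrow> complex) \<Rightarrow> dual_vertex \<Rightarrow> complex" where
  "dual_primitive A c \<omega> = (THE T. T \<in> extensional (dual_vertices A) \<and> T (Outer B1 W1) = c \<and>
     (\<forall>b w v v'. Kred A b w \<noteq> 0 \<and> on_left A (Inl b) (Inr w) v \<and> on_left A (Inr w) (Inl b) v'
        \<longrightarrow> T v' - T v = \<omega> b w))"

definition t_embedding :: "nat \<Rightarrow> dual_vertex \<Rightarrow> complex" where
  "t_embedding A = dual_primitive A (- cis (pi / 3))
     (\<lambda>b w. F_black A b * Kred A b w * F_white A w)"

definition origami :: "nat \<Rightarrow> dual_vertex \<Rightarrow> complex" where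
  "origami A = dual_primitive A (- 1 / 2)
     (\<lambda>b w. F_black A b * Kred A b w * cnj (F_white A w))"


section \<open>Contours and the integrand\<close>

definition ccw_contour :: "(real \<Rightarrow> complex) \<Rightarrow> bool" where
  "ccw_contour \<gamma> \<longleftrightarrow> valid_path \<gamma> \<and> simple_path \<gamma> \<and> pathfinish \<gamma> = pathstart \<gamma> \<and>
     (\<forall>z \<in> inside (path_image \<gamma>). winding_number \<gamma> z = 1)"

definition f_contour :: "nat \<Rightarrow> complex \<Rightarrow> (real \<Rightarrow> complex) \<Rightarrow> bool" where
  "f_contour A z \<gamma> \<longleftrightarrow> ccw_contour \<gamma> \<and>
     of_int ` {0..int A - 1} \<subseteq> inside (path_image \<gamma>) \<and>
     of_int ` {- 2 * int A..- int A - 1} \<subseteq> outside (path_image \<gamma>) \<and>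
     z \<in> outside (path_image \<gamma>)"

text \<open>The integral in \<open>f_fun\<close> does not depend on the choice of the contour.\<close>

definition f_fun :: "nat \<Rightarrow> complex \<Rightarrow> complex" where
  "f_fun A z =
     \<i> * cis (pi / 6) / (pochhammer (of_nat (2 * A)) A * fact (A - 1)) * (1 / (z - (of_nat A - 1)))
     + 1 / (2 * of_real pi * \<i>) * contour_integral (SOME \<gamma>. f_contour A z \<gamma>)
         (\<lambda>u. 1 / (pochhammer (- 2 * of_nat A - u) A * pochhammer (- u) A) * (1 / (z - u)))
     - \<i> * cis (- pi / 6) / (pochhammer (of_nat (2 * A)) A * fact (A - 1)) *
         (1 / (z + 2 * of_nat A))"

definition g_fun :: "nat \<Rightarrow> complex \<Rightarrow> complex" where
  "g_fun A z = - 1 + of_nat A / (1 + z) * cis (pi / 3)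
     + of_nat A / (- of_nat A - z) * cis (- pi / 3)"

definition g_bar :: "nat \<Rightarrow> complex \<Rightarrow> complex" where
  "g_bar A z = cnj (g_fun A (cnj z))"

text \<open>
  Besides \<open>0, \<dots>, A - 1\<close> the integrand can have poles in \<open>z\<^sub>1\<close> at \<open>-2A, \<dots>, -A\<close> and at \<open>-1\<close>. The
  latter comes from \<open>g_fun\<close>. It is cancelled by the zeros of the two Pochhammer numerators when
  \<open>x \<ge> 0\<close>, and then it may be inside or outside of the contour. For \<open>x < 0\<close> it is a genuine pole and
  the contour has to enclose it: the integral formulas fail for contours that separate it from
  \<open>0, \<dots>, A - 1\<close>.
\<close>

definition z1_contour :: "nat \<Rightarrow> int \<Rightarrow> (real \<Rightarrow> complex) \<Rightarrow> bool" where
  "z1_contour A x \<gamma> \<longleftrightarrow> ccw_contour \<gamma> \<and>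
     of_int ` {0..int A - 1} \<subseteq> inside (path_image \<gamma>) \<and>
     of_int ` {- 2 * int A..- int A} \<subseteq> outside (path_image \<gamma>) \<and>
     - 1 \<notin> path_image \<gamma> \<and> (x < 0 \<longrightarrow> - 1 \<in> inside (path_image \<gamma>))"

text \<open>
  The poles in \<open>z\<^sub>2\<close> of the factors of the integrand are \<open>x - 2A + n, \<dots>, x - 1\<close>, then
  \<open>-(2A - 1), \<dots>, -1\<close>, and the poles \<open>0, \<dots>, A - 1\<close> and \<open>-2A\<close> of \<open>f_fun\<close>. For a face \<open>(x, n)\<close> these
  are all among \<open>-2A, \<dots>, A - 1\<close>.
\<close>

definition z2_contour :: "nat \<Rightarrow> (real \<Rightarrow> complex) \<Rightarrow> (real \<Rightarrow> complex) \<Rightarrow> bool" where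
  "z2_contour A \<gamma>\<^sub>1 \<gamma> \<longleftrightarrow> ccw_contour \<gamma> \<and>
     path_image \<gamma>\<^sub>1 \<subseteq> inside (path_image \<gamma>) \<and>
     of_int ` {- 2 * int A..int A - 1} \<subseteq> inside (path_image \<gamma>)"

definition integrand ::
    "nat \<Rightarrow> int \<Rightarrow> int \<Rightarrow> (complex \<Rightarrow> complex) \<Rightarrow> complex \<Rightarrow> complex \<Rightarrow> complex" where
  "integrand A x n g z\<^sub>1 z\<^sub>2 =
     1 / (z\<^sub>1 - z\<^sub>2) *
     (pochhammer (z\<^sub>1 - of_int x + 1) (nat (2 * int A - n)) /
        pochhammer (z\<^sub>2 - of_int x + 1) (nat (2 * int A - n))
      - pochhammer (z\<^sub>1 + 1) (2 * A - 1) / pochhammer (z\<^sub>2 + 1) (2 * A - 1)) *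
     (pochhammer (- 2 * of_nat A - z\<^sub>2) A * pochhammer (- z\<^sub>2) A /
        (pochhammer (- 2 * of_nat A - z\<^sub>1) A * pochhammer (- z\<^sub>1) A)) *
     f_fun A z\<^sub>2 * g z\<^sub>1"

end

theory Submission
  imports Defs
begin

text \<open>
  Everything comes from interpolation at consecutive integers. On the hexagonal lattice, and after
  multiplication by \<open>(-1)^(x + n)\<close>, the equation \<open>K F = 0\<close> at a black vertex says that row \<open>n\<close> of
  \<open>F\<close> is the difference of row \<open>n - 1\<close>; the transposed equation at a white vertex says that row \<open>n\<close>
  is the difference of row \<open>n + 1\<close>. Hence both gauge functions have closed forms. Let
  \<open>M(z) = (-2A - z)_A (-z)_A\<close>. The product \<open>P = f_A M\<close> is a polynomial of degree less than \<open>2A\<close>, and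
  \<open>F_black (b(x, n))\<close> is, up to sign and the factor \<open>1 / Delta\<close>, the backward difference of order
  \<open>2A - n\<close> of \<open>P\<close> at \<open>x\<close> (\<open>F_black_eq\<close>). The value \<open>F_white (w(x, n))\<close> is, up to sign and a quotient of
  factorials, the sum of the residues of \<open>(z - x + 1)_(2A - n - 1) g_A(z) / M(z)\<close> at
  \<open>-1, 0, \<dots>, A - 1\<close> (\<open>F_white_eq\<close>). Both are verified by inserting them into the linear systems that
  characterise them, which requires that \<open>K_red\<close> is invertible (\<open>Kinv_inverse\<close>): a vector in its
  kernel comes from a sequence supported on \<open>{0..A - 1}\<close> whose differences of order \<open>2A\<close> vanish at \<open>A\<close>
  consecutive points; such a sequence agrees with a polynomial of degree less than \<open>2A\<close> that has \<open>2A\<close>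
  zeros.

  In the double integral, let \<open>Q(z) = (z - x + 1)_(2A - n)\<close>. The kernel \<open>(Q(z1) / Q(z2) - 1) / (z1 - z2)\<close>
  is the sum over \<open>j < 2A - n\<close> of \<open>(z1 - x + 1)_j / (z2 - x + 1)_(j + 1)\<close> (\<open>newton_kernel\<close>), and the
  integral of \<open>P(z2) / (z2 - x + 1)_(j + 1)\<close> is a divided difference of \<open>P\<close>. So the inner integral is
  Newton's interpolation polynomial of \<open>P\<close> at the nodes \<open>x - 1, \<dots>, x - 2A + n\<close>, evaluated at \<open>z1\<close>, minus
  the same polynomial for the face \<open>(0, 1)\<close>, the one behind the edge \<open>b1 w1\<close>. Going from a face to a
  neighbouring face adds, removes or exchanges one node, and the interpolation polynomial changes by a
  divided difference of \<open>P\<close> times a product of linear factors in \<open>z1\<close>. Up to signs and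
  factorials that cancel, the first factor is \<open>Delta F_black (b)\<close>, and the residues in \<open>z1\<close> turn the
  second one into \<open>F_white (w)\<close>. This is
  \<open>face_value_increment\<close>: the right-hand side of the formula has the increments that define the
  t-embedding. As the dual graph is connected, they determine it (\<open>dual_primitive_unique\<close>).

  The matrix \<open>K_red\<close> is real, so the origami map differs from the t-embedding only by the conjugation
  of the coefficients of \<open>g_A\<close>. Therefore the argument is carried out for
  \<open>g(z) = -1 + A \<alpha> / (1 + z) + A \<beta> / (-A - z)\<close> with arbitrary \<open>\<alpha>\<close> and \<open>\<beta>\<close>.
\<close>

section \<open>Iterated differences and interpolation at integers\<close>

text \<open>
  The step \<open>d = -1\<close> gives backward differences; \<open>d = 1\<close> gives forward differences with the sign
  \<open>(-1)^n\<close>. They occur on black and on white vertices, respectively.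
\<close>

primrec diffs :: "int \<Rightarrow> nat \<Rightarrow> (int \<Rightarrow> complex) \<Rightarrow> int \<Rightarrow> complex" where
  "diffs d 0 f x = f x"
| "diffs d (Suc n) f x = diffs d n f x - diffs d n f (x + d)"

lemma diffs_diff: "diffs d n (\<lambda>i. f i - g i) x = diffs d n f x - diffs d n g x"
  by (induction n arbitrary: x) (simp_all add: algebra_simps)

lemma diffs_Suc_inner: "diffs d (Suc n) f x = diffs d n (\<lambda>i. f i - f (i + d)) x"
proof (induction n arbitrary: x)
  case (Suc n)
  have "diffs d (Suc (Suc n)) f x = diffs d (Suc n) f x - diffs d (Suc n) f (x + d)"
    by simp
  also have "\<dots> = diffs d (Suc n) (\<lambda>i. f i - f (i + d)) x"
    unfolding Suc.IH by simp
  finally show ?case .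
qed simp

lemma diffs_binomial:
  "diffs d n f x = (\<Sum>j\<le>n. (-1) ^ j * of_nat (n choose j) * f (x + int j * d))"
proof (induction n arbitrary: x)
  case (Suc n)
  let ?t = "\<lambda>m j. (-1) ^ j * of_nat (m choose j) * f (x + int j * d)"
  have shift: "diffs d n f (x + d) = - (\<Sum>j\<le>n. (-1) ^ Suc j * of_nat (n choose j) * f (x + int (Suc j) * d))"
    unfolding Suc.IH by (simp add: sum_negf [symmetric] algebra_simps)
  have "(\<Sum>j\<le>Suc n. ?t (Suc n) j) =
      f x + (\<Sum>j\<le>n. (-1) ^ Suc j * of_nat (Suc n choose Suc j) * f (x + int (Suc j) * d))"
    by (subst sum.atMost_Suc_shift) simp
  also have "\<dots> = f x + (\<Sum>j\<le>n. ?t n (Suc j)) + (\<Sum>j\<le>n. (-1) ^ Suc j * of_nat (n choose j) * f (x + int (Suc j) * d))"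
    by (simp add: sum.distrib [symmetric] algebra_simps)
  also have "f x + (\<Sum>j\<le>n. ?t n (Suc j)) = (\<Sum>j\<le>Suc n. ?t n j)"
    by (subst sum.atMost_Suc_shift) simp
  also have "\<dots> = diffs d n f x"
    unfolding Suc.IH by simp
  finally show ?case
    using shift by simp
qed simp

lemma diffs_cong:
  assumes "\<And>j. j \<le> n \<Longrightarrow> f (x + int j * d) = g (x + int j * d)"
  shows "diffs d n f x = diffs d n g x"
  unfolding diffs_binomial by (rule sum.cong) (use assms in auto)

lemma degree_difference_less:
  fixes p :: "complex poly"
  assumes "degree p < Suc n"
  shows "degree (p - pcompose p [:c, 1:]) < n \<or> p - pcompose p [:c, 1:] = 0"
proof (cases "degree p = 0")
  case True
  then obtain a where "p = [:a:]" by (metis degree_eq_zeroE)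
  then show ?thesis by simp
next
  case False
  let ?q = "pcompose p [:c, 1:]"
  have deg: "degree ?q = degree p"
    by (simp add: degree_pcompose)
  have lead: "lead_coeff ?q = lead_coeff p"
    by (subst lead_coeff_comp) auto
  have "degree (p - ?q) < degree p"
  proof (rule degree_lessI)
    show "p - ?q \<noteq> 0 \<or> degree p > 0" using False by simp
    show "\<forall>k\<ge>degree p. coeff (p - ?q) k = 0"
    proof (intro allI impI)
      fix k assume "k \<ge> degree p"
      then consider "k = degree p" | "k > degree p" by linarith
      then show "coeff (p - ?q) k = 0"
        by cases (use lead deg in \<open>auto simp: coeff_eq_0\<close>)
    qed
  qed
  then show ?thesis using assms by linarith
qed

lemma diffs_poly_eq_0:
  fixes p :: "complex poly"
  assumes "degree p < n"
  shows "diffs d n (\<lambda>i. poly p (of_int i)) x = 0"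
  using assms
proof (induction n arbitrary: p x)
  case (Suc n)
  let ?q = "p - pcompose p [:of_int d, 1:]"
  have zero: "diffs d m (\<lambda>i. 0) y = 0" for m y
    by (simp add: diffs_binomial)
  have "diffs d (Suc n) (\<lambda>i. poly p (of_int i)) x = diffs d n (\<lambda>i. poly ?q (of_int i)) x"
    unfolding diffs_Suc_inner by (simp add: poly_pcompose algebra_simps)
  also have "\<dots> = 0"
    using degree_difference_less[OF Suc.prems, of "of_int d"]
  proof
    assume "degree ?q < n"
    then show ?thesis by (rule Suc.IH)
  next
    assume "?q = 0"
    then show ?thesis by (simp only: poly_0 zero)
  qed
  finally show ?case .
qed simp

abbreviation node_weight :: "int set \<Rightarrow> int \<Rightarrow> complex" where
  "node_weight S k \<equiv> \<Prod>j\<in>S - {k}. of_int k - of_int j"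

definition lagrange :: "int set \<Rightarrow> (int \<Rightarrow> complex) \<Rightarrow> complex poly" where
  "lagrange S v = (\<Sum>k\<in>S. smult (v k / (node_weight S k))
     (\<Prod>j\<in>S - {k}. [:- of_int j, 1:]))"

lemma degree_prod_linear:
  "finite S \<Longrightarrow> degree (\<Prod>j\<in>S. [:- of_int j, 1::complex:]) = card S"
  by (subst degree_prod_eq_sum_degree) auto

lemma poly_prod_linear:
  "poly (\<Prod>j\<in>S. [:- of_int j, 1::complex:]) z = (\<Prod>j\<in>S. z - of_int j)"
  by (simp add: poly_prod)

lemma prod_int_diff_neq_0:
  "finite S \<Longrightarrow> (node_weight S k :: complex) \<noteq> 0"
  by (auto simp: prod_zero_iff)

lemma poly_lagrange:
  "poly (lagrange S v) z = (\<Sum>k\<in>S. v k / (node_weight S k) * (\<Prod>j\<in>S - {k}. z - of_int j))"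
  unfolding lagrange_def by (simp add: poly_sum poly_prod_linear)

lemma degree_lagrange_less:
  assumes "finite S" "S \<noteq> {}"
  shows "degree (lagrange S v) < card S"
proof -
  have "degree (lagrange S v) \<le> card S - 1"
    unfolding lagrange_def
  proof (rule degree_sum_le [OF assms(1)])
    fix k assume k: "k \<in> S"
    show "degree (smult (v k / (node_weight S k))
        (\<Prod>j\<in>S - {k}. [:- of_int j, 1:])) \<le> card S - 1"
      by (rule order_trans [OF degree_smult_le])
        (use assms k in \<open>simp add: degree_prod_linear\<close>)
  qed
  then show ?thesis
    using assms card_gt_0_iff[of S] by linarith
qed

lemma poly_lagrange_node:
  assumes "finite S" "k \<in> S"
  shows "poly (lagrange S v) (of_int k) = v k"
proof -
  have "poly (lagrange S v) (of_int k) =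
      (\<Sum>i\<in>S. if i = k then v k else 0)"
    unfolding poly_lagrange
  proof (rule sum.cong [OF refl])
    fix i assume i: "i \<in> S"
    show "v i / (node_weight S i) * (\<Prod>j\<in>S - {i}. of_int k - of_int j) =
        (if i = k then v k else 0)"
    proof (cases "i = k")
      case True
      then show ?thesis using prod_int_diff_neq_0[OF assms(1), of k] by simp
    next
      case False
      then have "(\<Prod>j\<in>S - {i}. of_int k - of_int j :: complex) = 0"
        using assms by (intro prod_zero) auto
      then show ?thesis using False by simp
    qed
  qed
  then show ?thesis using assms by simp
qed

lemma poly_eq_by_int_nodes:
  fixes p q :: "complex poly"
  assumes "finite S" "degree p < card S" "degree q < card S"
    and "\<And>k. k \<in> S \<Longrightarrow> poly p (of_int k) = poly q (of_int k)"
  shows "p = q"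
proof (rule poly_eqI_degree)
  have "card (of_int ` S :: complex set) = card S"
    by (rule card_image) (simp add: inj_on_def)
  then show "degree p < card (of_int ` S :: complex set)" "degree q < card (of_int ` S :: complex set)"
    using assms by auto
qed (use assms in auto)

text \<open>
  The sum is the leading coefficient of the Lagrange interpolation polynomial, which is \<open>p\<close> itself.
  It plays the role of the theorem that the residues of \<open>p(z) / \<Prod>j\<in>S. (z - j)\<close> add up to minus the
  residue at infinity.
\<close>

lemma sum_poly_over_node_products:
  fixes p :: "complex poly"
  assumes "finite S" "degree p < card S"
  shows "(\<Sum>k\<in>S. poly p (of_int k) / (node_weight S k)) = coeff p (card S - 1)"
proof -
  have "S \<noteq> {}" using assms by auto
  have "p = lagrange S (\<lambda>k. poly p (of_int k))"
    using assms \<open>S \<noteq> {}\<close>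
    by (intro poly_eq_by_int_nodes[of S]) (auto simp: poly_lagrange_node degree_lagrange_less)
  then have "coeff p (card S - 1) = coeff (lagrange S (\<lambda>k. poly p (of_int k))) (card S - 1)"
    by simp
  also have "\<dots> = (\<Sum>k\<in>S. poly p (of_int k) / (node_weight S k))"
    unfolding lagrange_def coeff_sum
  proof (rule sum.cong [OF refl])
    fix k assume k: "k \<in> S"
    have "coeff (\<Prod>j\<in>S - {k}. [:- of_int j, 1::complex:]) (card S - 1) = 1"
      using degree_prod_linear[of "S - {k}"] k assms
        lead_coeff_prod[of "\<lambda>j. [:- of_int j, 1::complex:]" "S - {k}"]
      by simp
    then show "coeff (smult (poly p (of_int k) / (node_weight S k))
        (\<Prod>j\<in>S - {k}. [:- of_int j, 1:])) (card S - 1) =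
        poly p (of_int k) / (node_weight S k)"
      by simp
  qed
  finally show ?thesis by simp
qed


section \<open>Square linear systems\<close>

text \<open>
  Gaussian elimination: an equation with a nonzero coefficient is solved for one unknown, which is
  then eliminated from the remaining equations.
\<close>

lemma homogeneous_system_nontrivial:
  fixes a :: "'i \<Rightarrow> 'j \<Rightarrow> 'k::field"
  assumes "finite I" "finite J" "card I < card J"
  shows "\<exists>v. (\<exists>j\<in>J. v j \<noteq> 0) \<and> (\<forall>i\<in>I. (\<Sum>j\<in>J. a i j * v j) = 0)"
  using assms
proof (induction I arbitrary: J a rule: finite_induct)
  case empty
  then obtain j where "j \<in> J" by fastforce
  then show ?case by (intro exI[of _ "\<lambda>_. 1"]) auto
next
  case (insert i I)
  show ?case
  proof (cases "\<forall>j\<in>J. a i j = 0")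
    case True
    have "card I < card J" using insert by simp
    from insert.IH[OF insert.prems(1) this, of a] True show ?thesis by auto
  next
    case False
    then obtain l where l: "l \<in> J" "a i l \<noteq> 0" by auto
    let ?J = "J - {l}"
    let ?a = "\<lambda>i' j. a i' j - a i' l * a i j / a i l"
    have "card I < card ?J" "finite ?J" using insert l by auto
    from insert.IH[OF this(2,1), of ?a] obtain v where
      v: "\<exists>j\<in>?J. v j \<noteq> 0" "\<And>i'. i' \<in> I \<Longrightarrow> (\<Sum>j\<in>?J. ?a i' j * v j) = 0" by blast
    define s where "s = (\<Sum>j\<in>?J. a i j * v j)"
    define u where "u = (\<lambda>j. if j = l then - s / a i l else v j)"
    have split: "(\<Sum>j\<in>J. a i' j * u j) = - a i' l * s / a i l + (\<Sum>j\<in>?J. a i' j * v j)" for i'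
    proof -
      have "(\<Sum>j\<in>J. a i' j * u j) = a i' l * u l + (\<Sum>j\<in>?J. a i' j * u j)"
        using l insert.prems by (simp add: sum.remove)
      also have "(\<Sum>j\<in>?J. a i' j * u j) = (\<Sum>j\<in>?J. a i' j * v j)"
        by (rule sum.cong) (auto simp: u_def)
      finally show ?thesis by (simp add: u_def)
    qed
    have "(\<Sum>j\<in>J. a i' j * u j) = 0" if "i' \<in> I" for i'
    proof -
      have "(\<Sum>j\<in>?J. ?a i' j * v j) = (\<Sum>j\<in>?J. a i' j * v j) - (a i' l / a i l) * s"
        unfolding s_def sum_distrib_left sum_subtractf [symmetric]
        by (rule sum.cong) (auto simp: algebra_simps)
      then show ?thesis using v(2)[OF that] unfolding split by (simp add: algebra_simps)
    qed
    moreover have "(\<Sum>j\<in>J. a i j * u j) = 0"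
      unfolding split using l by (simp add: s_def)
    moreover have "\<exists>j\<in>J. u j \<noteq> 0"
      using v(1) by (auto simp: u_def)
    ultimately show ?thesis by (intro exI[of _ u]) auto
  qed
qed

lemma square_matrix_two_sided_inverse:
  fixes a :: "'i \<Rightarrow> 'j \<Rightarrow> 'k::field"
  assumes fin: "finite I" "finite J" "card I = card J"
    and ker: "\<And>v. \<forall>i\<in>I. (\<Sum>j\<in>J. a i j * v j) = 0 \<Longrightarrow> \<forall>j\<in>J. v j = 0"
  shows "\<exists>r. (\<forall>i\<in>I. \<forall>i'\<in>I. (\<Sum>j\<in>J. a i j * r j i') = (if i = i' then 1 else 0)) \<and>
    (\<forall>j\<in>J. \<forall>j'\<in>J. (\<Sum>i\<in>I. r j i * a i j') = (if j = j' then 1 else 0))"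
proof -
  have "\<exists>v. \<forall>i\<in>I. (\<Sum>j\<in>J. a i j * v j) = (if i = i' then 1 else 0)" if i': "i' \<in> I" for i'
  proof -
    \<comment> \<open>One unknown more than equations: adjoin the unit vector at \<open>i'\<close> as a further column.\<close>
    let ?b = "\<lambda>i j'. case j' of None \<Rightarrow> (if i = i' then -1 else 0) | Some j \<Rightarrow> a i j"
    have "card I < card (insert None (Some ` J))"
      using fin by (simp add: card_image)
    then obtain v where v: "\<exists>j\<in>insert None (Some ` J). v j \<noteq> 0"
        "\<And>i. i \<in> I \<Longrightarrow> (\<Sum>j\<in>insert None (Some ` J). ?b i j * v j) = 0"
      using homogeneous_system_nontrivial[of I "insert None (Some ` J)" ?b] fin by auto
    have eq: "(\<Sum>j\<in>J. a i j * v (Some j)) = (if i = i' then v None else 0)" if "i \<in> I" for i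
      using v(2)[OF that] fin by (auto simp: sum.reindex split: if_splits)
    have "v None \<noteq> 0"
    proof
      assume "v None = 0"
      then have "v (Some j) = 0" if "j \<in> J" for j
        using ker[of "\<lambda>j. v (Some j)"] eq that by auto
      then show False using v(1) \<open>v None = 0\<close> by auto
    qed
    then show ?thesis
      using eq by (intro exI[of _ "\<lambda>j. v (Some j) / v None"])
        (simp add: sum_divide_distrib [symmetric])
  qed
  then have "\<forall>i'\<in>I. \<exists>v. \<forall>i\<in>I. (\<Sum>j\<in>J. a i j * v j) = (if i = i' then 1 else 0)"
    by (rule ballI)
  then obtain r' where r': "\<forall>i'\<in>I. \<forall>i\<in>I.
      (\<Sum>j\<in>J. a i j * r' i' j) = (if i = i' then 1 else 0)"
    by (rule bchoice [THEN exE])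
  define r where "r = (\<lambda>j i. r' i j)"
  have r: "(\<Sum>j\<in>J. a i j * r j i') = (if i = i' then 1 else 0)" if "i \<in> I" "i' \<in> I" for i i'
    using r' that by (simp add: r_def)
  have "\<forall>j\<in>J. (\<Sum>i\<in>I. r j i * a i j') - (if j = j' then 1 else 0) = 0" if j': "j' \<in> J" for j'
  proof (rule ker, rule ballI)
    fix i assume i: "i \<in> I"
    have "(\<Sum>j\<in>J. a i j * (\<Sum>i'\<in>I. r j i' * a i' j')) =
        (\<Sum>j\<in>J. \<Sum>i'\<in>I. a i j * r j i' * a i' j')"
      by (simp add: sum_distrib_left mult.assoc)
    also have "\<dots> = (\<Sum>i'\<in>I. (\<Sum>j\<in>J. a i j * r j i') * a i' j')"
      unfolding sum_distrib_right by (rule sum.swap)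
    also have "(\<Sum>i'\<in>I. (\<Sum>j\<in>J. a i j * r j i') * a i' j') = (\<Sum>i'\<in>I. if i = i' then a i' j' else 0)"
      by (rule sum.cong) (auto simp: r i)
    also have "\<dots> = a i j'" using fin i by simp
    finally have "(\<Sum>j\<in>J. a i j * (\<Sum>i'\<in>I. r j i' * a i' j')) = a i j'" .
    moreover have "(\<Sum>j\<in>J. a i j * (if j = j' then 1 else 0)) = a i j'"
      using fin j' by (simp add: if_distrib cong: if_cong)
    ultimately show "(\<Sum>j\<in>J. a i j * ((\<Sum>i\<in>I. r j i * a i j') - (if j = j' then 1 else 0))) = 0"
      unfolding right_diff_distrib sum_subtractf by simp
  qed
  with r show ?thesis by (intro exI[of _ r]) auto
qed


section \<open>Contours and simple poles\<close>

lemma ccw_contour_winding_number: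
  assumes "ccw_contour \<gamma>"
  shows "z \<in> inside (path_image \<gamma>) \<Longrightarrow> winding_number \<gamma> z = 1"
    and "z \<in> outside (path_image \<gamma>) \<Longrightarrow> winding_number \<gamma> z = 0"
  using assms winding_number_zero_in_outside valid_path_imp_path
  by (auto simp: ccw_contour_def)

lemma inside_outside_not_on_path:
  "z \<in> inside T \<Longrightarrow> z \<notin> T" "z \<in> outside T \<Longrightarrow> z \<notin> T"
  using inside_no_overlap outside_no_overlap by blast+

lemma contour_integral_simple_poles:
  assumes \<gamma>: "valid_path \<gamma>" "pathfinish \<gamma> = pathstart \<gamma>"
    and S: "finite S" "S \<inter> path_image \<gamma> = {}"
    and \<phi>: "\<phi> holomorphic_on UNIV"
  shows "contour_integral \<gamma> (\<lambda>z. \<phi> z / (\<Prod>a\<in>S. z - a)) =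
    2 * of_real pi * \<i> * (\<Sum>a\<in>S. winding_number \<gamma> a * (\<phi> a / (\<Prod>b\<in>S - {a}. a - b)))"
proof -
  let ?f = "\<lambda>z. \<phi> z / (\<Prod>a\<in>S. z - a)"
  have res: "residue ?f a = \<phi> a / (\<Prod>b\<in>S - {a}. a - b)" if a: "a \<in> S" for a
  proof -
    let ?h = "\<lambda>z. \<phi> z / (\<Prod>b\<in>S - {a}. z - b)"
    have "?f = (\<lambda>z. ?h z / (z - a))"
      using a S by (auto simp: prod.remove mult.commute)
    moreover have "residue (\<lambda>z. ?h z / (z - a)) a = ?h a"
    proof (rule residue_simple[of "- (S - {a})"])
      show "?h holomorphic_on - (S - {a})"
        by (intro holomorphic_intros holomorphic_on_subset[OF \<phi>]) (use S in auto)
      show "open (- (S - {a}))" using S by (intro open_Compl finite_imp_closed) auto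
    qed auto
    ultimately show ?thesis by simp
  qed
  have "contour_integral \<gamma> ?f = 2 * pi * \<i> * (\<Sum>a\<in>S. winding_number \<gamma> a * residue ?f a)"
  proof (rule Residue_theorem)
    show "?f holomorphic_on UNIV - S"
      by (intro holomorphic_intros holomorphic_on_subset[OF \<phi>]) (use S in auto)
  qed (use assms in auto)
  then show ?thesis by (simp add: mult.assoc res)
qed

text \<open>
  The point is the centre of the star-shaped domain of the next lemma: being off every line through a
  point of \<open>B\<close> and a point of \<open>K\<close>, it does not see any point of \<open>K\<close> behind a point of \<open>B\<close>.
\<close>

lemma exists_off_lines:
  fixes B K :: "complex set"
  assumes "finite B" "finite K"
  obtains c where "c \<notin> B" "\<And>b k t. b \<in> B \<Longrightarrow> k \<in> K \<Longrightarrow> c \<noteq> of_real t * b + of_real (1 - t) * k"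
proof -
  obtain r where r: "r \<notin> Re ` (B \<union> K)"
    using ex_new_if_finite[of "Re ` (B \<union> K)"] assms infinite_UNIV_char_0 by blast
  \<comment> \<open>A non-vertical line meets the vertical line \<open>Re = r\<close> in exactly one point.\<close>
  define h where "h = (\<lambda>(b, k). let t = (r - Re k) / (Re b - Re k) in t * Im b + (1 - t) * Im k)"
  obtain y where y: "y \<notin> h ` (B \<times> K)"
    using ex_new_if_finite[of "h ` (B \<times> K)"] assms infinite_UNIV_char_0 by blast
  show thesis
  proof (rule that[of "Complex r y"])
    show "Complex r y \<notin> B" using r by force
    fix b k t assume bk: "b \<in> B" "k \<in> K"
    show "Complex r y \<noteq> of_real t * b + of_real (1 - t) * k"
    proof
      assume eq: "Complex r y = of_real t * b + of_real (1 - t) * k"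
      have re: "r = t * Re b + (1 - t) * Re k" and im: "y = t * Im b + (1 - t) * Im k"
        using arg_cong[OF eq, of Re] arg_cong[OF eq, of Im] by simp_all
      have ne: "Re b \<noteq> Re k"
      proof
        assume "Re b = Re k"
        then have "r = Re k" using re by (simp add: algebra_simps)
        then show False using r bk by auto
      qed
      then have "t = (r - Re k) / (Re b - Re k)"
        using re by (simp add: field_simps)
      then have "y = h (b, k)" using im by (simp add: h_def Let_def)
      then show False using y bk by auto
    qed
  qed
qed

text \<open>
  From the plane remove, for each \<open>b\<close> in \<open>B\<close>, the part of the ray from the centre \<open>c\<close> through \<open>b\<close> that
  starts at \<open>b\<close>.
\<close>

lemma exists_starlike_separating:
  fixes B K :: "complex set"
  assumes fin: "finite B" "finite K" and disj: "B \<inter> K = {}"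
  obtains S where "open S" "starlike S" "K \<subseteq> S" "B \<inter> S = {}"
proof -
  obtain c where c: "c \<notin> B"
    "\<And>b k t. b \<in> B \<Longrightarrow> k \<in> K \<Longrightarrow> c \<noteq> of_real t * b + of_real (1 - t) * k"
    using exists_off_lines[OF fin] by blast
  define ray where "ray b = (\<lambda>w. c + w) ` (\<lambda>t. t *\<^sub>R (b - c)) ` {1::real..}" for b
  have in_ray: "w \<in> ray b \<longleftrightarrow> (\<exists>t\<ge>1. w = c + of_real t * (b - c))" for w b
    by (auto simp: ray_def scaleR_conv_of_real)
  define S where "S = - (\<Union>b\<in>B. ray b)"
  have closed_ray: "closed (ray b)" if "b \<in> B" for b
  proof -
    have "b - c \<noteq> 0" using c that by auto
    then have "closed ((\<lambda>t. t *\<^sub>R (b - c)) ` {1::real..})"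
      by (intro closed_injective_linear_image) (auto simp: inj_on_def intro!: linearI algebra_simps)
    then show ?thesis unfolding ray_def by (rule closed_translation)
  qed
  show thesis
  proof (rule that[of S])
    show "open S" unfolding S_def using fin closed_ray by (intro open_Compl closed_UN) auto
    show "K \<subseteq> S"
    proof
      fix k assume k: "k \<in> K"
      show "k \<in> S" unfolding S_def
      proof (clarsimp simp: in_ray)
        fix b t assume b: "b \<in> B" and t: "(1::real) \<le> t" and eq: "k = c + of_real t * (b - c)"
        have "t \<noteq> 1" using eq b k disj by auto
        have "c * of_real (1 - t) = k - of_real t * b" using eq by (simp add: algebra_simps)
        then have "c = (k - of_real t * b) / of_real (1 - t)"
          using \<open>t \<noteq> 1\<close> by (simp add: field_simps del: of_real_diff)
        also have "\<dots> = of_real (- t / (1 - t)) * b + of_real (1 / (1 - t)) * k"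
          using \<open>t \<noteq> 1\<close> by (simp add: diff_divide_distrib del: of_real_diff)
        also have "1 / (1 - t) = 1 - (- t / (1 - t))"
          using \<open>t \<noteq> 1\<close> by (simp add: field_simps)
        finally show False using c(2)[OF b k] by blast
      qed
    qed
    show "B \<inter> S = {}"
    proof -
      have "b \<in> ray b" for b unfolding in_ray by (intro exI[of _ 1]) simp
      then show ?thesis unfolding S_def by auto
    qed
    show "starlike S" unfolding starlike_def
    proof (intro bexI[of _ c] ballI subsetI)
      show "c \<in> S" unfolding S_def in_ray using c(1) by (auto simp: in_ray)
      fix w v assume w: "w \<in> S" and v: "v \<in> closed_segment c w"
      from v obtain s where s: "0 \<le> s" "s \<le> 1" and veq: "v = c + of_real s * (w - c)"
        by (auto simp: in_segment scaleR_conv_of_real algebra_simps)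
      show "v \<in> S" unfolding S_def
      proof (clarsimp simp: in_ray)
        fix b t assume b: "b \<in> B" and t: "(1::real) \<le> t" and "v = c + of_real t * (b - c)"
        then have eq: "of_real s * (w - c) = of_real t * (b - c)" using veq by simp
        have "s \<noteq> 0"
        proof
          assume "s = 0"
          then have "b = c" using eq t by auto
          then show False using b c(1) by simp
        qed
        then have "w = c + of_real (t / s) * (b - c)"
          using eq by (simp add: field_simps)
        moreover have "t / s \<ge> 1" using s t \<open>s \<noteq> 0\<close> by (simp add: field_simps)
        ultimately have "w \<in> ray b" unfolding in_ray by blast
        then show False using w b unfolding S_def by blast
      qed
    qed
  qed
qed

text \<open>
  The image of the open disc is connected and relatively clopen in the complement of the image of the
  circle, because the image of the closed disc is compact. So it is a bounded component.
\<close>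

lemma biholomorphic_circle_inside:
  assumes f: "f holomorphic_on S" and g: "g holomorphic_on ball 0 1" and S: "open S"
    and fg: "\<And>z. z \<in> S \<Longrightarrow> f z \<in> ball 0 1 \<and> g (f z) = z"
    and gf: "\<And>z. z \<in> ball 0 1 \<Longrightarrow> g z \<in> S \<and> f (g z) = z"
    and r: "0 < r" "r < 1"
  shows "g ` ball 0 r \<subseteq> inside (g ` sphere 0 r)"
proof
  fix k assume k: "k \<in> g ` ball 0 r"
  let ?\<Gamma> = "g ` sphere 0 r" and ?U = "g ` ball 0 r" and ?V = "g ` cball 0 r"
  have sub: "ball (0::complex) r \<subseteq> ball 0 1" "cball (0::complex) r \<subseteq> ball 0 1" "sphere (0::complex) r \<subseteq> ball 0 1"
    using r by auto
  have inj: "inj_on g (ball 0 1)" using gf by (metis inj_onI)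
  have "?U = S \<inter> f -` ball 0 r"
    using fg gf sub(1) by (auto simp: image_iff) (metis mem_ball_0)
  then have "open ?U"
    using continuous_open_preimage[OF holomorphic_on_imp_continuous_on[OF f] S, of "ball 0 r"] by simp
  have "compact ?V"
    by (intro compact_continuous_image holomorphic_on_imp_continuous_on holomorphic_on_subset[OF g] sub) auto
  then have "closed ?V" by (rule compact_imp_closed)
  have VU: "?V = ?U \<union> ?\<Gamma>"
    unfolding image_Un [symmetric] by (rule arg_cong[of _ _ "image g"]) auto
  have disj: "?U \<inter> ?\<Gamma> = {}"
    using inj sub by (auto simp: inj_on_def) (metis dist_0_norm mem_ball mem_sphere order_less_irrefl subsetD sub(1) sub(3))
  let ?C = "connected_component_set (- ?\<Gamma>) k"
  have kG: "k \<in> - ?\<Gamma>" using k disj by auto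
  have "?C \<subseteq> ?U"
  proof (rule ccontr)
    assume "\<not> ?C \<subseteq> ?U"
    have cov: "?C \<subseteq> ?U \<union> - ?V"
      using VU connected_component_subset[of "- ?\<Gamma>" k] by auto
    have "?U \<inter> ?C \<noteq> {}" using k kG by auto
    moreover have "- ?V \<inter> ?C \<noteq> {}"
      using cov \<open>\<not> ?C \<subseteq> ?U\<close> by blast
    moreover have "?U \<inter> - ?V \<inter> ?C = {}" using VU by auto
    moreover have "connected ?C" by simp
    ultimately show False
      using connectedD[OF _ \<open>open ?U\<close> open_Compl[OF \<open>closed ?V\<close>] _ cov] by blast
  qed
  then have "bounded ?C"
    using VU by (intro bounded_subset[OF compact_imp_bounded[OF \<open>compact ?V\<close>]]) blast
  then show "k \<in> inside ?\<Gamma>" using kG by (simp add: inside_def)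
qed

text \<open>
  The contour is the image of a circle under a Riemann map onto a star-shaped domain that contains \<open>K\<close>
  and avoids \<open>B\<close>. This generality matters: the argument of \<open>f_fun\<close> runs over an arbitrary contour, which
  may cross the real axis between two of the poles that have to be enclosed.
\<close>

lemma exists_ccw_contour_separating:
  fixes B K :: "complex set"
  assumes fin: "finite B" "finite K" and disj: "B \<inter> K = {}" and ne: "B \<noteq> {}" "K \<noteq> {}"
  obtains \<gamma> where "ccw_contour \<gamma>" "K \<subseteq> inside (path_image \<gamma>)" "B \<subseteq> outside (path_image \<gamma>)"
proof -
  obtain S where S: "open S" "starlike S" "K \<subseteq> S" "B \<inter> S = {}"
    using exists_starlike_separating[OF fin disj] .
  have sc: "simply_connected S" using S starlike_imp_simply_connected by blast
  have "S \<noteq> {}" "S \<noteq> UNIV" using S ne by auto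
  then obtain f g where f: "f holomorphic_on S" and g: "g holomorphic_on ball 0 1"
    and fg: "\<And>z. z \<in> S \<Longrightarrow> f z \<in> ball 0 1 \<and> g (f z) = z"
    and gf: "\<And>z. z \<in> ball 0 1 \<Longrightarrow> g z \<in> S \<and> f (g z) = z"
    using Riemann_mapping_theorem[of S] S sc by metis
  define m where "m = Max (insert 0 ((\<lambda>k. norm (f k)) ` K))"
  have m: "0 \<le> m" "\<And>k. k \<in> K \<Longrightarrow> norm (f k) \<le> m"
    unfolding m_def using fin by auto
  have "m < 1" unfolding m_def using fin fg S by (subst Max_less_iff) auto
  define r where "r = (1 + m) / 2"
  have r: "0 < r" "r < 1" "m < r" using m \<open>m < 1\<close> by (auto simp: r_def)
  define \<gamma> where "\<gamma> = g \<circ> circlepath 0 r"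
  have pim: "path_image \<gamma> = g ` sphere 0 r"
    unfolding \<gamma>_def path_image_compose using r by simp
  have sph: "sphere (0::complex) r \<subseteq> ball 0 1" using r by auto
  have val: "valid_path \<gamma>" unfolding \<gamma>_def
    by (rule valid_path_compose_holomorphic[OF _ g]) (use r sph in auto)
  have loop: "pathfinish \<gamma> = pathstart \<gamma>" by (simp add: \<gamma>_def pathfinish_compose pathstart_compose)
  have "loop_free \<gamma>"
  proof -
    have lf: "loop_free (circlepath 0 r)" using simple_path_circlepath[of 0 r] r by (simp add: simple_path_def)
    have norm_circ: "circlepath 0 r t \<in> ball 0 1" if "t \<in> {0..1}" for t
    proof -
      have "circlepath 0 r t \<in> path_image (circlepath 0 r)"
        using that unfolding path_image_def by blast
      then show ?thesis using r by simp
    qed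
    show ?thesis unfolding loop_free_def
    proof (intro ballI impI)
      fix s t assume st: "s \<in> {0..1::real}" "t \<in> {0..1::real}" "\<gamma> s = \<gamma> t"
      then have "circlepath 0 r s = circlepath 0 r t"
        using gf norm_circ unfolding \<gamma>_def by (metis comp_apply)
      then show "s = t \<or> s = 0 \<and> t = 1 \<or> s = 1 \<and> t = 0"
        using lf st unfolding loop_free_def by blast
    qed
  qed
  then have simp: "simple_path \<gamma>" using val valid_path_imp_path by (simp add: simple_path_def)
  have "K \<subseteq> g ` ball 0 r"
  proof
    fix k assume "k \<in> K"
    then have "f k \<in> ball 0 r" "g (f k) = k" using m(2)[of k] r fg S by auto
    then show "k \<in> g ` ball 0 r" by (metis imageI)
  qed
  then have K: "K \<subseteq> inside (path_image \<gamma>)"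
    unfolding pim using biholomorphic_circle_inside[OF f g S(1) fg gf r(1,2)] by auto
  have "path_image \<gamma> \<subseteq> S" unfolding pim using gf sph by auto
  have B: "B \<subseteq> outside (path_image \<gamma>)"
  proof
    fix b assume "b \<in> B"
    then have "b \<notin> S" using S by auto
    then have "winding_number \<gamma> b = 0"
      using simply_connected_imp_winding_number_zero[OF sc] val loop valid_path_imp_path \<open>path_image \<gamma> \<subseteq> S\<close> by blast
    then have "b \<notin> inside (path_image \<gamma>)"
      using simple_closed_path_norm_winding_number_inside[OF simp, of b] by auto
    then show "b \<in> outside (path_image \<gamma>)"
      using \<open>b \<notin> S\<close> \<open>path_image \<gamma> \<subseteq> S\<close> inside_Un_outside[of "path_image \<gamma>"] by blast
  qed
  show thesis
  proof (rule simple_closed_path_winding_number_inside[OF simp])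
    assume "\<And>z. z \<in> inside (path_image \<gamma>) \<Longrightarrow> winding_number \<gamma> z = 1"
    then have "ccw_contour \<gamma>" using val simp loop by (simp add: ccw_contour_def)
    then show thesis using that K B by blast
  next
    assume w: "\<And>z. z \<in> inside (path_image \<gamma>) \<Longrightarrow> winding_number \<gamma> z = -1"
    have "winding_number (reversepath \<gamma>) z = 1" if "z \<in> inside (path_image \<gamma>)" for z
      using w[OF that] winding_number_reversepath[of \<gamma> z] valid_path_imp_path[OF val] inside_outside_not_on_path(1)[OF that]
      by simp
    then have "ccw_contour (reversepath \<gamma>)"
      using val simp loop by (simp add: ccw_contour_def simple_path_reversepath valid_path_reversepath)
    then show thesis using that[of "reversepath \<gamma>"] K B by simp
  qed
qed


section \<open>Newton's interpolation formula\<close>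

text \<open>
  The Newton form of the interpolation polynomial of \<open>p\<close> at the nodes \<open>y, y - 1, \<dots>, y - m + 1\<close>.
\<close>

definition newton :: "(int \<Rightarrow> complex) \<Rightarrow> nat \<Rightarrow> int \<Rightarrow> complex \<Rightarrow> complex" where
  "newton p m y z = (\<Sum>j<m. pochhammer (z - of_int y) j * diffs (-1) j p y / fact j)"

lemma newton_Suc:
  "newton p (Suc m) y z = newton p m y z + pochhammer (z - of_int y) m * diffs (-1) m p y / fact m"
  by (simp add: newton_def)

text \<open>
  Appending a node at the far end only appends a summand (\<open>newton_Suc\<close>), whereas removing the first
  node changes every summand; the total change is still a divided difference times a product of linear
  factors, since interpolation polynomials do not depend on the order of the nodes.
\<close>

lemma newton_drop_first_node:
  "newton p (Suc m) y z =
    newton p m (y - 1) z + pochhammer (z - of_int y + 1) m * diffs (-1) m p y / fact m"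
proof (induction m)
  case 0
  show ?case by (simp add: newton_def)
next
  case (Suc m)
  define u where "u = z - of_int y"
  define a where "a = diffs (-1) m p y"
  define b where "b = diffs (-1) m p (y - 1)"
  have gen: "q * a / r + u * q * (a - b) / (c * r) = q * b / r + q * (u + c) * (a - b) / (c * r)"
    if "r \<noteq> 0" "c \<noteq> 0" for q r c :: complex
    using that by (simp add: field_simps)
  have c: "(1 + of_nat m :: complex) \<noteq> 0" using of_nat_neq_0[of m, where ?'a = complex] by simp
  have f: "fact (Suc m) = (1 + of_nat m) * (fact m :: complex)" by (simp add: fact_Suc)
  have "newton p (Suc (Suc m)) y z = newton p m (y - 1) z +
      (pochhammer (u + 1) m * a / fact m + u * pochhammer (u + 1) m * (a - b) / ((1 + of_nat m) * fact m))"
    unfolding newton_Suc[of p "Suc m"] Suc.IH f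
    by (simp add: u_def a_def b_def pochhammer_rec[of "z - of_int y"])
  also have "\<dots> = newton p (Suc m) (y - 1) z +
      pochhammer (u + 1) m * (u + (1 + of_nat m)) * (a - b) / ((1 + of_nat m) * fact m)"
    unfolding gen[OF fact_nonzero c] by (simp add: newton_Suc u_def b_def algebra_simps)
  also have "pochhammer (u + 1) m * (u + (1 + of_nat m)) = pochhammer (u + 1) (Suc m)"
    by (simp only: pochhammer_Suc add.assoc)
  finally show ?case unfolding f by (simp add: u_def a_def b_def)
qed

lemma newton_node:
  assumes "y - int m < k" "k \<le> y"
  shows "newton p m y (of_int k) = p k"
  using assms
proof (induction m arbitrary: y)
  case (Suc m)
  show ?case
  proof (cases "k = y")
    case True
    have "newton p (Suc m) y (of_int y) = (\<Sum>j<Suc m. if j = 0 then p y else 0)"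
      unfolding newton_def by (rule sum.cong) (auto simp: pochhammer_0_left)
    then show ?thesis using True by simp
  next
    case False
    have "pochhammer (of_int k - of_int y + 1 :: complex) m = 0"
      unfolding pochhammer_eq_0_iff
    proof (intro exI conjI)
      show "nat (y - 1 - k) < m" using Suc.prems False by linarith
      have "of_nat (nat (y - 1 - k)) = (of_int (y - 1 - k) :: complex)" using Suc.prems False by simp
      then show "of_int k - of_int y + 1 = (- of_nat (nat (y - 1 - k)) :: complex)"
        by simp
    qed
    then show ?thesis
      using Suc False by (simp add: newton_drop_first_node)
  qed
qed simp

text \<open>
  Newton's formula for the function \<open>z1 \<mapsto> 1 / (z2 - z1)\<close>: the left-hand side is its interpolation
  polynomial at the zeros of the Pochhammer polynomial in \<open>z1\<close>.
\<close>

lemma newton_kernel: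
  fixes z1 z2 :: complex
  assumes "z1 \<noteq> z2" "pochhammer (z2 - a) m \<noteq> 0"
  shows "1 / (z1 - z2) * (pochhammer (z1 - a) m / pochhammer (z2 - a) m - 1) =
    (\<Sum>j<m. pochhammer (z1 - a) j / pochhammer (z2 - a) (Suc j))"
  using assms(2)
proof (induction m)
  case (Suc m)
  let ?P = "pochhammer (z1 - a)" and ?Q = "pochhammer (z2 - a)"
  have Q: "?Q (Suc m) = ?Q m * (z2 - a + of_nat m)" "?P (Suc m) = ?P m * (z1 - a + of_nat m)"
    by (simp_all add: pochhammer_Suc)
  then have nz: "?Q m \<noteq> 0" "z2 - a + of_nat m \<noteq> 0" using Suc.prems by auto
  have "1 / (z1 - z2) * (?P (Suc m) / ?Q (Suc m) - 1) =
      1 / (z1 - z2) * (?P m / ?Q m - 1) + ?P m / ?Q (Suc m)"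
  proof -
    have "?P (Suc m) / ?Q (Suc m) - ?P m / ?Q m = (z1 - z2) * (?P m / ?Q (Suc m))"
    proof -
      have gen: "s * c / (t * d) - s / t = (c - d) * (s / (t * d))" if "t \<noteq> 0" "d \<noteq> 0" for s t c d :: complex
        using that by (simp add: field_simps)
      show ?thesis unfolding Q using gen[OF nz, of "?P m" "z1 - a + of_nat m"] by simp
    qed
    then show ?thesis using assms(1) by (simp add: field_simps)
  qed
  also have "1 / (z1 - z2) * (?P m / ?Q m - 1) = (\<Sum>j<m. ?P j / ?Q (Suc j))"
    using Suc.IH nz by simp
  finally show ?case by simp
qed simp

lemma poly_holomorphic: "poly p holomorphic_on S"
  by (auto simp: holomorphic_on_def field_differentiable_def intro!: exI DERIV_subset[OF poly_DERIV])

text \<open>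
  The base case is Cauchy's formula. The integrals obey the recursion of divided differences by
  \<open>1 / (z - y)_(j + 1) - 1 / (z - y + 1)_(j + 1) = (j + 1) / (z - y)_(j + 2)\<close>.
\<close>

lemma has_contour_integral_divided_difference:
  fixes p :: "complex poly"
  assumes \<gamma>: "ccw_contour \<gamma>"
    and nodes: "\<And>i. y - int j \<le> i \<Longrightarrow> i \<le> y \<Longrightarrow> of_int i \<in> inside (path_image \<gamma>)"
  shows "((\<lambda>z. poly p z / pochhammer (z - of_int y) (Suc j)) has_contour_integral
    2 * of_real pi * \<i> * (diffs (-1) j (\<lambda>i. poly p (of_int i)) y / fact j)) \<gamma>"
  using nodes
proof (induction j arbitrary: y)
  case 0
  let ?y = "of_int y :: complex"
  have y: "?y \<in> inside (path_image \<gamma>)" using 0 by auto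
  have "((\<lambda>w. poly p w / (w - ?y)) has_contour_integral
      (2 * pi * \<i> * winding_number \<gamma> ?y * poly p ?y)) \<gamma>"
  proof (rule Cauchy_integral_formula_convex_simple[where S = UNIV])
    show "path_image \<gamma> \<subseteq> UNIV - {?y}" using inside_outside_not_on_path(1)[OF y] by auto
  qed (use \<gamma> in \<open>auto simp: ccw_contour_def intro: poly_holomorphic\<close>)
  then show ?case using ccw_contour_winding_number(1)[OF \<gamma> y] by simp
next
  case (Suc j)
  let ?p = "\<lambda>i. poly p (of_int i)"
  let ?c = "2 * of_real pi * \<i> :: complex"
  have 1: "((\<lambda>z. poly p z / pochhammer (z - of_int y) (Suc j)) has_contour_integral
      ?c * (diffs (-1) j ?p y / fact j)) \<gamma>"
    by (rule Suc.IH) (use Suc.prems in auto)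
  have 2: "((\<lambda>z. poly p z / pochhammer (z - of_int (y - 1)) (Suc j)) has_contour_integral
      ?c * (diffs (-1) j ?p (y - 1) / fact j)) \<gamma>"
    by (rule Suc.IH) (use Suc.prems in auto)
  have 3: "((\<lambda>z. (poly p z / pochhammer (z - of_int y) (Suc j) - poly p z / pochhammer (z - of_int (y - 1)) (Suc j)) / of_nat (Suc j))
      has_contour_integral (?c * (diffs (-1) j ?p y / fact j) - ?c * (diffs (-1) j ?p (y - 1) / fact j)) / of_nat (Suc j)) \<gamma>"
    by (intro has_contour_integral_div has_contour_integral_diff 1 2)
  have val: "(?c * (diffs (-1) j ?p y / fact j) - ?c * (diffs (-1) j ?p (y - 1) / fact j)) / of_nat (Suc j) =
      ?c * (diffs (-1) (Suc j) ?p y / fact (Suc j))"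
    by (simp add: fact_Suc field_simps del: of_nat_Suc)
  show ?case
  proof (rule has_contour_integral_eq[OF 3[unfolded val]])
    fix z assume z: "z \<in> path_image \<gamma>"
    define u where "u = z - of_int y"
    have "of_int y \<in> inside (path_image \<gamma>)" "of_int (y - int (Suc j)) \<in> inside (path_image \<gamma>)"
      by (rule Suc.prems; linarith)+
    then have "z \<noteq> of_int y" "z \<noteq> of_int (y - int (Suc j))"
      using inside_outside_not_on_path(1) z by blast+
    moreover have "u + 1 + of_nat j = z - of_int (y - int (Suc j))" by (simp add: u_def)
    ultimately have nz: "u \<noteq> 0" "u + 1 + of_nat j \<noteq> 0"
      by (simp_all only: u_def right_minus_eq simp_thms)
    have sh: "z - of_int (y - 1) = u + 1" by (simp add: u_def)
    have q: "pochhammer u (Suc j) = u * pochhammer (u + 1) j"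
       "pochhammer (u + 1) (Suc j) = pochhammer (u + 1) j * (u + 1 + of_nat j)"
       "pochhammer u (Suc (Suc j)) = u * (pochhammer (u + 1) j * (u + 1 + of_nat j))"
      by (simp_all only: pochhammer_rec[of u] pochhammer_Suc[of "u + 1"])
    have "(of_nat (Suc j) :: complex) \<noteq> 0" by (rule of_nat_neq_0)
    then show "(poly p z / pochhammer (z - of_int y) (Suc j) - poly p z / pochhammer (z - of_int (y - 1)) (Suc j)) / of_nat (Suc j) =
        poly p z / pochhammer (z - of_int y) (Suc (Suc j))"
      unfolding sh u_def [symmetric] q using nz
      by (cases "pochhammer (u + 1) j = 0") (simp_all add: divide_simps, simp add: algebra_simps)
  qed
qed


section \<open>The interpolation polynomial behind the function f\<close>

definition interp_nodes :: "nat \<Rightarrow> int set" where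
  "interp_nodes A = {- 2 * int A..- int A - 1} \<union> {0..int A - 1}"

abbreviation node_prod :: "nat \<Rightarrow> complex \<Rightarrow> complex" where
  "node_prod A z \<equiv> pochhammer (- 2 * of_nat A - z) A * pochhammer (- z) A"

text \<open>
  The polynomial \<open>f_A(z) (-2A - z)_A (-z)_A\<close>, given by its values at the zeros of the Pochhammer factors.
  These are the residues of \<open>f_A\<close> divided by the residues of the reciprocal of the Pochhammer factors:
  the integral in \<open>f_A\<close> contributes \<open>1\<close> at \<open>0, \<dots>, A - 1\<close>, and the two explicit fractions contribute at
  \<open>A - 1\<close> and \<open>-2A\<close>.
\<close>

definition black_poly :: "nat \<Rightarrow> complex poly" where
  "black_poly A = lagrange (interp_nodes A) (\<lambda>k.
     if k = - 2 * int A then \<i> * cis (- pi / 6)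
     else if k < 0 then 0
     else if k = int A - 1 then 1 + \<i> * cis (pi / 6) else 1)"

lemma finite_interp_nodes [simp]: "finite (interp_nodes A)"
  by (simp add: interp_nodes_def)

lemma card_interp_nodes: "card (interp_nodes A) = 2 * A"
  unfolding interp_nodes_def by (subst card_Un_disjoint) auto

lemma prod_linear_interval:
  "(\<Prod>j\<in>{b - int m + 1..b}. z - of_int j) = (pochhammer (z - of_int b) m :: complex)"
proof (induction m)
  case (Suc m)
  have "{b - int (Suc m) + 1..b} = insert (b - int m) {b - int m + 1..b}" by auto
  then show ?case using Suc by (simp add: pochhammer_Suc algebra_simps)
qed simp

lemma prod_interp_nodes:
  fixes z :: complex
  shows "node_prod A z = (\<Prod>k\<in>interp_nodes A. z - of_int k)"
proof -
  have "(\<Prod>k\<in>interp_nodes A. z - of_int k) =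
      (\<Prod>k\<in>{- 2 * int A..- int A - 1}. z - of_int k) * (\<Prod>k\<in>{0..int A - 1}. z - of_int k)"
    unfolding interp_nodes_def by (rule prod.union_disjoint) auto
  also have "\<dots> = pochhammer (z + of_nat A + 1) A * pochhammer (z - of_nat A + 1) A"
    using prod_linear_interval[where b = "- int A - 1" and m = A and z = z]
      prod_linear_interval[where b = "int A - 1" and m = A and z = z]
    by (simp add: algebra_simps)
  also have "\<dots> = node_prod A z"
  proof -
    have 1: "pochhammer (- 2 * of_nat A - z) A = (-1) ^ A * pochhammer (z + of_nat A + 1) A"
    proof -
      have "- 2 * of_nat A - z = - (2 * of_nat A + z)" "2 * of_nat A + z - of_nat A + 1 = z + of_nat A + 1"
        by (simp_all add: algebra_simps)
      then show ?thesis using pochhammer_minus[of "2 * of_nat A + z" A] by metis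
    qed
    have 2: "pochhammer (- z) A = (-1) ^ A * pochhammer (z - of_nat A + 1) A"
      using pochhammer_minus[of z A] by (simp add: algebra_simps)
    have "(-1) ^ A * (-1) ^ A = (1 :: complex)"
      by (simp flip: power_mult_distrib)
    then have "(-1) ^ A * a * ((-1) ^ A * b) = a * b" for a b :: complex
      by (metis mult.assoc mult.left_commute mult_1)
    then show ?thesis unfolding 1 2 by simp
  qed
  finally show ?thesis by simp
qed

text \<open>
  The weight of the smallest node; it turns the last summand of \<open>f_fun\<close> into the value of \<open>black_poly\<close>
  at \<open>-2A\<close>.
\<close>

lemma f_weight_first:
  assumes "A > 0"
  shows "(\<Prod>j\<in>interp_nodes A - {- 2 * int A}. of_int (- 2 * int A) - of_int j) =
    (- (pochhammer (of_nat (2 * A)) A * fact (A - 1)) :: complex)"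
proof -
  let ?z = "of_int (- 2 * int A) :: complex"
  have "interp_nodes A - {- 2 * int A} = {- 2 * int A + 1..- int A - 1} \<union> {0..int A - 1}"
    using assms unfolding interp_nodes_def by auto
  then have "(\<Prod>j\<in>interp_nodes A - {- 2 * int A}. ?z - of_int j) =
      (\<Prod>j\<in>{- 2 * int A + 1..- int A - 1}. ?z - of_int j) * (\<Prod>j\<in>{0..int A - 1}. ?z - of_int j)"
    by (simp only:) (rule prod.union_disjoint, auto)
  also have "(\<Prod>j\<in>{- 2 * int A + 1..- int A - 1}. ?z - of_int j) = pochhammer (- (of_nat A - 1)) (A - 1)"
    using prod_linear_interval[where b = "- int A - 1" and m = "A - 1" and z = ?z] assms
    by (simp add: of_nat_diff algebra_simps)
  also have "\<dots> = (-1) ^ (A - 1) * fact (A - 1)"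
    using pochhammer_minus[of "of_nat A - 1 :: complex" "A - 1"] assms
    by (simp add: of_nat_diff pochhammer_fact)
  also have "(\<Prod>j\<in>{0..int A - 1}. ?z - of_int j) = pochhammer (- (3 * of_nat A - 1)) A"
    using prod_linear_interval[where b = "int A - 1" and m = A and z = ?z]
    by (simp add: algebra_simps)
  also have "\<dots> = (-1) ^ A * pochhammer (of_nat (2 * A)) A"
    using pochhammer_minus[of "3 * of_nat A - 1 :: complex" A] by (simp add: algebra_simps)
  finally show ?thesis
    using assms by (cases A) (simp_all add: mult_ac flip: power_add power_mult_distrib)
qed

lemma f_weight_last:
  assumes "A > 0"
  shows "(\<Prod>j\<in>interp_nodes A - {int A - 1}. of_int (int A - 1) - of_int j) =
    (pochhammer (of_nat (2 * A)) A * fact (A - 1) :: complex)"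
proof -
  let ?z = "of_int (int A - 1) :: complex"
  have "interp_nodes A - {int A - 1} = {- 2 * int A..- int A - 1} \<union> {0..int A - 2}"
    using assms unfolding interp_nodes_def by auto
  then have "(\<Prod>j\<in>interp_nodes A - {int A - 1}. ?z - of_int j) =
      (\<Prod>j\<in>{- 2 * int A..- int A - 1}. ?z - of_int j) * (\<Prod>j\<in>{0..int A - 2}. ?z - of_int j)"
    by (simp only:) (rule prod.union_disjoint, auto)
  also have "(\<Prod>j\<in>{- 2 * int A..- int A - 1}. ?z - of_int j) = pochhammer (of_nat (2 * A)) A"
    using prod_linear_interval[where b = "- int A - 1" and m = A and z = ?z]
    by (simp add: algebra_simps)
  also have "(\<Prod>j\<in>{0..int A - 2}. ?z - of_int j) = fact (A - 1)"
    using prod_linear_interval[where b = "int A - 2" and m = "A - 1" and z = ?z] assms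
    by (simp add: of_nat_diff pochhammer_fact algebra_simps)
  finally show ?thesis .
qed

lemma inverse_flip_sign: "1 / a * (1 / (z - u)) = - 1 / ((u - z) * a)" for a z u :: complex
proof -
  have "1 / (z - u) = - (1 / (u - z))"
    by (metis divide_minus_right minus_diff_eq)
  then show ?thesis by (simp add: mult.commute)
qed

lemma exists_f_contour:
  assumes "A > 0" "z \<notin> of_int ` interp_nodes A"
  shows "\<exists>\<gamma>. f_contour A z \<gamma>"
proof -
  obtain \<gamma> where "ccw_contour \<gamma>" "of_int ` {0..int A - 1} \<subseteq> inside (path_image \<gamma>)"
      "insert z (of_int ` {- 2 * int A..- int A - 1}) \<subseteq> outside (path_image \<gamma>)"
  proof (rule exists_ccw_contour_separating[of "insert z (of_int ` {- 2 * int A..- int A - 1})"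
        "of_int ` {0..int A - 1} :: complex set"])
    show "insert z (of_int ` {- 2 * int A..- int A - 1}) \<inter> of_int ` {0..int A - 1} = {}"
      using assms by (auto simp: interp_nodes_def)
  qed (use assms in auto)
  then show ?thesis unfolding f_contour_def by auto
qed

lemma f_fun_contour_integral:
  assumes A: "A > 0" and z: "z \<notin> of_int ` interp_nodes A"
  shows "1 / (2 * of_real pi * \<i>) * contour_integral (SOME \<gamma>. f_contour A z \<gamma>)
      (\<lambda>u. 1 / (node_prod A u) * (1 / (z - u))) =
    (\<Sum>k=0..int A - 1. 1 / (node_weight (interp_nodes A) k) / (z - of_int k))"
proof -
  define \<gamma> where "\<gamma> = (SOME \<gamma>. f_contour A z \<gamma>)"
  have fc: "f_contour A z \<gamma>" unfolding \<gamma>_def using exists_f_contour[OF assms] by (rule someI_ex)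
  then have ccw: "ccw_contour \<gamma>" by (simp add: f_contour_def)
  let ?N = "interp_nodes A"
  let ?S = "insert z (of_int ` ?N) :: complex set"
  have inj: "inj_on (of_int :: int \<Rightarrow> complex) I" for I by (simp add: inj_on_def)
  have inN: "of_int k \<in> inside (path_image \<gamma>)" if "k \<in> {0..int A - 1}" for k
    using fc that unfolding f_contour_def by blast
  have outN: "of_int k \<in> outside (path_image \<gamma>)" if "k \<in> {- 2 * int A..- int A - 1}" for k
    using fc that unfolding f_contour_def by blast
  have zout: "z \<in> outside (path_image \<gamma>)" using fc by (simp add: f_contour_def)
  have eq: "(\<lambda>u. 1 / (node_prod A u) * (1 / (z - u))) =
      (\<lambda>u. (\<lambda>_. -1) u / (\<Prod>a\<in>?S. u - a))"
  proof
    fix u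
    have "(\<Prod>a\<in>?S. u - a) = (u - z) * (\<Prod>k\<in>?N. u - of_int k)"
      using z by (simp add: prod.reindex[OF inj])
    then show "1 / (node_prod A u) * (1 / (z - u)) =
        (\<lambda>_. -1) u / (\<Prod>a\<in>?S. u - a)"
      unfolding prod_interp_nodes by (simp only: inverse_flip_sign)
  qed
  have disj: "?S \<inter> path_image \<gamma> = {}"
    using zout inN outN inside_outside_not_on_path by (fastforce simp: interp_nodes_def)
  have "contour_integral \<gamma> (\<lambda>u. (\<lambda>_. -1) u / (\<Prod>a\<in>?S. u - a)) =
     2 * of_real pi * \<i> * (\<Sum>a\<in>?S. winding_number \<gamma> a * (-1 / (\<Prod>b\<in>?S - {a}. a - b)))"
    by (rule contour_integral_simple_poles) (use ccw disj in \<open>auto simp: ccw_contour_def\<close>)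
  also have "(\<Sum>a\<in>?S. winding_number \<gamma> a * (-1 / (\<Prod>b\<in>?S - {a}. a - b))) =
     (\<Sum>a\<in>of_int ` ?N. winding_number \<gamma> a * (-1 / (\<Prod>b\<in>?S - {a}. a - b)))"
    using z ccw_contour_winding_number(2)[OF ccw zout] by simp
  also have "\<dots> = (\<Sum>k\<in>?N. winding_number \<gamma> (of_int k) * (-1 / (\<Prod>b\<in>?S - {of_int k}. of_int k - b)))"
    by (rule sum.reindex_cong[OF inj]) auto
  also have "\<dots> = (\<Sum>k=0..int A - 1. winding_number \<gamma> (of_int k) * (-1 / (\<Prod>b\<in>?S - {of_int k}. of_int k - b)))"
    by (rule sum.mono_neutral_right)
      (auto simp: interp_nodes_def ccw_contour_winding_number(2)[OF ccw outN])
  also have "\<dots> = (\<Sum>k=0..int A - 1. 1 / (node_weight ?N k) / (z - of_int k))"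
  proof (rule sum.cong[OF refl])
    fix k assume k: "k \<in> {0..int A - 1}"
    then have kN: "k \<in> ?N" by (auto simp: interp_nodes_def)
    then have zk: "z \<noteq> of_int k" using z by blast
    have "?S - {of_int k} = insert z (of_int ` (?N - {k}))" using zk by auto
    then have "(\<Prod>b\<in>?S - {of_int k}. of_int k - b) = (of_int k - z) * (node_weight ?N k)"
      using z by (simp add: prod.reindex[OF inj] image_iff)
    then show "winding_number \<gamma> (of_int k) * (-1 / (\<Prod>b\<in>?S - {of_int k}. of_int k - b)) =
        1 / (node_weight ?N k) / (z - of_int k)"
      using ccw_contour_winding_number(1)[OF ccw inN[OF k]]
        inverse_flip_sign[of "node_weight ?N k" z "of_int k"] by simp
  qed
  finally show ?thesis unfolding \<gamma>_def [symmetric] eq by simp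
qed

text \<open>
  Evaluating the integral by residues makes \<open>f_fun\<close> a sum of simple fractions over the interpolation
  nodes. Multiplied by the product of the linear factors, it becomes a Lagrange interpolation formula.
\<close>

lemma f_fun_times_node_prod:
  assumes A: "A > 0" and z: "z \<notin> of_int ` interp_nodes A"
  shows "node_prod A z * f_fun A z = poly (black_poly A) z"
proof -
  let ?N = "interp_nodes A"
  define w where "w k = (node_weight ?N k :: complex)" for k
  define v where "v = (\<lambda>k. if k = - 2 * int A then \<i> * cis (- pi / 6)
     else if k < 0 then 0
     else if k = int A - 1 then 1 + \<i> * cis (pi / 6) else 1)"
  have "(\<Sum>k\<in>?N. v k / w k / (z - of_int k)) =
     (\<Sum>k\<in>{- 2 * int A..- int A - 1}. v k / w k / (z - of_int k)) + (\<Sum>k=0..int A - 1. v k / w k / (z - of_int k))"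
    unfolding interp_nodes_def by (rule sum.union_disjoint) auto
  also have "(\<Sum>k\<in>{- 2 * int A..- int A - 1}. v k / w k / (z - of_int k)) =
      (\<Sum>k\<in>{- 2 * int A..- int A - 1}. if k = - 2 * int A then \<i> * cis (- pi / 6) / w (- 2 * int A) / (z + 2 * of_nat A) else 0)"
    by (rule sum.cong) (use A in \<open>auto simp: v_def\<close>)
  also have "\<dots> = - (\<i> * cis (- pi / 6) / (pochhammer (of_nat (2 * A)) A * fact (A - 1)) * (1 / (z + 2 * of_nat A)))"
    unfolding w_def f_weight_first[OF A] using A by simp
  also have "(\<Sum>k=0..int A - 1. v k / w k / (z - of_int k)) =
      (\<Sum>k=0..int A - 1. 1 / w k / (z - of_int k) +
        (if k = int A - 1 then \<i> * cis (pi / 6) / w (int A - 1) / (z - (of_nat A - 1)) else 0))"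
    by (rule sum.cong) (use A in \<open>auto simp: v_def add_divide_distrib\<close>)
  also have "\<dots> = (\<Sum>k=0..int A - 1. 1 / w k / (z - of_int k)) +
      \<i> * cis (pi / 6) / (pochhammer (of_nat (2 * A)) A * fact (A - 1)) * (1 / (z - (of_nat A - 1)))"
    unfolding sum.distrib w_def f_weight_last[OF A] using A by simp
  finally have f: "f_fun A z = (\<Sum>k\<in>?N. v k / w k / (z - of_int k))"
    unfolding f_fun_def f_fun_contour_integral[OF A z] w_def [symmetric] by simp
  have "(\<Prod>k\<in>?N. z - of_int k) * f_fun A z = (\<Sum>k\<in>?N. v k / w k * (\<Prod>j\<in>?N - {k}. z - of_int j))"
    unfolding f sum_distrib_left
  proof (rule sum.cong[OF refl])
    fix k assume k: "k \<in> ?N"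
    then have "z - of_int k \<noteq> 0" using z by auto
    moreover have "(\<Prod>k\<in>?N. z - of_int k) = (z - of_int k) * (\<Prod>j\<in>?N - {k}. z - of_int j)"
      using k by (simp add: prod.remove)
    ultimately show "(\<Prod>k\<in>?N. z - of_int k) * (v k / w k / (z - of_int k)) = v k / w k * (\<Prod>j\<in>?N - {k}. z - of_int j)"
      by simp
  qed
  then show ?thesis
    unfolding prod_interp_nodes black_poly_def poly_lagrange v_def w_def by simp
qed


section \<open>The residues of the factor in the first variable\<close>

lemma faces_iff:
  assumes "A > 0"
  shows "(x, n) \<in> faces A \<longleftrightarrow>
    1 \<le> n \<and> n \<le> 2 * int A - 1 \<and> - n < x \<and> - int A < x \<and> x \<le> int A - 1 \<and> x \<le> 2 * int A - 1 - n"
  using assms by (auto simp: faces_def face_boundary_def hexagon_def max_def min_def split: if_splits)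

abbreviation white_factor :: "complex \<Rightarrow> complex \<Rightarrow> nat \<Rightarrow> complex \<Rightarrow> complex" where
  "white_factor \<alpha> \<beta> A z \<equiv> -1 + of_nat A / (1 + z) * \<alpha> + of_nat A / (- of_nat A - z) * \<beta>"

text \<open>
  The poles of \<open>g(z) / ((-2A - z)_A (-z)_A)\<close>. For \<open>A \<ge> 2\<close> all of them are simple, since
  then \<open>-1 \<noteq> -A\<close>.
\<close>

definition white_poles :: "nat \<Rightarrow> int set" where
  "white_poles A = {- 2 * int A..- int A} \<union> {-1..int A - 1}"

text \<open>
  The numerator of \<open>g(z) = -1 + A \<alpha> / (1 + z) + A \<beta> / (-A - z)\<close> over the denominator \<open>(z + 1) (z + A)\<close>.
\<close>

definition white_num :: "complex \<Rightarrow> complex \<Rightarrow> nat \<Rightarrow> complex poly" where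
  "white_num \<alpha> \<beta> A = - ([:1, 1:] * [:of_nat A, 1:]) + smult (of_nat A * \<alpha>) [:of_nat A, 1:]
     - smult (of_nat A * \<beta>) [:1, 1:]"

definition white_residue :: "complex \<Rightarrow> complex \<Rightarrow> nat \<Rightarrow> int \<Rightarrow> complex" where
  "white_residue \<alpha> \<beta> A k =
     poly (white_num \<alpha> \<beta> A) (of_int k) / (node_weight (white_poles A) k)"

text \<open>
  The sum of the residues of \<open>\<phi>(z) g(z) / ((-2A - z)_A (-z)_A)\<close> at \<open>-1, 0, \<dots>, A - 1\<close>. Always including \<open>-1\<close>
  makes the same functional serve all faces: for \<open>x \<ge> 0\<close> the integrand of the double integral has no
  pole there.
\<close>

definition white_functional :: "complex \<Rightarrow> complex \<Rightarrow> nat \<Rightarrow> (complex \<Rightarrow> complex) \<Rightarrow> complex" where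
  "white_functional \<alpha> \<beta> A \<phi> = (\<Sum>k=-1..int A - 1. white_residue \<alpha> \<beta> A k * \<phi> (of_int k))"

lemma white_functional_lin:
  "white_functional \<alpha> \<beta> A (\<lambda>z. \<phi> z - \<psi> z) = white_functional \<alpha> \<beta> A \<phi> - white_functional \<alpha> \<beta> A \<psi>"
  "white_functional \<alpha> \<beta> A (\<lambda>z. \<phi> z + \<psi> z) = white_functional \<alpha> \<beta> A \<phi> + white_functional \<alpha> \<beta> A \<psi>"
  "white_functional \<alpha> \<beta> A (\<lambda>z. \<phi> z * c) = white_functional \<alpha> \<beta> A \<phi> * c"
  by (simp_all add: white_functional_def algebra_simps sum_subtractf sum.distrib sum_distrib_left)

lemma finite_white_poles [simp]: "finite (white_poles A)"
  by (simp add: white_poles_def)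

lemma white_poles_eq:
  assumes "A \<ge> 2"
  shows "white_poles A = insert (-1) (insert (- int A) (interp_nodes A))"
    "- int A \<notin> interp_nodes A" "-1 \<notin> insert (- int A) (interp_nodes A)"
    "card (white_poles A) = 2 * A + 2"
proof -
  show 1: "white_poles A = insert (-1) (insert (- int A) (interp_nodes A))"
    using assms by (auto simp: white_poles_def interp_nodes_def)
  show 2: "- int A \<notin> interp_nodes A" "-1 \<notin> insert (- int A) (interp_nodes A)"
    using assms by (auto simp: interp_nodes_def)
  show "card (white_poles A) = 2 * A + 2"
    using 1 2 card_interp_nodes[of A] by simp
qed

lemma poly_white_num:
  "poly (white_num \<alpha> \<beta> A) z = - ((z + 1) * (z + of_nat A)) + of_nat A * \<alpha> * (z + of_nat A) - of_nat A * \<beta> * (z + 1)"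
  by (simp add: white_num_def algebra_simps)

lemma white_factor_eq:
  fixes z :: complex
  assumes "A \<ge> 2" "z \<noteq> -1" "z \<noteq> - of_nat A"
  shows "(white_factor \<alpha> \<beta> A z) /
      (node_prod A z) =
    poly (white_num \<alpha> \<beta> A) z / (\<Prod>k\<in>white_poles A. z - of_int k)"
proof -
  have nz: "z + 1 \<noteq> 0" "z + of_nat A \<noteq> 0" using assms(2,3) unfolding eq_neg_iff_add_eq_0 by auto
  have "(\<Prod>k\<in>white_poles A. z - of_int k) = (z + 1) * (z + of_nat A) * (\<Prod>k\<in>interp_nodes A. z - of_int k)"
    using white_poles_eq[OF assms(1)] by simp
  moreover have "white_factor \<alpha> \<beta> A z =
      poly (white_num \<alpha> \<beta> A) z / ((z + 1) * (z + of_nat A))"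
  proof -
    have "of_nat A / (- of_nat A - z) = - (of_nat A / (z + of_nat A))"
      by (metis add.commute add_uminus_conv_diff divide_minus_right minus_add_distrib)
    moreover have "-1 + c / a * \<alpha> + - (c / b) * \<beta> = (- (a * b) + c * \<alpha> * b - c * \<beta> * a) / (a * b)"
      if "a \<noteq> 0" "b \<noteq> 0" for a b c :: complex
      using that by (simp add: field_simps)
    from this[OF nz] have "-1 + of_nat A / (1 + z) * \<alpha> + - (of_nat A / (z + of_nat A)) * \<beta> =
        poly (white_num \<alpha> \<beta> A) z / ((z + 1) * (z + of_nat A))"
      unfolding poly_white_num by (simp only: add.commute[of 1 z])
    ultimately show ?thesis by (simp only:)
  qed
  ultimately show ?thesis unfolding prod_interp_nodes by simp
qed

text \<open>
  For \<open>x \<ge> 0\<close> the contour may or may not enclose \<open>-1\<close>, but then \<open>\<phi>\<close> vanishes at that pole.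
\<close>

lemma z1_contour_integral:
  assumes A: "A \<ge> 2" and \<gamma>: "z1_contour A x \<gamma>"
    and \<phi>: "\<phi> holomorphic_on UNIV" "x \<ge> 0 \<Longrightarrow> \<phi> (-1) = 0"
  shows "contour_integral \<gamma> (\<lambda>z. \<phi> z * ((white_factor \<alpha> \<beta> A z) /
      (node_prod A z))) =
    2 * of_real pi * \<i> * white_functional \<alpha> \<beta> A \<phi>"
proof -
  let ?S = "of_int ` white_poles A :: complex set"
  have inj: "inj_on (of_int :: int \<Rightarrow> complex) I" for I by (simp add: inj_on_def)
  have ccw: "ccw_contour \<gamma>" using \<gamma> by (simp add: z1_contour_def)
  have ins: "of_int k \<in> inside (path_image \<gamma>)" if "k \<in> {0..int A - 1}" for k
    using \<gamma> that unfolding z1_contour_def by blast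
  have outs: "of_int k \<in> outside (path_image \<gamma>)" if "k \<in> {- 2 * int A..- int A}" for k
    using \<gamma> that unfolding z1_contour_def by blast
  have m1: "-1 \<notin> path_image \<gamma>" using \<gamma> by (simp add: z1_contour_def)
  have disj: "?S \<inter> path_image \<gamma> = {}"
  proof -
    have "of_int k \<notin> path_image \<gamma>" if "k \<in> white_poles A" for k
    proof -
      consider "k = -1" | "k \<in> {0..int A - 1}" | "k \<in> {- 2 * int A..- int A}"
        using \<open>k \<in> white_poles A\<close> unfolding white_poles_def by fastforce
      then show ?thesis
        using m1 inside_outside_not_on_path(1)[OF ins] inside_outside_not_on_path(2)[OF outs] by cases auto
    qed
    then show ?thesis by auto
  qed
  have "contour_integral \<gamma> (\<lambda>z. \<phi> z * ((white_factor \<alpha> \<beta> A z) /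
      (node_prod A z))) =
      contour_integral \<gamma> (\<lambda>z. (\<phi> z * poly (white_num \<alpha> \<beta> A) z) / (\<Prod>a\<in>?S. z - a))"
  proof (rule contour_integral_cong[OF refl])
    fix z assume z: "z \<in> path_image \<gamma>"
    have "- int A \<in> {- 2 * int A..- int A}" by auto
    from inside_outside_not_on_path(2)[OF outs[OF this]] z
    have "z \<noteq> - of_nat A" by auto
    moreover have "z \<noteq> -1" using m1 z by auto
    ultimately show "\<phi> z * ((white_factor \<alpha> \<beta> A z) /
        (node_prod A z)) =
      (\<phi> z * poly (white_num \<alpha> \<beta> A) z) / (\<Prod>a\<in>?S. z - a)"
      using white_factor_eq[OF A, of z \<alpha> \<beta>] by (simp add: prod.reindex[OF inj])
  qed
  also have "\<dots> = 2 * of_real pi * \<i> * (\<Sum>a\<in>?S. winding_number \<gamma> a *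
      (\<phi> a * poly (white_num \<alpha> \<beta> A) a / (\<Prod>b\<in>?S - {a}. a - b)))"
  proof (rule contour_integral_simple_poles)
    show "(\<lambda>z. \<phi> z * poly (white_num \<alpha> \<beta> A) z) holomorphic_on UNIV"
      by (intro holomorphic_intros \<phi> poly_holomorphic)
  qed (use ccw disj in \<open>auto simp: ccw_contour_def\<close>)
  also have "(\<Sum>a\<in>?S. winding_number \<gamma> a *
      (\<phi> a * poly (white_num \<alpha> \<beta> A) a / (\<Prod>b\<in>?S - {a}. a - b))) =
      (\<Sum>k\<in>white_poles A. winding_number \<gamma> (of_int k) * (white_residue \<alpha> \<beta> A k * \<phi> (of_int k)))"
  proof (rule sum.reindex_cong[OF inj refl])
    fix k assume "k \<in> white_poles A"
    have "?S - {of_int k} = of_int ` (white_poles A - {k})" by auto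
    then have "(\<Prod>b\<in>?S - {of_int k}. of_int k - b) = (node_weight (white_poles A) k :: complex)"
      by (simp add: prod.reindex[OF inj])
    then show "winding_number \<gamma> (of_int k) *
        (\<phi> (of_int k) * poly (white_num \<alpha> \<beta> A) (of_int k) / (\<Prod>b\<in>?S - {of_int k}. of_int k - b)) =
        winding_number \<gamma> (of_int k) * (white_residue \<alpha> \<beta> A k * \<phi> (of_int k))"
      by (simp add: white_residue_def)
  qed
  also have "\<dots> = (\<Sum>k=-1..int A - 1. winding_number \<gamma> (of_int k) * (white_residue \<alpha> \<beta> A k * \<phi> (of_int k)))"
    by (rule sum.mono_neutral_right)
      (auto simp: white_poles_def ccw_contour_winding_number(2)[OF ccw outs])
  also have "\<dots> = white_functional \<alpha> \<beta> A \<phi>"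
    unfolding white_functional_def
  proof (rule sum.cong[OF refl])
    fix k assume k: "k \<in> {-1..int A - 1}"
    show "winding_number \<gamma> (of_int k) * (white_residue \<alpha> \<beta> A k * \<phi> (of_int k)) = white_residue \<alpha> \<beta> A k * \<phi> (of_int k)"
    proof (cases "k = -1")
      case True
      show ?thesis
      proof (cases "x \<ge> 0")
        case True
        then show ?thesis using \<phi>(2) \<open>k = -1\<close> by simp
      next
        case False
        then have "-1 \<in> inside (path_image \<gamma>)" using \<gamma> by (simp add: z1_contour_def)
        then show ?thesis using ccw_contour_winding_number(1)[OF ccw] \<open>k = -1\<close> by simp
      qed
    next
      case False
      then have "k \<in> {0..int A - 1}" using k by auto
      then show ?thesis using ccw_contour_winding_number(1)[OF ccw ins] by simp
    qed
  qed
  finally show ?thesis .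
qed


section \<open>The double integral\<close>

abbreviation black_seq :: "nat \<Rightarrow> int \<Rightarrow> complex" where
  "black_seq A \<equiv> \<lambda>i. poly (black_poly A) (of_int i)"

lemma holomorphic_pochhammer [holomorphic_intros]:
  "f holomorphic_on S \<Longrightarrow> (\<lambda>z. pochhammer (f z) m :: complex) holomorphic_on S"
  by (induction m) (auto simp: pochhammer_Suc intro!: holomorphic_intros)

lemma holomorphic_newton: "newton p m y holomorphic_on S"
proof -
  have "(\<lambda>z. \<Sum>j<m. pochhammer (z - of_int y) j * diffs (-1) j p y / fact j) holomorphic_on S"
    by (intro holomorphic_intros) auto
  then show ?thesis by (simp add: newton_def [abs_def])
qed

text \<open>
  After multiplication by the values of \<open>black_poly\<close>, the two parts of the kernel integrate to two
  Newton interpolation polynomials; the summands \<open>1 / (z1 - z2)\<close> that \<open>newton_kernel\<close> subtracts from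
  each of them cancel.
\<close>

lemma z2_contour_integral:
  assumes A: "A \<ge> 2" and face: "(x, n) \<in> faces A"
    and \<gamma>: "z2_contour A \<gamma>\<^sub>1 \<gamma>\<^sub>2" and z1: "z1 \<in> path_image \<gamma>\<^sub>1"
  shows "contour_integral \<gamma>\<^sub>2 (\<lambda>z2. integrand A x n g z1 z2) =
    2 * of_real pi * \<i> * ((newton (black_seq A) (nat (2 * int A - n)) (x - 1) z1
        - newton (black_seq A) (2 * A - 1) (-1) z1) *
      (g z1 / (pochhammer (- 2 * of_nat A - z1) A * pochhammer (- z1) A)))"
proof -
  have f: "1 \<le> n" "n \<le> 2 * int A - 1" "- n < x" "- int A < x" "x \<le> int A - 1" "x \<le> 2 * int A - 1 - n"
    using face A by (auto simp: faces_iff)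
  have ccw: "ccw_contour \<gamma>\<^sub>2" using \<gamma> by (simp add: z2_contour_def)
  have ins: "of_int k \<in> inside (path_image \<gamma>\<^sub>2)" if "- 2 * int A \<le> k" "k \<le> int A - 1" for k
    using \<gamma> that unfolding z2_contour_def by fastforce
  have z1_inside: "z1 \<in> inside (path_image \<gamma>\<^sub>2)" using \<gamma> z1 unfolding z2_contour_def by blast
  let ?c = "2 * of_real pi * \<i> :: complex"
  let ?w = "g z1 / (pochhammer (- 2 * of_nat A - z1) A * pochhammer (- z1) A)"
  let ?m = "nat (2 * int A - n)"
  let ?p = "poly (black_poly A)"
  define K where "K m y z2 = (\<Sum>j<m. pochhammer (z1 - of_int y) j * (?p z2 / pochhammer (z2 - of_int y) (Suc j)))"
    for m y z2
  have int: "(K m y has_contour_integral ?c * newton (black_seq A) m y z1) \<gamma>\<^sub>2"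
    if "- 2 * int A < y - int m + 1" "y \<le> int A - 1" for m y
  proof -
    have "(K m y has_contour_integral
        (\<Sum>j<m. pochhammer (z1 - of_int y) j * (?c * (diffs (-1) j (black_seq A) y / fact j)))) \<gamma>\<^sub>2"
      unfolding K_def [abs_def]
    proof (intro has_contour_integral_sum has_contour_integral_lmul)
      fix j assume "j \<in> {..<m}"
      then show "((\<lambda>z. ?p z / pochhammer (z - of_int y) (Suc j)) has_contour_integral
          ?c * (diffs (-1) j (black_seq A) y / fact j)) \<gamma>\<^sub>2"
        using that by (intro has_contour_integral_divided_difference ccw ins) auto
    qed auto
    then show ?thesis
      by (simp add: newton_def sum_distrib_left mult_ac)
  qed
  have "((\<lambda>z2. (K ?m (x - 1) z2 - K (2 * A - 1) (-1) z2) * ?w) has_contour_integral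
      (?c * newton (black_seq A) ?m (x - 1) z1 - ?c * newton (black_seq A) (2 * A - 1) (-1) z1) * ?w) \<gamma>\<^sub>2"
    by (intro has_contour_integral_rmul has_contour_integral_diff int) (use f A in auto)
  then have "((\<lambda>z2. integrand A x n g z1 z2) has_contour_integral
      (?c * newton (black_seq A) ?m (x - 1) z1 - ?c * newton (black_seq A) (2 * A - 1) (-1) z1) * ?w) \<gamma>\<^sub>2"
  proof (rule has_contour_integral_eq)
    fix z2 assume z2: "z2 \<in> path_image \<gamma>\<^sub>2"
    have ne: "z1 \<noteq> z2" using z1_inside z2 inside_outside_not_on_path(1) by blast
    have z2k: "z2 \<noteq> of_int k" if "- 2 * int A \<le> k" "k \<le> int A - 1" for k
      using ins[OF that] z2 inside_outside_not_on_path(1) by blast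
    have "z2 \<notin> of_int ` interp_nodes A"
    proof
      assume "z2 \<in> of_int ` interp_nodes A"
      then obtain k where "k \<in> interp_nodes A" "z2 = of_int k" by blast
      then show False using z2k[of k] by (auto simp: interp_nodes_def)
    qed
    then have fM: "pochhammer (- 2 * of_nat A - z2) A * pochhammer (- z2) A * f_fun A z2 = ?p z2"
      using A by (intro f_fun_times_node_prod) auto
    have nz: "pochhammer (z2 - of_int y) m \<noteq> 0"
      if "- 2 * int A < y - int m + 1" "y \<le> int A - 1" for m y
    proof
      assume "pochhammer (z2 - of_int y) m = 0"
      then obtain k where k: "k < m" "z2 - of_int y = - of_nat k" unfolding pochhammer_eq_0_iff by blast
      then have "z2 = of_int (y - int k)" by (simp add: algebra_simps)
      then show False using z2k[of "y - int k"] k that by auto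
    qed
    have K: "K m y z2 = 1 / (z1 - z2) * (pochhammer (z1 - of_int y) m / pochhammer (z2 - of_int y) m - 1) * ?p z2"
      if "- 2 * int A < y - int m + 1" "y \<le> int A - 1" for m y
      unfolding newton_kernel[OF ne nz[OF that]] K_def
      by (simp add: sum_distrib_right)
    have "K ?m (x - 1) z2 - K (2 * A - 1) (-1) z2 =
       1 / (z1 - z2) * (pochhammer (z1 - of_int x + 1) ?m / pochhammer (z2 - of_int x + 1) ?m
        - pochhammer (z1 + 1) (2 * A - 1) / pochhammer (z2 + 1) (2 * A - 1)) * ?p z2"
    proof -
      have "K ?m (x - 1) z2 = 1 / (z1 - z2) * (pochhammer (z1 - of_int x + 1) ?m / pochhammer (z2 - of_int x + 1) ?m - 1) * ?p z2"
        using K[of "x - 1" ?m] f by (simp add: algebra_simps)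
      moreover have "K (2 * A - 1) (-1) z2 = 1 / (z1 - z2) * (pochhammer (z1 + 1) (2 * A - 1) / pochhammer (z2 + 1) (2 * A - 1) - 1) * ?p z2"
        using K[of "-1" "2 * A - 1"] A by simp
      moreover have "c * (a - 1) * p - c * (b - 1) * p = c * (a - b) * p" for a b c p :: complex
        by (simp add: algebra_simps)
      ultimately show ?thesis by (simp only:)
    qed
    then show "(K ?m (x - 1) z2 - K (2 * A - 1) (-1) z2) * ?w = integrand A x n g z1 z2"
      unfolding integrand_def fM [symmetric] by simp
  qed
  then have "contour_integral \<gamma>\<^sub>2 (\<lambda>z2. integrand A x n g z1 z2) =
      (?c * newton (black_seq A) ?m (x - 1) z1 - ?c * newton (black_seq A) (2 * A - 1) (-1) z1) * ?w"
    by (rule contour_integral_unique)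
  then show ?thesis by (simp only: right_diff_distrib mult.assoc left_diff_distrib)
qed

lemma double_contour_integral:
  assumes A: "A \<ge> 2" and face: "(x, n) \<in> faces A"
    and \<gamma>: "z1_contour A x \<gamma>\<^sub>1" "z2_contour A \<gamma>\<^sub>1 \<gamma>\<^sub>2"
    and g: "g = (\<lambda>z. white_factor \<alpha> \<beta> A z)"
  shows "(1 / (2 * of_real pi * \<i>)\<^sup>2) *
      contour_integral \<gamma>\<^sub>1 (\<lambda>z1. contour_integral \<gamma>\<^sub>2 (\<lambda>z2. integrand A x n g z1 z2)) =
    white_functional \<alpha> \<beta> A (\<lambda>z. newton (black_seq A) (nat (2 * int A - n)) (x - 1) z
      - newton (black_seq A) (2 * A - 1) (-1) z)"
proof -
  let ?c = "2 * of_real pi * \<i> :: complex"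
  define J where "J = (\<lambda>z. newton (black_seq A) (nat (2 * int A - n)) (x - 1) z
      - newton (black_seq A) (2 * A - 1) (-1) z)"
  let ?w = "\<lambda>z. g z / (node_prod A z)"
  have f: "1 \<le> n" "n \<le> 2 * int A - 1" "- n < x" "x \<le> 2 * int A - 1 - n"
    using face A by (auto simp: faces_iff)
  have "contour_integral \<gamma>\<^sub>1 (\<lambda>z1. contour_integral \<gamma>\<^sub>2 (\<lambda>z2. integrand A x n g z1 z2)) =
      contour_integral \<gamma>\<^sub>1 (\<lambda>z. (?c * J z) * ?w z)"
    by (rule contour_integral_cong[OF refl])
      (simp add: z2_contour_integral[OF A face \<gamma>(2)] J_def mult.assoc)
  also have "\<dots> = ?c * white_functional \<alpha> \<beta> A (\<lambda>z. ?c * J z)"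
    unfolding g
  proof (rule z1_contour_integral[OF A \<gamma>(1)])
    show "(\<lambda>z. ?c * J z) holomorphic_on UNIV"
      unfolding J_def by (intro holomorphic_intros holomorphic_newton)
    assume "x \<ge> 0"
    have "J (of_int (-1)) = 0" unfolding J_def
      by (subst (1 2) newton_node) (use \<open>x \<ge> 0\<close> f A in auto)
    then show "?c * J (-1) = 0" by simp
  qed
  also have "white_functional \<alpha> \<beta> A (\<lambda>z. ?c * J z) = white_functional \<alpha> \<beta> A J * ?c"
    unfolding white_functional_lin(3) [symmetric] by (simp only: mult.commute)
  finally show ?thesis
    unfolding J_def [symmetric] by (simp add: power2_eq_square)
qed


section \<open>Rows and columns of the Kasteleyn matrix\<close>

lemma inner_black_iff: "inner_black A x n \<longleftrightarrow> 2 \<le> n \<and> n \<le> 2 * int A - 1 \<and>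
    - n < x \<and> - int A < x \<and> x < int A - 1 \<and> x < 2 * int A - 1 - n"
  by (auto simp: inner_black_def)

lemma inner_white_iff: "inner_white A y m \<longleftrightarrow> 1 \<le> m \<and> m \<le> 2 * int A - 2 \<and>
    - m < y \<and> - int A < y \<and> y < int A - 1 \<and> y < 2 * int A - 1 - m"
  by (auto simp: inner_white_def)

lemma minus_one_powi: "(-1 :: complex) powi k = (if even k then 1 else -1)"
  by (simp add: power_int_minus_left)

definition inner_white_set :: "nat \<Rightarrow> (int \<times> int) set" where
  "inner_white_set A = {(y, m). inner_white A y m}"

definition inner_black_set :: "nat \<Rightarrow> (int \<times> int) set" where
  "inner_black_set A = {(x, n). inner_black A x n}"

lemma finite_inner [simp]: "finite (inner_white_set A)" "finite (inner_black_set A)"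
proof -
  have "inner_white_set A \<subseteq> {- int A..int A} \<times> {0..2 * int A}"
    "inner_black_set A \<subseteq> {- int A..int A} \<times> {0..2 * int A}"
    by (auto simp: inner_white_set_def inner_black_set_def inner_white_iff inner_black_iff)
  then show "finite (inner_white_set A)" "finite (inner_black_set A)"
    using finite_subset by blast+
qed

lemma whites_eq: "whites A = (\<lambda>(y, m). W y m) ` inner_white_set A \<union> {W1, W2, W3}"
  by (auto simp: whites_def inner_white_set_def)

lemma blacks_eq: "blacks A = (\<lambda>(x, n). B x n) ` inner_black_set A \<union> {B1, B2, B3}"
  by (auto simp: blacks_def inner_black_set_def)

lemma finite_vertices [simp]: "finite (whites A)" "finite (blacks A)"
  by (simp_all add: whites_eq blacks_eq)

lemma sum_whites:
  "(\<Sum>w\<in>whites A. f w) = (\<Sum>(y, m)\<in>inner_white_set A. f (W y m)) + f W1 + f W2 + (f W3 :: complex)"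
proof -
  have "inj_on (\<lambda>(y, m). W y m) S" for S by (auto simp: inj_on_def)
  moreover have "(\<lambda>(y, m). W y m) ` inner_white_set A \<inter> {W1, W2, W3} = {}" by auto
  ultimately show ?thesis
    unfolding whites_eq by (subst sum.union_disjoint) (auto simp: sum.reindex case_prod_unfold o_def)
qed

lemma sum_blacks:
  "(\<Sum>b\<in>blacks A. f b) = (\<Sum>(x, n)\<in>inner_black_set A. f (B x n)) + f B1 + f B2 + (f B3 :: complex)"
proof -
  have "inj_on (\<lambda>(x, n). B x n) S" for S by (auto simp: inj_on_def)
  moreover have "(\<lambda>(x, n). B x n) ` inner_black_set A \<inter> {B1, B2, B3} = {}" by auto
  ultimately show ?thesis
    unfolding blacks_eq by (subst sum.union_disjoint) (auto simp: sum.reindex case_prod_unfold o_def)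
qed

lemma sum_if_swap:
  "finite S \<Longrightarrow> finite T \<Longrightarrow>
    (\<Sum>p\<in>S. if p \<in> T then f p else 0) = (\<Sum>p\<in>T. if p \<in> S then f p else (0 :: complex))"
  by (simp add: sum.inter_restrict [symmetric] Int_commute)

lemma sum_subfamily:
  assumes "finite S" "\<And>i. i \<in> I \<Longrightarrow> h i \<in> S \<and> r (h i) = i \<and> f (h i) = g i"
    and "\<And>p. p \<in> S \<Longrightarrow> f p \<noteq> 0 \<Longrightarrow> r p \<in> I \<and> h (r p) = p"
  shows "(\<Sum>p\<in>S. f p) = (\<Sum>i\<in>I. g i :: complex)"
proof -
  have "(\<Sum>p\<in>S. f p) = (\<Sum>p\<in>h ` I. f p)"
    using assms by (intro sum.mono_neutral_right) (auto, force)
  moreover have "inj_on h I" using assms(2) by (metis inj_onI)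
  ultimately show ?thesis using assms(2) by (simp add: sum.reindex)
qed

text \<open>
  The function on white vertices of the hexagon that belongs to a function \<open>v\<close> on the reduced hexagon.
  Along a contracted string of white vertices the equations at the degree-two black vertices in between
  force alternating signs, and the entries of \<open>Kred\<close> at the string are these signs. The last case is
  meant for the string of \<open>W2\<close> only.
\<close>

definition white_lift :: "nat \<Rightarrow> (white \<Rightarrow> complex) \<Rightarrow> int \<Rightarrow> int \<Rightarrow> complex" where
  "white_lift A v y m =
    (if inner_white A y m then v (W y m)
     else if m = 2 * int A - 1 then (-1) powi (y + 1) * v W3
     else if y = - m then (-1) powi (m + 1) * v W1
     else (-1) powi (m + 1) * v W2)"

text \<open>
  The analogue of \<open>white_lift\<close> for black vertices.
\<close>

definition black_lift :: "nat \<Rightarrow> (black \<Rightarrow> complex) \<Rightarrow> int \<Rightarrow> int \<Rightarrow> complex" where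
  "black_lift A t x n =
    (if inner_black A x n then t (B x n)
     else if n = 1 then (-1) powi (x + 1) * t B1
     else if x + n = 2 * int A - 1 then (-1) powi (x + 1) * t B2
     else (-1) powi n * t B3)"

text \<open>
  In terms of the lift, the row of \<open>Kred\<close> at an inner black vertex is the row of the Kasteleyn matrix of
  the hexagon with all weights \<open>1\<close>.
\<close>

lemma Kred_row_inner:
  assumes "A \<ge> 2" and b: "inner_black A x n"
  shows "(\<Sum>w\<in>whites A. Kred A (B x n) w * v w) =
    white_lift A v x n + white_lift A v x (n - 1) + white_lift A v (x + 1) (n - 1)"
proof -
  let ?T = "{(x, n), (x, n - 1), (x + 1, n - 1)}"
  have "(\<Sum>(y, m)\<in>inner_white_set A. Kred A (B x n) (W y m) * v (W y m)) =
      (\<Sum>p\<in>inner_white_set A. if p \<in> ?T then v (W (fst p) (snd p)) else 0)"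
    by (rule sum.cong) (use b in \<open>auto simp: inner_white_set_def hex_adj_def split: if_splits\<close>)
  also have "\<dots> = (\<Sum>p\<in>?T. if p \<in> inner_white_set A then v (W (fst p) (snd p)) else 0)"
    by (rule sum_if_swap) auto
  also have "\<dots> = (if inner_white A x n then v (W x n) else 0) + (if inner_white A x (n - 1) then v (W x (n - 1)) else 0)
      + (if inner_white A (x + 1) (n - 1) then v (W (x + 1) (n - 1)) else 0)"
    by (simp add: inner_white_set_def)
  finally have sum: "(\<Sum>(y, m)\<in>inner_white_set A. Kred A (B x n) (W y m) * v (W y m)) = \<dots>" .
  have 1: "(if inner_white A x n then v (W x n) else 0) + Kred A (B x n) W3 * v W3 = white_lift A v x n"
    using b assms by (auto simp: white_lift_def inner_black_iff inner_white_iff)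
  have 2: "(if inner_white A x (n - 1) then v (W x (n - 1)) else 0) + Kred A (B x n) W1 * v W1 = white_lift A v x (n - 1)"
    using b assms by (auto simp: white_lift_def inner_black_iff inner_white_iff Let_def)
  have 3: "(if inner_white A (x + 1) (n - 1) then v (W (x + 1) (n - 1)) else 0) + Kred A (B x n) W2 * v W2
      = white_lift A v (x + 1) (n - 1)"
    using b assms by (auto simp: white_lift_def inner_black_iff inner_white_iff Let_def)
  show ?thesis
    unfolding sum_whites sum 1 [symmetric] 2 [symmetric] 3 [symmetric] by simp
qed

text \<open>
  The two summands at the ends of the range are the entries at \<open>W1\<close> and \<open>W2\<close>. The sign at the upper end
  is \<open>(-1)^A\<close>, so \<open>A\<close> has to be even for this to fit with the entry \<open>1\<close>. The other two boundary rows and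
  the boundary columns are alike.
\<close>

lemma Kred_row_B1:
  assumes "A \<ge> 2" "even A"
  shows "(\<Sum>w\<in>whites A. Kred A B1 w * v w) = (\<Sum>k=-1..int A - 1. (-1) powi (k + 1) * white_lift A v k 1)"
proof -
  have s: "(\<Sum>(y, m)\<in>inner_white_set A. Kred A B1 (W y m) * v (W y m)) =
      (\<Sum>k=0..int A - 2. (-1) powi (k + 1) * white_lift A v k 1)"
    by (rule sum_subfamily[OF finite_inner(1), where h = "\<lambda>k. (k, 1)" and r = "fst"])
      (use assms in \<open>auto simp: white_lift_def inner_white_set_def inner_white_iff inner_black_iff Let_def split: if_splits\<close>)
  have i: "{-1..int A - 1} = insert (-1) (insert (int A - 1) {0..int A - 2})" using assms by auto
  have "white_lift A v (-1) 1 = v W1" "(-1) powi int A * white_lift A v (int A - 1) 1 = v W2"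
    using assms by (auto simp: white_lift_def inner_white_iff minus_one_powi)
  then show ?thesis unfolding sum_whites s i using assms by simp
qed

lemma Kred_row_B2:
  assumes "A \<ge> 2" "even A"
  shows "(\<Sum>w\<in>whites A. Kred A B2 w * v w) =
    (\<Sum>k=-1..int A - 1. (-1) powi (k + 1) * white_lift A v k (2 * int A - 2 - k))"
proof -
  have s: "(\<Sum>(y, m)\<in>inner_white_set A. Kred A B2 (W y m) * v (W y m)) =
      (\<Sum>k=0..int A - 2. (-1) powi (k + 1) * white_lift A v k (2 * int A - 2 - k))"
    by (rule sum_subfamily[OF finite_inner(1), where h = "\<lambda>k. (k, 2 * int A - 2 - k)" and r = "fst"])
      (use assms in \<open>auto simp: white_lift_def inner_white_set_def inner_white_iff inner_black_iff Let_def split: if_splits\<close>)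
  have i: "{-1..int A - 1} = insert (-1) (insert (int A - 1) {0..int A - 2})" using assms by auto
  have "white_lift A v (-1) (2 * int A - 1) = v W3" "(-1) powi int A * white_lift A v (int A - 1) (int A - 1) = v W2"
    using assms by (auto simp: white_lift_def inner_white_iff minus_one_powi)
  then show ?thesis unfolding sum_whites s i using assms by simp
qed

lemma Kred_row_B3:
  assumes "A \<ge> 2" "even A"
  shows "(\<Sum>w\<in>whites A. Kred A B3 w * v w) =
    (\<Sum>m=int A - 1..2 * int A - 1. (-1) powi (m + 1) * white_lift A v (- int A + 1) m)"
proof -
  have s: "(\<Sum>(y, m)\<in>inner_white_set A. Kred A B3 (W y m) * v (W y m)) =
      (\<Sum>m=int A..2 * int A - 2. (-1) powi (m + 1) * white_lift A v (- int A + 1) m)"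
    by (rule sum_subfamily[OF finite_inner(1), where h = "\<lambda>m. (- int A + 1, m)" and r = "snd"])
      (use assms in \<open>auto simp: white_lift_def inner_white_set_def inner_white_iff inner_black_iff Let_def split: if_splits\<close>)
  have i: "{int A - 1..2 * int A - 1} = insert (int A - 1) (insert (2 * int A - 1) {int A..2 * int A - 2})"
    using assms by auto
  have "(-1) powi int A * white_lift A v (- int A + 1) (int A - 1) = v W1"
    "(-1) powi (2 * int A) * white_lift A v (- int A + 1) (2 * int A - 1) = v W3"
    using assms by (auto simp: white_lift_def inner_white_iff minus_one_powi)
  then show ?thesis unfolding sum_whites s i using assms by simp
qed

lemma Kred_column_inner:
  assumes "A \<ge> 2" and w: "inner_white A y m"
  shows "(\<Sum>b\<in>blacks A. t b * Kred A b (W y m)) =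
    black_lift A t y m + black_lift A t y (m + 1) + black_lift A t (y - 1) (m + 1)"
proof -
  let ?T = "{(y, m), (y, m + 1), (y - 1, m + 1)}"
  have "(\<Sum>(x, n)\<in>inner_black_set A. t (B x n) * Kred A (B x n) (W y m)) =
      (\<Sum>p\<in>inner_black_set A. if p \<in> ?T then t (B (fst p) (snd p)) else 0)"
    by (rule sum.cong) (use w in \<open>auto simp: inner_black_set_def hex_adj_def split: if_splits\<close>)
  also have "\<dots> = (\<Sum>p\<in>?T. if p \<in> inner_black_set A then t (B (fst p) (snd p)) else 0)"
    by (rule sum_if_swap) auto
  also have "\<dots> = (if inner_black A y m then t (B y m) else 0) + (if inner_black A y (m + 1) then t (B y (m + 1)) else 0)
      + (if inner_black A (y - 1) (m + 1) then t (B (y - 1) (m + 1)) else 0)"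
    by (simp add: inner_black_set_def)
  finally have sum: "(\<Sum>(x, n)\<in>inner_black_set A. t (B x n) * Kred A (B x n) (W y m)) = \<dots>" .
  have 1: "(if inner_black A y m then t (B y m) else 0) + t B1 * Kred A B1 (W y m) = black_lift A t y m"
    using w assms by (auto simp: black_lift_def inner_black_iff inner_white_iff)
  have 2: "(if inner_black A y (m + 1) then t (B y (m + 1)) else 0) + t B2 * Kred A B2 (W y m) = black_lift A t y (m + 1)"
    using w assms by (auto simp: black_lift_def inner_black_iff inner_white_iff)
  have 3: "(if inner_black A (y - 1) (m + 1) then t (B (y - 1) (m + 1)) else 0) + t B3 * Kred A B3 (W y m)
      = black_lift A t (y - 1) (m + 1)"
    using w assms by (auto simp: black_lift_def inner_black_iff inner_white_iff Let_def)
  show ?thesis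
    unfolding sum_blacks sum 1 [symmetric] 2 [symmetric] 3 [symmetric] by simp
qed

lemma Kred_column_W1:
  assumes "A \<ge> 2" "even A"
  shows "(\<Sum>b\<in>blacks A. t b * Kred A b W1) = (\<Sum>k=0..int A. (-1) powi (k + 1) * black_lift A t (- k) (k + 1))"
proof -
  have s: "(\<Sum>(x, n)\<in>inner_black_set A. t (B x n) * Kred A (B x n) W1) =
      (\<Sum>k=1..int A - 1. (-1) powi (k + 1) * black_lift A t (- k) (k + 1))"
    by (rule sum_subfamily[OF finite_inner(2), where h = "\<lambda>k. (- k, k + 1)" and r = "\<lambda>p. snd p - 1"])
      (use assms in \<open>auto simp: black_lift_def inner_black_set_def inner_white_iff inner_black_iff Let_def split: if_splits\<close>)
  have i: "{0..int A} = insert 0 (insert (int A) {1..int A - 1})" using assms by auto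
  have "- black_lift A t 0 1 = t B1" "(-1) powi (int A + 1) * black_lift A t (- int A) (int A + 1) = t B3"
    using assms by (auto simp: black_lift_def inner_black_iff minus_one_powi)
  then show ?thesis unfolding sum_blacks s i using assms by simp
qed

lemma Kred_column_W2:
  assumes "A \<ge> 2" "even A"
  shows "(\<Sum>b\<in>blacks A. t b * Kred A b W2) =
    (\<Sum>k=0..int A. (-1) powi (k + 1) * black_lift A t (int A - 2) (k + 1))"
proof -
  have s: "(\<Sum>(x, n)\<in>inner_black_set A. t (B x n) * Kred A (B x n) W2) =
      (\<Sum>k=1..int A - 1. (-1) powi (k + 1) * black_lift A t (int A - 2) (k + 1))"
    by (rule sum_subfamily[OF finite_inner(2), where h = "\<lambda>k. (int A - 2, k + 1)" and r = "\<lambda>p. snd p - 1"])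
      (use assms in \<open>auto simp: black_lift_def inner_black_set_def inner_white_iff inner_black_iff Let_def split: if_splits\<close>)
  have i: "{0..int A} = insert 0 (insert (int A) {1..int A - 1})" using assms by auto
  have "- black_lift A t (int A - 2) 1 = t B1"
    "(-1) powi (int A + 1) * black_lift A t (int A - 2) (int A + 1) = t B2"
    using assms by (auto simp: black_lift_def inner_black_iff minus_one_powi)
  then show ?thesis unfolding sum_blacks s i using assms by simp
qed

lemma Kred_column_W3:
  assumes "A \<ge> 2" "even A"
  shows "(\<Sum>b\<in>blacks A. t b * Kred A b W3) =
    (\<Sum>k=- int A..0. (-1) powi (k + 1) * black_lift A t k (2 * int A - 1))"
proof -
  have s: "(\<Sum>(x, n)\<in>inner_black_set A. t (B x n) * Kred A (B x n) W3) =
      (\<Sum>k=- int A + 1..-1. (-1) powi (k + 1) * black_lift A t k (2 * int A - 1))"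
    by (rule sum_subfamily[OF finite_inner(2), where h = "\<lambda>k. (k, 2 * int A - 1)" and r = "fst"])
      (use assms in \<open>auto simp: black_lift_def inner_black_set_def inner_white_iff inner_black_iff Let_def split: if_splits\<close>)
  have i: "{- int A..0} = insert 0 (insert (- int A) {- int A + 1..-1})" using assms by auto
  have "- black_lift A t 0 (2 * int A - 1) = t B2"
    "(-1) powi (- int A + 1) * black_lift A t (- int A) (2 * int A - 1) = t B3"
    using assms by (auto simp: black_lift_def inner_black_iff minus_one_powi)
  then show ?thesis unfolding sum_blacks s i using assms by simp
qed


section \<open>Rows on functions obeying the difference recursion\<close>

text \<open>
  The white vertices of the hexagon that do not lie in the fibre of one of \<open>B1\<close>, \<open>B2\<close>, \<open>B3\<close>.
\<close>

definition white_dom :: "nat \<Rightarrow> int \<Rightarrow> int \<Rightarrow> bool" where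
  "white_dom A y m \<longleftrightarrow> 1 \<le> m \<and> m \<le> 2 * int A - 1 \<and> - m \<le> y \<and> - int A < y \<and> y \<le> int A - 1 \<and> y \<le> 2 * int A - 2 - m"

lemma telescope_int:
  fixes f :: "int \<Rightarrow> complex"
  assumes "a \<le> b + 1"
  shows "(\<Sum>k=a..b. f k - f (k + 1)) = f a - f (b + 1)"
proof -
  have "(\<Sum>k=a..c. f k - f (k + 1)) = f a - f (c + 1)" if "a \<le> c" for c
    using that
  proof (induction c rule: int_ge_induct)
    case (step i)
    then have "{a..i + 1} = insert (i + 1) {a..i}" by auto
    then show ?case using step by simp
  qed simp
  then show ?thesis
  proof (cases "a \<le> b")
    case False
    then have "a = b + 1" using assms by simp
    then show ?thesis by simp
  qed
qed

text \<open>
  Functions on white vertices whose lift is, up to the sign \<open>(-1)^(y + m)\<close>, a family of rows \<open>\<tau>\<close> in which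
  each row is the difference of the preceding one. The equations at \<open>B1\<close>, \<open>B2\<close>, \<open>B3\<close> then telescope
  to a few values of \<open>\<tau>\<close> at the boundary of the hexagon and just outside of it. Both the kernel and the columns of the inverse of
  \<open>Kred\<close> are found in this way.
\<close>

locale white_recursion =
  fixes A :: nat and v :: "white \<Rightarrow> complex" and \<tau> :: "int \<Rightarrow> int \<Rightarrow> complex"
  assumes A: "A \<ge> 2" "even A"
    and rec: "1 \<le> n \<Longrightarrow> n \<le> 2 * int A - 1 \<Longrightarrow> \<tau> x n = \<tau> x (n - 1) - \<tau> (x + 1) (n - 1)"
    and lift: "white_dom A y m \<Longrightarrow> white_lift A v y m = (-1) powi (y + m) * \<tau> y m"
begin

lemma row_inner:
  assumes "inner_black A x n"
  shows "(\<Sum>w\<in>whites A. Kred A (B x n) w * v w) = 0"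
proof -
  have "white_dom A x n" "white_dom A x (n - 1)" "white_dom A (x + 1) (n - 1)" "1 \<le> n" "n \<le> 2 * int A - 1"
    using assms by (auto simp: white_dom_def inner_black_iff)
  then show ?thesis
    using A rec[of n x] unfolding Kred_row_inner[OF A(1) assms]
    by (simp add: lift minus_one_powi)
qed

lemma row_B1: "(\<Sum>w\<in>whites A. Kred A B1 w * v w) = \<tau> (-1) 0 - \<tau> (int A) 0"
proof -
  have "(\<Sum>w\<in>whites A. Kred A B1 w * v w) = (\<Sum>k=-1..int A - 1. \<tau> k 0 - \<tau> (k + 1) 0)"
    unfolding Kred_row_B1[OF A]
  proof (rule sum.cong[OF refl])
    fix k assume "k \<in> {-1..int A - 1}"
    then have "white_dom A k 1" using A by (auto simp: white_dom_def)
    then show "(-1) powi (k + 1) * white_lift A v k 1 = \<tau> k 0 - \<tau> (k + 1) 0"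
      using rec[of 1 k] A by (simp add: lift minus_one_powi)
  qed
  then show ?thesis using telescope_int[of "-1" "int A - 1" "\<lambda>k. \<tau> k 0"] by simp
qed

lemma row_B2:
  "(\<Sum>w\<in>whites A. Kred A B2 w * v w) = \<tau> (-1) (2 * int A - 1) - \<tau> 0 (2 * int A - 1) + \<tau> (int A) (int A - 1)"
proof -
  have i: "{-1..int A - 1} = insert (-1) {0..int A - 1}" by auto
  have m: "white_lift A v (-1) (2 * int A - 1) = \<tau> (-1) (2 * int A - 1)"
    using A by (subst lift) (auto simp: white_dom_def minus_one_powi)
  define b where "b k = - ((-1) powi k * \<tau> k (2 * int A - 1 - k))" for k
  have "(\<Sum>k=0..int A - 1. (-1) powi (k + 1) * white_lift A v k (2 * int A - 2 - k)) = (\<Sum>k=0..int A - 1. b k - b (k + 1))"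
  proof (rule sum.cong[OF refl])
    fix k assume k: "k \<in> {0..int A - 1}"
    then have "white_dom A k (2 * int A - 2 - k)" using A by (auto simp: white_dom_def)
    moreover have "\<tau> k (2 * int A - 1 - k) = \<tau> k (2 * int A - 2 - k) - \<tau> (k + 1) (2 * int A - 2 - k)"
      using rec[of "2 * int A - 1 - k" k] k A by (simp add: algebra_simps)
    ultimately show "(-1) powi (k + 1) * white_lift A v k (2 * int A - 2 - k) = b k - b (k + 1)"
      by (simp add: lift minus_one_powi b_def algebra_simps)
  qed
  also have "\<dots> = b 0 - b (int A)" by (simp add: telescope_int)
  finally show ?thesis
    unfolding Kred_row_B2[OF A] i using m A by (simp add: b_def minus_one_powi)
qed

lemma row_B3:
  "(\<Sum>w\<in>whites A. Kred A B3 w * v w) =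
    \<tau> (- int A) (int A - 1) - \<tau> (- int A) (2 * int A - 1) + \<tau> (- int A + 1) (2 * int A - 1)"
proof -
  have i: "{int A - 1..2 * int A - 1} = insert (2 * int A - 1) {int A - 1..2 * int A - 2}" using A by auto
  have l: "(-1) powi (m + 1) * white_lift A v (- int A + 1) m = \<tau> (- int A + 1) m"
    if "m \<in> {int A - 1..2 * int A - 1}" for m
    using that A by (subst lift) (auto simp: white_dom_def minus_one_powi)
  have "(\<Sum>m=int A - 1..2 * int A - 2. (-1) powi (m + 1) * white_lift A v (- int A + 1) m) =
      (\<Sum>m=int A - 1..2 * int A - 2. \<tau> (- int A) m - \<tau> (- int A) (m + 1))"
  proof (rule sum.cong[OF refl])
    fix m assume m: "m \<in> {int A - 1..2 * int A - 2}"
    have "\<tau> (- int A) (m + 1) = \<tau> (- int A) m - \<tau> (- int A + 1) m"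
      using rec[of "m + 1" "- int A"] m A by simp
    then show "(-1) powi (m + 1) * white_lift A v (- int A + 1) m = \<tau> (- int A) m - \<tau> (- int A) (m + 1)"
      using l[of m] m by simp
  qed
  also have "\<dots> = \<tau> (- int A) (int A - 1) - \<tau> (- int A) (2 * int A - 1)"
    using A telescope_int[of "int A - 1" "2 * int A - 2" "\<tau> (- int A)"] by simp
  finally show ?thesis
    unfolding Kred_row_B3[OF A] i using l[of "2 * int A - 1"] A by simp
qed

end


section \<open>The inverse of the Kasteleyn matrix\<close>

lemma diffs_eq_0:
  assumes "\<And>j. j \<le> n \<Longrightarrow> f (x + int j * d) = 0"
  shows "diffs d n f x = 0"
  unfolding diffs_binomial using assms by (intro sum.neutral) auto

text \<open>
  Let \<open>q\<close> interpolate \<open>f\<close> on \<open>{-A..A - 1}\<close>. The vanishing differences propagate the equality of \<open>f\<close> and \<open>q\<close>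
  up to \<open>2A - 1\<close>. So \<open>q\<close>, of degree less than \<open>2A\<close>, vanishes at the \<open>2A\<close> points of \<open>{-A..-1}\<close> and
  \<open>{A..2A - 1}\<close>.
\<close>

lemma supported_diffs_eq_0_imp_eq_0:
  fixes f :: "int \<Rightarrow> complex"
  assumes supp: "\<And>i. i < 0 \<or> i \<ge> int A \<Longrightarrow> f i = 0"
    and diffs: "\<And>x. - int A \<le> x \<Longrightarrow> x \<le> -1 \<Longrightarrow> diffs 1 (2 * A) f x = 0"
  shows "f = (\<lambda>_. 0)"
proof (cases "A = 0")
  case True
  then show ?thesis using supp by force
next
  case False
  define q where "q = lagrange {- int A..int A - 1} f"
  have "card {- int A..int A - 1} = 2 * A" by simp
  then have deg: "degree q < 2 * A"
    unfolding q_def using degree_lagrange_less[of "{- int A..int A - 1}" f] False by simp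
  define h where "h = (\<lambda>i. f i - poly q (of_int i))"
  have h0: "h i = 0" if "- int A \<le> i" "i \<le> int A - 1" for i
    using that unfolding h_def q_def by (simp add: poly_lagrange_node)
  have hd: "diffs 1 (2 * A) h x = 0" if "- int A \<le> x" "x \<le> -1" for x
    unfolding h_def diffs_diff using diffs[OF that] diffs_poly_eq_0[OF deg] by simp
  have hA: "h (int A + int j) = 0" if "j < A" for j
    using that
  proof (induction j rule: less_induct)
    case (less j)
    have "0 = diffs 1 (2 * A) h (int j - int A)"
      using hd[of "int j - int A"] less.prems by simp
    also have "\<dots> = (\<Sum>i\<le>2 * A. (-1) ^ i * of_nat ((2 * A) choose i) * h (int j - int A + int i * 1))"
      by (rule diffs_binomial)
    also have "\<dots> = (\<Sum>i\<le>2 * A. if i = 2 * A then h (int A + int j) else 0)"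
    proof (rule sum.cong[OF refl])
      fix i assume i: "i \<in> {..2 * A}"
      show "(-1) ^ i * of_nat ((2 * A) choose i) * h (int j - int A + int i * 1) =
          (if i = 2 * A then h (int A + int j) else 0)"
      proof (cases "i = 2 * A")
        case False
        have "h (int j - int A + int i) = 0"
        proof (cases "int j - int A + int i \<le> int A - 1")
          case True
          then show ?thesis by (intro h0) auto
        next
          case F: False
          define j' where "j' = nat (int j - 2 * int A + int i)"
          have j': "j' < j" "int A + int j' = int j - int A + int i"
            using F False i unfolding j'_def by auto
          then have "h (int A + int j') = 0" using less.IH[of j'] less.prems by simp
          then show ?thesis by (simp only: j'(2))
        qed
        then show ?thesis using False by simp
      qed (simp add: algebra_simps)
    qed
    also have "\<dots> = h (int A + int j)" by simp
    finally show ?case by simp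
  qed
  have h: "h i = 0" if "- int A \<le> i" "i \<le> 2 * int A - 1" for i
    using h0[of i] hA[of "nat (i - int A)"] that by (cases "i \<le> int A - 1") auto
  have "q = 0"
  proof (rule poly_eq_by_int_nodes[of "{- int A..-1} \<union> {int A..2 * int A - 1}"])
    have "card ({- int A..-1} \<union> {int A..2 * int A - 1}) = 2 * A"
      by (subst card_Un_disjoint) auto
    then show "degree q < card ({- int A..-1} \<union> {int A..2 * int A - 1})"
      "degree (0 :: complex poly) < card ({- int A..-1} \<union> {int A..2 * int A - 1})"
      using deg by auto
    fix k assume k: "k \<in> {- int A..-1} \<union> {int A..2 * int A - 1}"
    then have "h k = 0" "f k = 0" using h[of k] supp[of k] by auto
    then show "poly q (of_int k) = poly 0 (of_int k)" by (simp add: h_def)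
  qed auto
  then have "f i = 0" for i
    using h0[of i] supp[of i] unfolding h_def by (cases "0 \<le> i \<and> i < int A") auto
  then show ?thesis by auto
qed

text \<open>
  Summing row \<open>1\<close> of the lift gives a sequence \<open>s\<close>; by the equation at \<open>B1\<close> it is supported on
  \<open>{0..A - 1}\<close>. The equations at the inner vertices say that row \<open>n\<close> consists of the differences of order
  \<open>n\<close> of \<open>s\<close>. Row \<open>2A - 1\<close> is constant on \<open>{-A + 1..-1}\<close>, being the string of \<open>W3\<close>, and the equations at
  \<open>B2\<close> and \<open>B3\<close> extend this to \<open>{-A..0}\<close>. So the differences of order \<open>2A\<close> vanish on \<open>{-A..-1}\<close>, and
  \<open>s = 0\<close>.
\<close>

lemma Kred_kernel_trivial:
  assumes A: "A \<ge> 2" "even A"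
    and ker: "\<And>b. b \<in> blacks A \<Longrightarrow> (\<Sum>w\<in>whites A. Kred A b w * v w) = 0"
    and w: "w \<in> whites A"
  shows "v w = 0"
proof -
  define \<sigma> where "\<sigma> y m = (-1) powi (y + m) * white_lift A v y m" for y m
  define s where "s x = (if 0 \<le> x \<and> x \<le> int A - 1 then \<Sum>k=x..int A - 1. \<sigma> k 1 else 0)" for x
  define \<tau> where "\<tau> x n = diffs 1 (nat n) s x" for x n
  have supp: "s i = 0" if "i < 0 \<or> i \<ge> int A" for i using that by (auto simp: s_def)
  have rec: "\<tau> x n = \<tau> x (n - 1) - \<tau> (x + 1) (n - 1)" if "1 \<le> n" for x n
  proof -
    have "nat n = Suc (nat (n - 1))" using that by simp
    then show ?thesis unfolding \<tau>_def by simp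
  qed
  have t_right: "\<tau> x n = 0" if "x \<ge> int A" for x n
    unfolding \<tau>_def using that by (intro diffs_eq_0 supp) auto
  have t_left: "\<tau> x n = 0" if "x + n < 0" "n \<ge> 0" for x n
    unfolding \<tau>_def using that by (intro diffs_eq_0 supp) auto
  \<comment> \<open>This is what makes \<open>s\<close> fit at \<open>-1\<close>: \<open>\<sigma> (-1) 1 = s (-1) - s 0\<close> with \<open>s (-1) = 0\<close>.\<close>
  have row1: "(\<Sum>k=-1..int A - 1. \<sigma> k 1) = 0"
  proof -
    have "(\<Sum>k=-1..int A - 1. \<sigma> k 1) = (\<Sum>w\<in>whites A. Kred A B1 w * v w)"
      unfolding Kred_row_B1[OF A] \<sigma>_def ..
    then show ?thesis using ker[of B1] by (simp add: blacks_def)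
  qed
  have \<sigma>\<tau>: "white_dom A y n \<Longrightarrow> \<sigma> y n = \<tau> y n" if "1 \<le> n" for y n
    using that
  proof (induction n arbitrary: y rule: int_ge_induct)
    case base
    have y: "-1 \<le> y" "y \<le> int A - 1" using base by (auto simp: white_dom_def)
    have "{y..int A - 1} = insert y {y + 1..int A - 1}" using y by auto
    then have split: "(\<Sum>k=y..int A - 1. \<sigma> k 1) = \<sigma> y 1 + (\<Sum>k=y+1..int A - 1. \<sigma> k 1)" by simp
    have "\<tau> y 1 = s y - s (y + 1)" by (simp add: \<tau>_def)
    also have "s (y + 1) = (\<Sum>k=y+1..int A - 1. \<sigma> k 1)" using y by (auto simp: s_def)
    also have "s y = (\<Sum>k=y..int A - 1. \<sigma> k 1)" using y row1 by (cases "y = -1") (auto simp: s_def)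
    finally show ?case using split by simp
  next
    case (step n)
    define N where "N = n + 1"
    have N: "2 \<le> N" "n = N - 1" using step.hyps by (auto simp: N_def)
    have dom: "white_dom A y N" using step.prems by (simp add: N_def)
    then have d: "- N \<le> y" "- int A < y" "y \<le> int A - 1" "y \<le> 2 * int A - 2 - N" "N \<le> 2 * int A - 1"
      by (auto simp: white_dom_def)
    have IH: "\<sigma> z (N - 1) = \<tau> z (N - 1)" if "white_dom A z (N - 1)" for z
      using step.IH that N by simp
    have r: "\<tau> y N = \<tau> y (N - 1) - \<tau> (y + 1) (N - 1)" using rec[of N y] N by simp
    show ?case
    proof (cases "inner_black A y N")
      case True
      have "(\<Sum>w\<in>whites A. Kred A (B y N) w * v w) = 0"
        using True by (intro ker) (auto simp: blacks_def)
      then have "white_lift A v y N = - white_lift A v y (N - 1) - white_lift A v (y + 1) (N - 1)"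
        unfolding Kred_row_inner[OF A(1) True] by (simp add: algebra_simps eq_neg_iff_add_eq_0)
      then have "\<sigma> y N = \<sigma> y (N - 1) - \<sigma> (y + 1) (N - 1)"
        by (simp add: \<sigma>_def minus_one_powi)
      moreover have "white_dom A y (N - 1)" "white_dom A (y + 1) (N - 1)"
        using True N by (auto simp: white_dom_def inner_black_iff)
      ultimately show ?thesis using IH r by (simp add: N_def)
    next
      case False
      then consider "y = - N" "N \<le> int A - 1" | "y = int A - 1" "N \<le> int A - 1"
        using d N by (fastforce simp: inner_black_iff)
      then show ?thesis
      proof cases
        case 1
        have "white_dom A (y + 1) (N - 1)" using 1 N by (auto simp: white_dom_def)
        then have "\<tau> y N = - \<sigma> (y + 1) (N - 1)"
          using r IH t_left[of y "N - 1"] 1 N by simp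
        also have "\<dots> = \<sigma> y N"
          using 1 N A by (simp add: \<sigma>_def white_lift_def inner_white_iff minus_one_powi)
        finally show ?thesis by (simp add: N_def)
      next
        case 2
        have "white_dom A y (N - 1)" using 2 N by (auto simp: white_dom_def)
        then have "\<tau> y N = \<sigma> y (N - 1)"
          using r IH t_right[of "y + 1" "N - 1"] 2 N by simp
        also have "\<dots> = \<sigma> y N"
          using 2 N A by (simp add: \<sigma>_def white_lift_def inner_white_iff minus_one_powi)
        finally show ?thesis by (simp add: N_def)
      qed
    qed
  qed
  have top: "\<tau> x (2 * int A) = \<tau> x (2 * int A - 1) - \<tau> (x + 1) (2 * int A - 1)" for x
    using rec[of "2 * int A" x] A by simp
  interpret white_recursion A v \<tau>
  proof
    fix y m assume d: "white_dom A y m"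
    then have "\<tau> y m = (-1) powi (y + m) * white_lift A v y m"
      using \<sigma>\<tau>[of m y] by (simp add: white_dom_def \<sigma>_def)
    then show "white_lift A v y m = (-1) powi (y + m) * \<tau> y m"
      by (simp add: minus_one_powi)
  qed (use A rec in auto)
  have "diffs 1 (2 * A) s x = 0" if x: "- int A \<le> x" "x \<le> -1" for x
  proof -
    have "\<tau> x (2 * int A) = 0"
    proof -
      consider "x = -1" | "x = - int A" | "- int A < x" "x < -1" using x by linarith
      then show ?thesis
      proof cases
        case 1
        then show ?thesis
          using row_B2 ker[of B2] t_right[of "int A"] top[of "-1"] by (simp add: blacks_def)
      next
        case 2
        then show ?thesis
          using row_B3 ker[of B3] t_left[of "- int A" "int A - 1"] top[of "- int A"] A
          by (simp add: blacks_def)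
      next
        case 3
        have "\<tau> x (2 * int A - 1) = v W3" if "- int A < x" "x \<le> -1" for x
        proof -
          have "white_dom A x (2 * int A - 1)" using that A by (auto simp: white_dom_def)
          then have "\<tau> x (2 * int A - 1) = \<sigma> x (2 * int A - 1)" using \<sigma>\<tau>[of "2 * int A - 1" x] A by simp
          then show ?thesis using A by (auto simp: \<sigma>_def white_lift_def inner_white_iff minus_one_powi)
        qed
        then show ?thesis using 3 top[of x] by simp
      qed
    qed
    then show ?thesis by (simp add: \<tau>_def nat_mult_distrib)
  qed
  then have "s = (\<lambda>_. 0)" using supported_diffs_eq_0_imp_eq_0[of A s] supp by blast
  then have "\<tau> x n = 0" for x n unfolding \<tau>_def by (intro diffs_eq_0) simp
  then have l: "white_lift A v y m = 0" if "white_dom A y m" for y m using lift[OF that] by simp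
  consider y m where "w = W y m" "inner_white A y m" | "w = W1" | "w = W2" | "w = W3"
    using w by (auto simp: whites_def)
  then show ?thesis
  proof cases
    case (1 y m)
    then show ?thesis using l[of y m] by (auto simp: white_lift_def white_dom_def inner_white_iff)
  next
    case 2
    then show ?thesis using l[of "-1" 1] A by (auto simp: white_lift_def white_dom_def inner_white_iff)
  next
    case 3
    then show ?thesis using l[of "int A - 1" 1] A by (auto simp: white_lift_def white_dom_def inner_white_iff)
  next
    case 4
    then show ?thesis using l[of "-1" "2 * int A - 1"] A by (auto simp: white_lift_def white_dom_def inner_white_iff)
  qed
qed

text \<open>
  Inner vertices with the same coordinates are matched, and the top row of black vertices is matched
  with the bottom row of white vertices.
\<close>

lemma card_blacks_eq_card_whites:
  assumes "A \<ge> 2"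
  shows "card (blacks A) = card (whites A)"
proof -
  define h :: "int \<times> int \<Rightarrow> int \<times> int" where
    "h = (\<lambda>(x, n). if n = 2 * int A - 1 then (x + int A - 1, 1) else (x, n))"
  define h' :: "int \<times> int \<Rightarrow> int \<times> int" where
    "h' = (\<lambda>(y, m). if m = 1 then (y - int A + 1, 2 * int A - 1) else (y, m))"
  have "bij_betw h (inner_black_set A) (inner_white_set A)"
  proof (rule bij_betw_byWitness[where f' = h'])
    show "\<forall>a\<in>inner_black_set A. h' (h a) = a"
      using assms by (auto simp: h_def h'_def inner_black_set_def inner_black_iff)
    show "\<forall>a\<in>inner_white_set A. h (h' a) = a"
      using assms by (auto simp: h_def h'_def inner_white_set_def inner_white_iff)
    show "h ` inner_black_set A \<subseteq> inner_white_set A"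
      using assms by (auto simp: h_def inner_black_set_def inner_black_iff inner_white_set_def inner_white_iff split: if_splits)
    show "h' ` inner_white_set A \<subseteq> inner_black_set A"
      using assms by (auto simp: h'_def inner_black_set_def inner_black_iff inner_white_set_def inner_white_iff split: if_splits)
  qed
  then have c: "card (inner_black_set A) = card (inner_white_set A)" by (rule bij_betw_same_card)
  have inj: "inj_on (\<lambda>(x, n). B x n) I" "inj_on (\<lambda>(y, m). W y m) I" for I
    by (auto simp: inj_on_def)
  have "card (blacks A) = card (inner_black_set A) + 3"
    unfolding blacks_eq by (subst card_Un_disjoint) (auto simp: card_image[OF inj(1)] card_image[OF inj(2)])
  moreover have "card (whites A) = card (inner_white_set A) + 3"
    unfolding whites_eq by (subst card_Un_disjoint) (auto simp: card_image[OF inj(1)] card_image[OF inj(2)])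
  ultimately show ?thesis using c by simp
qed

lemma Kinv_inverse:
  assumes A: "A \<ge> 2" "even A"
  shows "b \<in> blacks A \<Longrightarrow> b' \<in> blacks A \<Longrightarrow>
      (\<Sum>w\<in>whites A. Kred A b w * Kinv A w b') = (if b = b' then 1 else 0)" (is "_ \<Longrightarrow> _ \<Longrightarrow> ?KR b b'")
    and "w \<in> whites A \<Longrightarrow> w' \<in> whites A \<Longrightarrow>
      (\<Sum>b\<in>blacks A. Kinv A w b * Kred A b w') = (if w = w' then 1 else 0)" (is "_ \<Longrightarrow> _ \<Longrightarrow> ?RK w w'")
proof -
  define inv where "inv R \<longleftrightarrow>
     (\<forall>w b. \<not> (w \<in> whites A \<and> b \<in> blacks A) \<longrightarrow> R w b = 0) \<and>
     (\<forall>b\<in>blacks A. \<forall>b'\<in>blacks A.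
        (\<Sum>w\<in>whites A. Kred A b w * R w b') = (if b = b' then 1 else 0)) \<and>
     (\<forall>w\<in>whites A. \<forall>w'\<in>whites A.
        (\<Sum>b\<in>blacks A. R w b * Kred A b w') = (if w = w' then 1 else 0))" for R
  have "\<forall>w\<in>whites A. v w = 0" if "\<forall>b\<in>blacks A. (\<Sum>w\<in>whites A. Kred A b w * v w) = 0" for v
    using Kred_kernel_trivial[OF A, of v] that by simp
  from square_matrix_two_sided_inverse[OF finite_vertices(2,1) card_blacks_eq_card_whites[OF A(1)] this]
  obtain r where
    r: "\<forall>b\<in>blacks A. \<forall>b'\<in>blacks A. (\<Sum>w\<in>whites A. Kred A b w * r w b') = (if b = b' then 1 else 0)"
       "\<forall>w\<in>whites A. \<forall>w'\<in>whites A. (\<Sum>b\<in>blacks A. r w b * Kred A b w') = (if w = w' then 1 else 0)"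
    by blast
  define R where "R w b = (if w \<in> whites A \<and> b \<in> blacks A then r w b else 0)" for w b
  have inv_R: "inv R" unfolding inv_def R_def using r by simp
  have unique: "R' = R''" if R': "inv R'" and R'': "inv R''" for R' R''
  proof (intro ext)
    fix w b
    show "R' w b = R'' w b"
    proof (cases "w \<in> whites A \<and> b \<in> blacks A")
      case True
      have "R' w b = (\<Sum>b'\<in>blacks A. R' w b' * (if b' = b then 1 else 0))"
        using True by (simp add: if_distrib cong: if_cong)
      also have "\<dots> = (\<Sum>b'\<in>blacks A. R' w b' * (\<Sum>w'\<in>whites A. Kred A b' w' * R'' w' b))"
        by (rule sum.cong) (use True R'' in \<open>auto simp: inv_def\<close>)
      also have "\<dots> = (\<Sum>b'\<in>blacks A. \<Sum>w'\<in>whites A. R' w b' * Kred A b' w' * R'' w' b)"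
        by (simp add: sum_distrib_left mult.assoc)
      also have "\<dots> = (\<Sum>w'\<in>whites A. (\<Sum>b'\<in>blacks A. R' w b' * Kred A b' w') * R'' w' b)"
        unfolding sum_distrib_right by (rule sum.swap)
      also have "\<dots> = (\<Sum>w'\<in>whites A. if w = w' then R'' w' b else 0)"
        by (rule sum.cong) (use True R' in \<open>auto simp: inv_def\<close>)
      also have "\<dots> = R'' w b" using True by simp
      finally show ?thesis .
    next
      case False
      then show ?thesis using R' R'' by (simp add: inv_def)
    qed
  qed
  have "inv (THE R. inv R)" by (rule theI[of inv, OF inv_R unique[OF _ inv_R]])
  moreover have "Kinv A = (THE R. inv R)" unfolding Kinv_def inv_def ..
  ultimately have K: "inv (Kinv A)" by simp
  show "b \<in> blacks A \<Longrightarrow> b' \<in> blacks A \<Longrightarrow> ?KR b b'" "w \<in> whites A \<Longrightarrow> w' \<in> whites A \<Longrightarrow> ?RK w w'"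
    using K unfolding inv_def by blast+
qed

text \<open>
  This is how the gauge functions are identified: their closed forms solve the defining systems.
\<close>

lemma Kinv_solve_white:
  assumes A: "A \<ge> 2" "even A" and w: "w \<in> whites A"
    and sys: "\<And>b. b \<in> blacks A \<Longrightarrow> (\<Sum>w\<in>whites A. Kred A b w * s w) = h b"
  shows "s w = (\<Sum>b\<in>blacks A. Kinv A w b * h b)"
proof -
  have "(\<Sum>b\<in>blacks A. Kinv A w b * h b) = (\<Sum>b\<in>blacks A. \<Sum>w'\<in>whites A. Kinv A w b * Kred A b w' * s w')"
    by (simp add: sys [symmetric] sum_distrib_left mult.assoc)
  also have "\<dots> = (\<Sum>w'\<in>whites A. (\<Sum>b\<in>blacks A. Kinv A w b * Kred A b w') * s w')"
    unfolding sum_distrib_right by (rule sum.swap)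
  also have "\<dots> = (\<Sum>w'\<in>whites A. if w = w' then s w' else 0)"
    by (rule sum.cong) (use w Kinv_inverse(2)[OF A] in auto)
  finally show ?thesis using w by simp
qed

lemma Kinv_solve_black:
  assumes A: "A \<ge> 2" "even A" and b: "b \<in> blacks A"
    and sys: "\<And>w. w \<in> whites A \<Longrightarrow> (\<Sum>b\<in>blacks A. t b * Kred A b w) = h w"
  shows "t b = (\<Sum>w\<in>whites A. h w * Kinv A w b)"
proof -
  have "(\<Sum>w\<in>whites A. h w * Kinv A w b) = (\<Sum>w\<in>whites A. \<Sum>b'\<in>blacks A. t b' * (Kred A b' w * Kinv A w b))"
    by (simp add: sys [symmetric] sum_distrib_right mult.assoc)
  also have "\<dots> = (\<Sum>b'\<in>blacks A. t b' * (\<Sum>w\<in>whites A. Kred A b' w * Kinv A w b))"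
    unfolding sum_distrib_left by (rule sum.swap)
  also have "\<dots> = (\<Sum>b'\<in>blacks A. if b' = b then t b' else 0)"
    by (rule sum.cong) (use b Kinv_inverse(1)[OF A] in auto)
  finally show ?thesis using b by simp
qed


section \<open>The gauge function on white vertices\<close>

text \<open>
  Up to the sign \<open>(-1)^(x + n)\<close>, the values of the white gauge function, continued to all integers \<open>x\<close>.
\<close>

definition white_amp :: "complex \<Rightarrow> complex \<Rightarrow> nat \<Rightarrow> int \<Rightarrow> int \<Rightarrow> complex" where
  "white_amp \<alpha> \<beta> A x n = fact (2 * A - 1) / fact (nat (2 * int A - 1 - n)) *
     white_functional \<alpha> \<beta> A (\<lambda>z. pochhammer (z - of_int x + 1) (nat (2 * int A - 1 - n)))"

lemma white_amp_rec:
  assumes "n \<le> 2 * int A - 1"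
  shows "white_amp \<alpha> \<beta> A x n = white_amp \<alpha> \<beta> A x (n - 1) - white_amp \<alpha> \<beta> A (x + 1) (n - 1)"
proof -
  define m where "m = nat (2 * int A - 1 - n)"
  have m: "nat (2 * int A - 1 - (n - 1)) = Suc m" using assms by (simp add: m_def)
  have d: "pochhammer (z - of_int x + 1) (Suc m) - pochhammer (z - of_int (x + 1) + 1) (Suc m) =
      pochhammer (z - of_int x + 1) m * of_nat (Suc m)" for z :: complex
  proof -
    have "z - of_int (x + 1) + 1 = z - of_int x" by simp
    then have 1: "pochhammer (z - of_int (x + 1) + 1) (Suc m) = (z - of_int x) * pochhammer (z - of_int x + 1) m"
      by (simp only: pochhammer_rec)
    have 2: "pochhammer (z - of_int x + 1) (Suc m) = pochhammer (z - of_int x + 1) m * (z - of_int x + 1 + of_nat m)"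
      by (rule pochhammer_Suc)
    show ?thesis unfolding 1 2 by (simp add: algebra_simps)
  qed
  have "white_amp \<alpha> \<beta> A x (n - 1) - white_amp \<alpha> \<beta> A (x + 1) (n - 1) =
      fact (2 * A - 1) / fact (Suc m) * white_functional \<alpha> \<beta> A (\<lambda>z. pochhammer (z - of_int x + 1) m * of_nat (Suc m))"
    unfolding white_amp_def m d [symmetric] white_functional_lin(1) by (simp only: right_diff_distrib)
  also have "\<dots> = fact (2 * A - 1) / fact m * white_functional \<alpha> \<beta> A (\<lambda>z. pochhammer (z - of_int x + 1) m)"
    unfolding white_functional_lin(3) by (simp add: fact_Suc field_simps del: of_nat_Suc)
  finally show ?thesis unfolding white_amp_def m_def by simp
qed

lemma fact_split:
  assumes "A > 0"
  shows "(fact (2 * A - 1) :: complex) = fact (A - 1) * pochhammer (of_nat A) A"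
proof -
  have "pochhammer (1 :: complex) (2 * A - 1) = pochhammer 1 (A - 1) * pochhammer (1 + of_nat (A - 1)) (2 * A - 1 - (A - 1))"
    by (rule pochhammer_product) (use assms in simp)
  moreover have "2 * A - 1 - (A - 1) = A" "1 + of_nat (A - 1) = (of_nat A :: complex)"
    using assms by (auto simp: of_nat_diff)
  ultimately show ?thesis by (simp only: pochhammer_fact)
qed

lemma pochhammer_even_neg:
  assumes "even A"
  shows "pochhammer (- of_nat A :: complex) A = fact A"
  using pochhammer_minus[of "of_nat A :: complex" A] assms by (simp add: pochhammer_fact)

lemma white_residue_minus_1:
  assumes A: "A \<ge> 2" "even A"
  shows "white_residue \<alpha> \<beta> A (-1) = \<alpha> / fact (2 * A - 1)"
proof -
  have "white_poles A - {-1} = insert (- int A) (interp_nodes A)"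
    using white_poles_eq[OF A(1)] by auto
  then have "(\<Prod>j\<in>white_poles A - {-1}. of_int (-1) - of_int j :: complex) =
      (of_nat A - 1) * (\<Prod>j\<in>interp_nodes A. -1 - of_int j)"
    using white_poles_eq[OF A(1)] by simp
  also have "(\<Prod>j\<in>interp_nodes A. -1 - of_int j :: complex) = pochhammer (- 2 * of_nat A + 1) A * fact A"
    using prod_interp_nodes[of A "-1"] by (simp add: pochhammer_fact)
  also have "pochhammer (- 2 * of_nat A + 1 :: complex) A = pochhammer (of_nat A) A"
    using pochhammer_minus[of "2 * of_nat A - 1 :: complex" A] A by (simp add: algebra_simps)
  finally have p: "(\<Prod>j\<in>white_poles A - {-1}. of_int (-1) - of_int j :: complex) =
      (of_nat A - 1) * (pochhammer (of_nat A) A * fact A)" .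
  have f: "fact A = of_nat A * (fact (A - 1) :: complex)" using A by (simp add: fact_reduce)
  have "(of_nat A - 1 :: complex) \<noteq> 0" "(of_nat A :: complex) \<noteq> 0" using A by auto
  moreover have num: "poly (white_num \<alpha> \<beta> A) (of_int (-1)) = of_nat A * (of_nat A - 1) * \<alpha>"
    by (simp add: poly_white_num algebra_simps)
  moreover have fs: "(fact (2 * A - 1) :: complex) = fact (A - 1) * pochhammer (of_nat A) A"
    using A by (intro fact_split) simp
  ultimately show ?thesis unfolding white_residue_def p f num fs by simp
qed

lemma white_residue_minus_A:
  assumes A: "A \<ge> 2" "even A"
  shows "white_residue \<alpha> \<beta> A (- int A) = - \<beta> / fact (2 * A - 1)"
proof -
  have "white_poles A - {- int A} = insert (-1) (interp_nodes A)" "-1 \<notin> interp_nodes A"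
    using white_poles_eq[OF A(1)] by auto
  then have "(\<Prod>j\<in>white_poles A - {- int A}. of_int (- int A) - of_int j :: complex) =
      (1 - of_nat A) * (\<Prod>j\<in>interp_nodes A. - of_nat A - of_int j)"
    by simp
  also have "(\<Prod>j\<in>interp_nodes A. - of_nat A - of_int j :: complex) = fact A * pochhammer (of_nat A) A"
    using prod_interp_nodes[of A "- of_nat A"] pochhammer_even_neg[OF A(2)] by simp
  finally have p: "(\<Prod>j\<in>white_poles A - {- int A}. of_int (- int A) - of_int j :: complex) =
      (1 - of_nat A) * (fact A * pochhammer (of_nat A) A)" .
  have f: "fact A = of_nat A * (fact (A - 1) :: complex)" using A by (simp add: fact_reduce)
  have nz: "(1 - of_nat A :: complex) \<noteq> 0" "(of_nat A :: complex) \<noteq> 0" using A by auto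
  have num: "poly (white_num \<alpha> \<beta> A) (of_int (- int A)) = of_nat A * (1 - of_nat A) * (- \<beta>)"
    by (simp add: poly_white_num algebra_simps)
  have fs: "(fact (2 * A - 1) :: complex) = fact (A - 1) * pochhammer (of_nat A) A"
    using A by (intro fact_split) simp
  show ?thesis unfolding white_residue_def p f num fs using nz by simp
qed

lemma coeff_mult_top:
  fixes p q :: "complex poly"
  assumes "degree p \<le> m" "degree q \<le> n"
  shows "coeff (p * q) (m + n) = coeff p m * coeff q n"
proof -
  have "coeff (p * q) (m + n) = (\<Sum>i\<le>m + n. if i = m then coeff p m * coeff q n else 0)"
    unfolding coeff_mult
  proof (rule sum.cong[OF refl])
    fix i assume "i \<in> {..m + n}"
    then show "coeff p i * coeff q (m + n - i) = (if i = m then coeff p m * coeff q n else 0)"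
      using assms coeff_eq_0[of p i] coeff_eq_0[of q "m + n - i"]
      by (cases i m rule: linorder_cases) auto
  qed
  then show ?thesis by simp
qed

text \<open>
  The residues at all poles add up to minus the coefficient of \<open>z^(2A - 1)\<close>, as \<open>g(z)\<close> tends to \<open>-1\<close> at
  infinity. Under the hypothesis on zeros, \<open>-A\<close> is the only pole besides those of the functional. It
  carries the parameter \<open>\<beta>\<close>, and \<open>-1\<close> carries \<open>\<alpha>\<close>.
\<close>

lemma white_functional_poly:
  fixes q :: "complex poly"
  assumes A: "A \<ge> 2" "even A" and deg: "degree q \<le> 2 * A - 1"
    and zeros: "\<And>k. - 2 * int A \<le> k \<Longrightarrow> k \<le> - int A - 1 \<Longrightarrow> poly q (of_int k) = 0"
  shows "white_functional \<alpha> \<beta> A (poly q) =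
    - coeff q (2 * A - 1) + \<beta> * poly q (- of_nat A) / fact (2 * A - 1)"
proof -
  have dn: "degree (white_num \<alpha> \<beta> A) \<le> 2"
    unfolding white_num_def by (intro degree_add_le degree_diff_le) auto
  have "degree (q * white_num \<alpha> \<beta> A) \<le> (2 * A - 1) + 2"
    by (rule order_trans[OF degree_mult_le]) (use deg dn in linarith)
  then have "(\<Sum>k\<in>white_poles A. poly (q * white_num \<alpha> \<beta> A) (of_int k) / (node_weight (white_poles A) k)) =
      coeff (q * white_num \<alpha> \<beta> A) (card (white_poles A) - 1)"
    using A white_poles_eq(4)[OF A(1)] by (intro sum_poly_over_node_products) auto
  also have "card (white_poles A) - 1 = (2 * A - 1) + 2" using A white_poles_eq(4)[OF A(1)] by simp
  also have "coeff (q * white_num \<alpha> \<beta> A) \<dots> = coeff q (2 * A - 1) * coeff (white_num \<alpha> \<beta> A) 2"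
    by (rule coeff_mult_top[OF deg dn])
  also have "coeff (white_num \<alpha> \<beta> A) 2 = -1"
    by (simp add: white_num_def numeral_2_eq_2)
  finally have total: "(\<Sum>k\<in>white_poles A. white_residue \<alpha> \<beta> A k * poly q (of_int k)) = - coeff q (2 * A - 1)"
    by (simp add: white_residue_def mult.commute)
  have "white_poles A = {- 2 * int A..- int A - 1} \<union> insert (- int A) {-1..int A - 1}"
    using A by (auto simp: white_poles_def)
  then have "(\<Sum>k\<in>white_poles A. white_residue \<alpha> \<beta> A k * poly q (of_int k)) =
      (\<Sum>k\<in>{- 2 * int A..- int A - 1}. white_residue \<alpha> \<beta> A k * poly q (of_int k)) +
      (\<Sum>k\<in>insert (- int A) {-1..int A - 1}. white_residue \<alpha> \<beta> A k * poly q (of_int k))"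
    using A by (simp only:) (rule sum.union_disjoint, auto)
  also have "(\<Sum>k\<in>{- 2 * int A..- int A - 1}. white_residue \<alpha> \<beta> A k * poly q (of_int k)) = 0"
    by (intro sum.neutral) (use zeros in auto)
  also have "(\<Sum>k\<in>insert (- int A) {-1..int A - 1}. white_residue \<alpha> \<beta> A k * poly q (of_int k)) =
      - \<beta> / fact (2 * A - 1) * poly q (- of_nat A) + white_functional \<alpha> \<beta> A (poly q)"
    using A white_residue_minus_A[OF A] by (simp add: white_functional_def)
  finally show ?thesis unfolding total by (simp add: algebra_simps eq_neg_iff_add_eq_0)
qed

lemma white_functional_vanishing:
  assumes A: "A \<ge> 2" "even A" and zeros: "\<And>k. 0 \<le> k \<Longrightarrow> k \<le> int A - 1 \<Longrightarrow> \<phi> (of_int k) = 0"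
  shows "white_functional \<alpha> \<beta> A \<phi> = \<alpha> * \<phi> (-1) / fact (2 * A - 1)"
proof -
  have "{-1..int A - 1} = insert (-1) {0..int A - 1}" by auto
  then have "white_functional \<alpha> \<beta> A \<phi> = white_residue \<alpha> \<beta> A (-1) * \<phi> (-1) +
      (\<Sum>k=0..int A - 1. white_residue \<alpha> \<beta> A k * \<phi> (of_int k))"
    by (simp add: white_functional_def)
  also have "(\<Sum>k=0..int A - 1. white_residue \<alpha> \<beta> A k * \<phi> (of_int k)) = 0"
    by (intro sum.neutral) (use zeros in auto)
  finally show ?thesis unfolding white_residue_minus_1[OF A] by simp
qed

lemma pochhammer_as_poly:
  obtains q :: "complex poly" where "\<And>z. poly q z = pochhammer (z - a) m" "degree q = m" "coeff q m = 1"
proof -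
  define q where "q = (\<Prod>i<m. [:of_nat i - a, 1:] :: complex poly)"
  have "poly q z = pochhammer (z - a) m" for z
    unfolding q_def pochhammer_prod by (simp add: poly_prod algebra_simps atLeast0LessThan)
  moreover have deg: "degree q = m"
    unfolding q_def by (subst degree_prod_eq_sum_degree) auto
  moreover have "lead_coeff q = 1" unfolding q_def by (simp add: lead_coeff_prod)
  ultimately show thesis using that by metis
qed

lemma pochhammer_int_eq_0:
  assumes "y - int m < k" "k \<le> y"
  shows "pochhammer (of_int k - of_int y :: complex) m = 0"
  unfolding pochhammer_eq_0_iff
proof (intro exI conjI)
  show "nat (y - k) < m" using assms by linarith
  have "of_nat (nat (y - k)) = (of_int (y - k) :: complex)" using assms by simp
  then show "of_int k - of_int y = (- of_nat (nat (y - k)) :: complex)" by simp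
qed

text \<open>
  The three nonzero cases of \<open>white_amp_left\<close> and \<open>white_amp_right\<close> are the coefficients \<open>-1\<close>, \<open>\<alpha>\<close>, \<open>\<beta>\<close>
  of the columns \<open>B1\<close>, \<open>B2\<close>, \<open>B3\<close> of the inverse; the zeros are the reason for the alternating signs along
  the strings of \<open>W1\<close> and \<open>W2\<close>. They come from the residue at infinity, at \<open>-1\<close> and at \<open>-A\<close>.
\<close>

lemma white_amp_left:
  assumes A: "A \<ge> 2" "even A" and m: "1 \<le> m" "m \<le> int A"
  shows "white_amp \<alpha> \<beta> A (- m) (m - 1) = (if m = 1 then -1 else if m = int A then \<beta> else 0)"
proof -
  define M where "M = nat (2 * int A - m)"
  have M: "nat (2 * int A - 1 - (m - 1)) = M" "int M = 2 * int A - m" using m by (auto simp: M_def)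
  obtain q :: "complex poly" where
    q: "\<And>z. poly q z = pochhammer (z - of_int (- m - 1)) M" "degree q = M" "coeff q M = 1"
    using pochhammer_as_poly[where a = "of_int (- m - 1)" and m = M] by blast
  have zero: "poly q (of_int k) = 0" if "- 2 * int A \<le> k" "k \<le> - m - 1" for k
    unfolding q(1) by (rule pochhammer_int_eq_0) (use that M in auto)
  have "white_functional \<alpha> \<beta> A (poly q) = - coeff q (2 * A - 1) + \<beta> * poly q (- of_nat A) / fact (2 * A - 1)"
    by (rule white_functional_poly[OF A]) (use q(2) M m zero in auto)
  moreover have "coeff q (2 * A - 1) = (if m = 1 then 1 else 0)"
  proof (cases "m = 1")
    case True
    then have "M = 2 * A - 1" using M by linarith
    then show ?thesis using q(3) True by simp
  next
    case False
    then show ?thesis using m M q(2) by (auto intro!: coeff_eq_0)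
  qed
  moreover have "poly q (- of_nat A) = (if m = int A then fact A else 0)"
  proof (cases "m = int A")
    case True
    then have "M = A" using M by linarith
    then show ?thesis using q(1)[of "- of_nat A"] True by (simp add: pochhammer_fact)
  next
    case False
    then show ?thesis using zero[of "- int A"] m by simp
  qed
  moreover have "white_amp \<alpha> \<beta> A (- m) (m - 1) = fact (2 * A - 1) / fact M * white_functional \<alpha> \<beta> A (poly q)"
  proof -
    have "(\<lambda>z. pochhammer (z - of_int (- m) + 1) M) = poly q"
      unfolding q(1) by (simp add: fun_eq_iff algebra_simps)
    then show ?thesis unfolding white_amp_def M by simp
  qed
  moreover have "M = 2 * A - 1" if "m = 1" using that M by linarith
  moreover have "M = A" if "m = int A" using that M by linarith
  moreover have "\<not> (m = 1 \<and> m = int A)" using A by auto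
  ultimately show ?thesis by (cases "m = 1"; cases "m = int A"; simp)
qed

lemma white_amp_right:
  assumes A: "A \<ge> 2" "even A" and m: "0 \<le> m" "m \<le> int A - 1"
  shows "white_amp \<alpha> \<beta> A (int A) m = (if m = int A - 1 then \<alpha> else 0)"
proof -
  define M where "M = nat (2 * int A - 1 - m)"
  have M: "int M = 2 * int A - 1 - m" using m by (auto simp: M_def)
  define \<phi> where "\<phi> = (\<lambda>z :: complex. pochhammer (z - of_int (int A - 1)) M)"
  have zero: "\<phi> (of_int k) = 0" if "m - int A < k" "k \<le> int A - 1" for k
    unfolding \<phi>_def by (rule pochhammer_int_eq_0) (use that M in auto)
  have "white_functional \<alpha> \<beta> A \<phi> = \<alpha> * \<phi> (-1) / fact (2 * A - 1)"
    by (rule white_functional_vanishing[OF A]) (use zero m in auto)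
  moreover have "\<phi> (-1) = (if m = int A - 1 then fact A else 0)"
  proof (cases "m = int A - 1")
    case True
    then have "M = A" using M by linarith
    then show ?thesis using pochhammer_even_neg[OF A(2)] True by (simp add: \<phi>_def)
  next
    case False
    then show ?thesis using zero[of "-1"] m by simp
  qed
  moreover have "white_amp \<alpha> \<beta> A (int A) m = fact (2 * A - 1) / fact M * white_functional \<alpha> \<beta> A \<phi>"
    unfolding white_amp_def M_def \<phi>_def by (simp add: algebra_simps)
  moreover have "M = A" if "m = int A - 1" using that M by linarith
  ultimately show ?thesis by auto
qed

text \<open>
  At \<open>W1\<close>, \<open>W2\<close>, \<open>W3\<close> the value of the lift at a vertex of the string whose sign is \<open>1\<close>.
\<close>

definition white_gauge :: "complex \<Rightarrow> complex \<Rightarrow> nat \<Rightarrow> white \<Rightarrow> complex" where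
  "white_gauge \<alpha> \<beta> A w = (case w of
      W y m \<Rightarrow> (-1) powi (y + m) * white_amp \<alpha> \<beta> A y m
    | W1 \<Rightarrow> white_amp \<alpha> \<beta> A (-1) 1
    | W2 \<Rightarrow> white_amp \<alpha> \<beta> A (int A - 1) 1
    | W3 \<Rightarrow> white_amp \<alpha> \<beta> A (-1) (2 * int A - 1))"

lemma white_gauge_lift:
  assumes A: "A \<ge> 2" "even A" and d: "white_dom A y m"
  shows "white_lift A (white_gauge \<alpha> \<beta> A) y m = (-1) powi (y + m) * white_amp \<alpha> \<beta> A y m"
proof -
  let ?\<tau> = "white_amp \<alpha> \<beta> A"
  have left: "?\<tau> (- k) k = (-1) powi (k + 1) * ?\<tau> (-1) 1" if "1 \<le> k" "k \<le> int A - 1" for k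
    using that
  proof (induction k rule: int_ge_induct)
    case (step k)
    have "?\<tau> (- (k + 1)) (k + 1) = ?\<tau> (- (k + 1)) k - ?\<tau> (- k) k"
      using white_amp_rec[of "k + 1" A \<alpha> \<beta> "- (k + 1)"] step by simp
    also have "?\<tau> (- (k + 1)) k = 0"
      using white_amp_left[OF A, of "k + 1" \<alpha> \<beta>] step by simp
    finally show ?case using step by (simp add: minus_one_powi)
  qed simp
  have right: "?\<tau> (int A - 1) k = ?\<tau> (int A - 1) 1" if "1 \<le> k" "k \<le> int A - 1" for k
    using that
  proof (induction k rule: int_ge_induct)
    case (step k)
    have "?\<tau> (int A - 1) (k + 1) = ?\<tau> (int A - 1) k - ?\<tau> (int A) k"
      using white_amp_rec[of "k + 1" A \<alpha> \<beta> "int A - 1"] step by simp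
    also have "?\<tau> (int A) k = 0"
      using white_amp_right[OF A, of k \<alpha> \<beta>] step by simp
    finally show ?case using step by simp
  qed simp
  have top: "?\<tau> y (2 * int A - 1) = ?\<tau> (-1) (2 * int A - 1)" by (simp add: white_amp_def)
  consider "inner_white A y m" | "m = 2 * int A - 1" | "m \<noteq> 2 * int A - 1" "y = - m" "1 \<le> m" "m \<le> int A - 1"
    | "m \<noteq> 2 * int A - 1" "y = int A - 1" "1 \<le> m" "m \<le> int A - 1"
    using d by (fastforce simp: white_dom_def inner_white_iff)
  then show ?thesis
  proof cases
    case 1
    then show ?thesis by (simp add: white_lift_def white_gauge_def)
  next
    case 2
    then show ?thesis using top by (simp add: white_lift_def white_gauge_def inner_white_iff minus_one_powi)
  next
    case 3
    then show ?thesis using left[of m] by (simp add: white_lift_def white_gauge_def inner_white_iff minus_one_powi)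
  next
    case 4
    then show ?thesis using right[of m] A by (auto simp: white_lift_def white_gauge_def inner_white_iff minus_one_powi)
  qed
qed

lemma white_gauge_eq_Kinv:
  assumes A: "A \<ge> 2" "even A" and w: "w \<in> whites A"
  shows "white_gauge \<alpha> \<beta> A w = - Kinv A w B1 + \<alpha> * Kinv A w B2 + \<beta> * Kinv A w B3"
proof -
  let ?h = "\<lambda>b. case b of B x n \<Rightarrow> 0 | B1 \<Rightarrow> -1 | B2 \<Rightarrow> \<alpha> | B3 \<Rightarrow> \<beta>"
  interpret white_recursion A "white_gauge \<alpha> \<beta> A" "white_amp \<alpha> \<beta> A"
    by unfold_locales (fact A | rule white_amp_rec | rule white_gauge_lift[OF A] | assumption)+
  have top: "white_amp \<alpha> \<beta> A y (2 * int A - 1) = white_amp \<alpha> \<beta> A (-1) (2 * int A - 1)" for y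
    by (simp add: white_amp_def)
  have "white_gauge \<alpha> \<beta> A w = (\<Sum>b\<in>blacks A. Kinv A w b * ?h b)"
  proof (rule Kinv_solve_white[OF A w])
    fix b assume "b \<in> blacks A"
    then consider x n where "b = B x n" "inner_black A x n" | "b = B1" | "b = B2" | "b = B3"
      by (auto simp: blacks_def)
    then show "(\<Sum>w\<in>whites A. Kred A b w * white_gauge \<alpha> \<beta> A w) = ?h b"
    proof cases
      case 1
      then show ?thesis using row_inner by simp
    next
      case 2
      then show ?thesis
        using row_B1 white_amp_left[OF A, of 1 \<alpha> \<beta>] white_amp_right[OF A, of 0 \<alpha> \<beta>] A by simp
    next
      case 3
      then show ?thesis
        using row_B2 white_amp_right[OF A, of "int A - 1" \<alpha> \<beta>] top[of 0] A by simp
    next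
      case 4
      then show ?thesis
        using row_B3 white_amp_left[OF A, of "int A" \<alpha> \<beta>] top[of "- int A"] top[of "- int A + 1"] A by simp
    qed
  qed
  then show ?thesis unfolding sum_blacks by (simp add: case_prod_unfold mult.commute)
qed

lemma F_white_eq:
  "A \<ge> 2 \<Longrightarrow> even A \<Longrightarrow> w \<in> whites A \<Longrightarrow> F_white A w = white_gauge (cis (pi / 3)) (cis (- pi / 3)) A w"
  by (simp add: F_white_def white_gauge_eq_Kinv)

lemma cnj_white_amp: "cnj (white_amp \<alpha> \<beta> A x n) = white_amp (cnj \<alpha>) (cnj \<beta>) A x n"
proof -
  have "cnj (pochhammer (of_int k - of_int x + 1) m) = pochhammer (of_int k - of_int x + 1) m" for k m
    by (simp add: pochhammer_prod)
  moreover have "cnj (white_residue \<alpha> \<beta> A k) = white_residue (cnj \<alpha>) (cnj \<beta>) A k" for k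
    by (simp add: white_residue_def poly_white_num)
  ultimately show ?thesis by (simp add: white_amp_def white_functional_def)
qed

lemma cnj_F_white_eq:
  assumes "A \<ge> 2" "even A" "w \<in> whites A"
  shows "cnj (F_white A w) = white_gauge (cis (- pi / 3)) (cis (pi / 3)) A w"
proof -
  have "cnj (cis a) = cis (- a)" for a by (simp add: cis_cnj)
  then show ?thesis
    unfolding F_white_eq[OF assms] white_gauge_def
    by (cases w) (simp_all add: cnj_white_amp minus_one_powi)
qed


section \<open>The gauge function on black vertices\<close>

text \<open>
  Up to sign and the factor \<open>1 / Delta A\<close>, the values of the black gauge function.
\<close>

definition black_amp :: "nat \<Rightarrow> int \<Rightarrow> int \<Rightarrow> complex" where
  "black_amp A x n = diffs (-1) (nat (2 * int A - n)) (black_seq A) x"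

lemma black_amp_rec:
  assumes "n \<le> 2 * int A - 1"
  shows "black_amp A x n = black_amp A x (n + 1) - black_amp A (x - 1) (n + 1)"
proof -
  have "nat (2 * int A - n) = Suc (nat (2 * int A - (n + 1)))" using assms by simp
  then show ?thesis by (simp add: black_amp_def)
qed

lemma black_seq_node:
  assumes "k \<in> interp_nodes A"
  shows "black_seq A k = (if k = - 2 * int A then \<i> * cis (- pi / 6) else if k < 0 then 0
     else if k = int A - 1 then 1 + \<i> * cis (pi / 6) else 1)"
  unfolding black_poly_def using assms by (simp add: poly_lagrange_node)

lemma black_seq_values:
  assumes "A \<ge> 2"
  shows "black_seq A (- 2 * int A) = \<i> * cis (- pi / 6)"
    "\<And>k. - 2 * int A + 1 \<le> k \<Longrightarrow> k \<le> - int A - 1 \<Longrightarrow> black_seq A k = 0"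
    "\<And>k. 0 \<le> k \<Longrightarrow> k \<le> int A - 2 \<Longrightarrow> black_seq A k = 1"
    "black_seq A (int A - 1) = 1 + \<i> * cis (pi / 6)"
  by (subst black_seq_node; use assms in \<open>auto simp: interp_nodes_def\<close>)+

lemma black_amp_0: 
  assumes "A \<ge> 2"
  shows "black_amp A x 0 = 0"
proof -
  have "degree (black_poly A) < 2 * A"
    using degree_lagrange_less[of "interp_nodes A"] assms card_interp_nodes[of A]
    unfolding black_poly_def by (auto simp: interp_nodes_def)
  then show ?thesis unfolding black_amp_def by (simp add: nat_mult_distrib diffs_poly_eq_0)
qed

lemma black_amp_1:
  assumes "A \<ge> 2"
  shows "black_amp A x 1 = black_amp A 0 1"
proof -
  have step: "black_amp A y 1 = black_amp A (y - 1) 1" for y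
    using black_amp_rec[of 0 A y] black_amp_0[OF assms, of y] assms by simp
  show ?thesis
  proof (induction x rule: int_induct[of _ 0])
    case (step1 i)
    then show ?case using step[of "i + 1"] by simp
  next
    case (step2 i)
    then show ?case using step[of i] by simp
  qed simp
qed

text \<open>
  The black vertices of the hexagon outside of the fibres of \<open>W1\<close>, \<open>W2\<close>, \<open>W3\<close>, except for the two ends of
  each of the three black strings. These ends are incident with the outer edges of the reduced hexagon.
\<close>

definition black_dom :: "nat \<Rightarrow> int \<Rightarrow> int \<Rightarrow> bool" where
  "black_dom A x n \<longleftrightarrow> 1 \<le> n \<and> n \<le> 2 * int A - 1 \<and> - n < x \<and> - int A \<le> x \<and> x \<le> int A - 2 \<and> x \<le> 2 * int A - 1 - n"

definition black_gauge :: "nat \<Rightarrow> black \<Rightarrow> complex" where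
  "black_gauge A b = (case b of
      B x n \<Rightarrow> (-1) powi (x + n) * black_amp A x n
    | B1 \<Rightarrow> black_amp A 0 1
    | B2 \<Rightarrow> 1 - black_seq A (-1)
    | B3 \<Rightarrow> black_seq A (- int A))"

text \<open>
  On the string of \<open>B2\<close> the nodes of the difference are \<open>-1, 0, \<dots>, x\<close>, where \<open>black_seq\<close> differs from the
  constant \<open>1\<close> only at \<open>-1\<close>.
\<close>

lemma black_amp_lower_right:
  assumes "A \<ge> 2" "0 \<le> x" "x \<le> int A - 2"
  shows "black_amp A x (2 * int A - 1 - x) = (-1) powi x * (1 - black_seq A (-1))"
proof -
  define k where "k = nat x"
  have x: "x = int k" using assms by (simp add: k_def)
  have "black_amp A x (2 * int A - 1 - x) = diffs (-1) (Suc k) (black_seq A) x"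
    unfolding black_amp_def x by (simp add: nat_add_distrib)
  also have "\<dots> = diffs (-1) (Suc k) (\<lambda>i. 1 - (if i = -1 then 1 - black_seq A (-1) else 0)) x"
  proof (rule diffs_cong)
    fix j assume j: "j \<le> Suc k"
    show "black_seq A (x + int j * -1) = 1 - (if x + int j * -1 = -1 then 1 - black_seq A (-1) else 0)"
    proof (cases "x + int j * -1 = -1")
      case True
      then show ?thesis by (simp only: if_True) simp
    next
      case False
      then have "0 \<le> x + int j * -1" "x + int j * -1 \<le> int A - 2" using j assms x by auto
      then show ?thesis using False by (simp only: black_seq_values(3)[OF assms(1)] if_False diff_zero)
    qed
  qed
  also have "\<dots> = diffs (-1) (Suc k) (\<lambda>i. poly 1 (of_int i)) x - diffs (-1) (Suc k) (\<lambda>i. if i = -1 then 1 - black_seq A (-1) else 0) x"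
    unfolding diffs_diff by simp
  also have "diffs (-1) (Suc k) (\<lambda>i. poly 1 (of_int i)) x = 0"
    by (rule diffs_poly_eq_0) simp
  also have "diffs (-1) (Suc k) (\<lambda>i. if i = -1 then 1 - black_seq A (-1) else 0) x =
      (\<Sum>j\<le>Suc k. if j = Suc k then (-1) ^ Suc k * (1 - black_seq A (-1)) else 0)"
    unfolding diffs_binomial by (rule sum.cong) (use x in auto)
  finally show ?thesis by (simp add: x)
qed

text \<open>
  On the string of \<open>B3\<close> all nodes of the difference other than \<open>-A\<close> itself are zeros of \<open>black_seq\<close>.
\<close>

lemma black_amp_left:
  assumes "A \<ge> 2" "int A + 1 \<le> n" "n \<le> 2 * int A"
  shows "black_amp A (- int A) n = black_seq A (- int A)"
proof -
  define m where "m = nat (2 * int A - n)"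
  have m: "int m \<le> int A - 1" using assms by (simp add: m_def)
  have "black_amp A (- int A) n = (\<Sum>j\<le>m. (-1) ^ j * of_nat (m choose j) * black_seq A (- int A + int j * -1))"
    unfolding black_amp_def m_def diffs_binomial ..
  also have "\<dots> = (\<Sum>j\<le>m. if j = 0 then black_seq A (- int A) else 0)"
  proof (rule sum.cong[OF refl])
    fix j assume j: "j \<in> {..m}"
    show "(-1) ^ j * of_nat (m choose j) * black_seq A (- int A + int j * -1) = (if j = 0 then black_seq A (- int A) else 0)"
    proof (cases "j = 0")
      case False
      have "black_seq A (- int A + int j * -1) = 0"
        by (rule black_seq_values(2)[OF assms(1)]) (use j m False in auto)
      then show ?thesis using False by (simp only: mult_zero_right if_False)
    qed simp
  qed
  also have "\<dots> = black_seq A (- int A)" by simp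
  finally show ?thesis .
qed

lemma black_amp_first_node:
  assumes A: "A \<ge> 2" "even A"
  shows "black_amp A (- int A - 1) (int A + 1) = - (\<i> * cis (- pi / 6))"
proof -
  have "black_amp A (- int A - 1) (int A + 1) =
      (\<Sum>j\<le>A - 1. (-1) ^ j * of_nat ((A - 1) choose j) * black_seq A (- int A - 1 + int j * -1))"
  proof -
    have "nat (2 * int A - (int A + 1)) = A - 1" by linarith
    then show ?thesis unfolding black_amp_def diffs_binomial by simp
  qed
  also have "\<dots> = (\<Sum>j\<le>A - 1. if j = A - 1 then - (\<i> * cis (- pi / 6)) else 0)"
  proof (rule sum.cong[OF refl])
    fix j assume j: "j \<in> {..A - 1}"
    show "(-1) ^ j * of_nat ((A - 1) choose j) * black_seq A (- int A - 1 + int j * -1) =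
        (if j = A - 1 then - (\<i> * cis (- pi / 6)) else 0)"
    proof (cases "j = A - 1")
      case True
      then have "- int A - 1 + int j * -1 = - 2 * int A" using A by simp
      moreover have "odd (A - 1)" using A by simp
      ultimately show ?thesis using True black_seq_values(1)[OF A(1)] by simp
    next
      case False
      then show ?thesis using black_seq_values(2)[OF A(1), of "- int A - 1 - int j"] j by simp
    qed
  qed
  finally show ?thesis by simp
qed

lemma black_amp_last_node:
  assumes A: "A \<ge> 2"
  shows "black_amp A (int A - 1) (int A + 1) = \<i> * cis (pi / 6)"
proof -
  let ?c = "\<i> * cis (pi / 6)"
  have n: "nat (2 * int A - (int A + 1)) = A - 1" by linarith
  have "black_amp A (int A - 1) (int A + 1) =
      diffs (-1) (A - 1) (\<lambda>i. 1 - (if i = int A - 1 then - ?c else 0)) (int A - 1)"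
    unfolding black_amp_def n
  proof (rule diffs_cong)
    fix j assume "j \<le> A - 1"
    then show "black_seq A (int A - 1 + int j * -1) = 1 - (if int A - 1 + int j * -1 = int A - 1 then - ?c else 0)"
      using black_seq_values(3)[OF A, of "int A - 1 - int j"] black_seq_values(4)[OF A] A by (cases j) auto
  qed
  also have "\<dots> = diffs (-1) (A - 1) (\<lambda>i. poly 1 (of_int i)) (int A - 1) - diffs (-1) (A - 1) (\<lambda>i. if i = int A - 1 then - ?c else 0) (int A - 1)"
    unfolding diffs_diff by simp
  also have "diffs (-1) (A - 1) (\<lambda>i. poly 1 (of_int i)) (int A - 1) = 0"
    by (rule diffs_poly_eq_0) (use A in simp)
  also have "diffs (-1) (A - 1) (\<lambda>i. if i = int A - 1 then - ?c else 0) (int A - 1) =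
      (\<Sum>j\<le>A - 1. if j = 0 then - ?c else 0)"
    unfolding diffs_binomial by (rule sum.cong) auto
  finally show ?thesis by simp
qed

lemma black_gauge_lift:
  assumes A: "A \<ge> 2" "even A" and d: "black_dom A x n"
  shows "black_lift A (black_gauge A) x n = (-1) powi (x + n) * black_amp A x n"
proof -
  consider "inner_black A x n" | "n = 1" | "n \<noteq> 1" "n = 2 * int A - 1 - x" "0 \<le> x" "x \<le> int A - 2"
    | "n \<noteq> 1" "x = - int A" "int A + 1 \<le> n" "n \<le> 2 * int A - 1"
    using d by (fastforce simp: black_dom_def inner_black_iff)
  then show ?thesis
  proof cases
    case 1
    then show ?thesis by (simp add: black_lift_def black_gauge_def)
  next
    case 2
    then show ?thesis using black_amp_1[OF A(1), of x] by (simp add: black_lift_def black_gauge_def inner_black_iff)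
  next
    case 3
    then show ?thesis using black_amp_lower_right[OF A(1), of x]
      by (simp add: black_lift_def black_gauge_def inner_black_iff minus_one_powi)
  next
    case 4
    then show ?thesis using black_amp_left[OF A(1), of n] A
      by (simp add: black_lift_def black_gauge_def inner_black_iff minus_one_powi)
  qed
qed

lemma black_gauge_column_inner:
  assumes A: "A \<ge> 2" "even A" and w: "inner_white A y m"
  shows "(\<Sum>b\<in>blacks A. black_gauge A b * Kred A b (W y m)) = 0"
proof -
  have "black_dom A y m" "black_dom A y (m + 1)" "black_dom A (y - 1) (m + 1)" "m \<le> 2 * int A - 1"
    using w by (auto simp: black_dom_def inner_white_iff)
  then show ?thesis
    unfolding Kred_column_inner[OF A(1) w] using black_amp_rec[of m A y]
    by (simp add: black_gauge_lift[OF A] minus_one_powi)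
qed

text \<open>
  The sum telescopes to the difference at the place where the value of \<open>black_seq\<close> at \<open>-2A\<close> enters. For
  \<open>W2\<close> it is the value at \<open>A - 1\<close>, and for \<open>W3\<close> the jump of \<open>black_seq\<close> from \<open>0\<close> to \<open>1\<close>.
\<close>

lemma black_gauge_column_W1:
  assumes A: "A \<ge> 2" "even A"
  shows "(\<Sum>b\<in>blacks A. black_gauge A b * Kred A b W1) = - (\<i> * cis (- pi / 6))"
proof -
  define c where "c k = (-1) powi k * black_amp A (- k) k" for k
  have "(\<Sum>b\<in>blacks A. black_gauge A b * Kred A b W1) = (\<Sum>k=0..int A. c k - c (k + 1))"
    unfolding Kred_column_W1[OF A]
  proof (rule sum.cong[OF refl])
    fix k assume k: "k \<in> {0..int A}"
    then have "black_dom A (- k) (k + 1)" using A by (auto simp: black_dom_def)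
    moreover have "black_amp A (- k) k = black_amp A (- k) (k + 1) - black_amp A (- (k + 1)) (k + 1)"
      using black_amp_rec[of k A "- k"] k A by simp
    ultimately show "(-1) powi (k + 1) * black_lift A (black_gauge A) (- k) (k + 1) = c k - c (k + 1)"
      by (simp add: black_gauge_lift[OF A] minus_one_powi c_def)
  qed
  also have "\<dots> = c 0 - c (int A + 1)" by (simp add: telescope_int)
  also have "\<dots> = - (\<i> * cis (- pi / 6))"
    using black_amp_0[OF A(1), of 0] black_amp_first_node[OF A] A by (simp add: c_def minus_one_powi)
  finally show ?thesis .
qed

lemma black_gauge_column_W2:
  assumes A: "A \<ge> 2" "even A"
  shows "(\<Sum>b\<in>blacks A. black_gauge A b * Kred A b W2) = \<i> * cis (pi / 6)"
proof -
  define c where "c k = - black_amp A (int A - 1) k" for k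
  have "(\<Sum>b\<in>blacks A. black_gauge A b * Kred A b W2) = (\<Sum>k=0..int A. c k - c (k + 1))"
    unfolding Kred_column_W2[OF A]
  proof (rule sum.cong[OF refl])
    fix k assume k: "k \<in> {0..int A}"
    then have "black_dom A (int A - 2) (k + 1)" using A by (auto simp: black_dom_def)
    moreover have "black_amp A (int A - 1) k = black_amp A (int A - 1) (k + 1) - black_amp A (int A - 2) (k + 1)"
      using black_amp_rec[of k A "int A - 1"] k A by simp
    ultimately show "(-1) powi (k + 1) * black_lift A (black_gauge A) (int A - 2) (k + 1) = c k - c (k + 1)"
      using A by (simp add: black_gauge_lift[OF A] minus_one_powi c_def)
  qed
  also have "\<dots> = c 0 - c (int A + 1)" by (simp add: telescope_int)
  also have "\<dots> = \<i> * cis (pi / 6)"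
    using black_amp_0[OF A(1), of "int A - 1"] black_amp_last_node[OF A(1)] by (simp add: c_def)
  finally show ?thesis .
qed

lemma black_gauge_column_W3:
  assumes A: "A \<ge> 2" "even A"
  shows "(\<Sum>b\<in>blacks A. black_gauge A b * Kred A b W3) = 1"
proof -
  define c where "c k = - black_seq A (k - 1)" for k
  have "(\<Sum>b\<in>blacks A. black_gauge A b * Kred A b W3) = (\<Sum>k=- int A..0. c k - c (k + 1))"
    unfolding Kred_column_W3[OF A]
  proof (rule sum.cong[OF refl])
    fix k assume k: "k \<in> {- int A..0}"
    then have "black_dom A k (2 * int A - 1)" using A by (auto simp: black_dom_def)
    moreover have "black_amp A k (2 * int A - 1) = black_seq A k - black_seq A (k - 1)"
      by (simp add: black_amp_def)
    ultimately show "(-1) powi (k + 1) * black_lift A (black_gauge A) k (2 * int A - 1) = c k - c (k + 1)"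
      by (simp add: black_gauge_lift[OF A] minus_one_powi c_def)
  qed
  also have "\<dots> = c (- int A) - c 1" using telescope_int[of "- int A" 0 c] by simp
  also have "\<dots> = 1"
    using black_seq_values(3)[OF A(1), of 0] black_seq_values(2)[OF A(1), of "- int A - 1"] A by (simp add: c_def)
  finally show ?thesis .
qed

lemma F_black_eq:
  assumes A: "A \<ge> 2" "even A" and b: "b \<in> blacks A"
  shows "F_black A b = black_gauge A b / of_real (Delta A)"
proof -
  let ?h = "\<lambda>w. case w of W y m \<Rightarrow> 0 | W1 \<Rightarrow> - (\<i> * cis (- pi / 6)) | W2 \<Rightarrow> \<i> * cis (pi / 6) | W3 \<Rightarrow> 1"
  have "black_gauge A b = (\<Sum>w\<in>whites A. ?h w * Kinv A w b)"
  proof (rule Kinv_solve_black[OF A b])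
    fix w assume "w \<in> whites A"
    then consider y m where "w = W y m" "inner_white A y m" | "w = W1" | "w = W2" | "w = W3"
      by (auto simp: whites_def)
    then show "(\<Sum>b\<in>blacks A. black_gauge A b * Kred A b w) = ?h w"
      by cases (simp_all add: black_gauge_column_inner[OF A] black_gauge_column_W1[OF A]
          black_gauge_column_W2[OF A] black_gauge_column_W3[OF A])
  qed
  then have e: "black_gauge A b = \<i> * cis (pi / 6) * Kinv A W2 b + Kinv A W3 b - \<i> * cis (- pi / 6) * Kinv A W1 b"
    unfolding sum_whites by (simp add: case_prod_unfold algebra_simps)
  show ?thesis unfolding F_black_def e by simp
qed


section \<open>Edges of the reduced hexagon and the faces next to them\<close>

lemma fibre_mem:
  "HB X N \<in> fibre A (Inl (B x n)) \<longleftrightarrow> inner_black A x n \<and> X = x \<and> N = n"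
  "HB X N \<in> fibre A (Inl B1) \<longleftrightarrow> N = 1 \<and> -1 \<le> X \<and> X \<le> int A - 1"
  "HB X N \<in> fibre A (Inl B2) \<longleftrightarrow> N = 2 * int A - 1 - X \<and> -1 \<le> X \<and> X \<le> int A - 1"
  "HB X N \<in> fibre A (Inl B3) \<longleftrightarrow> X = - int A \<and> int A \<le> N \<and> N \<le> 2 * int A"
  "HW Y M \<in> fibre A (Inl (B x n)) \<longleftrightarrow> False"
  "HW Y M \<in> fibre A (Inl B1) \<longleftrightarrow> M = 0 \<and> 0 \<le> Y \<and> Y \<le> int A - 1"
  "HW Y M \<in> fibre A (Inl B2) \<longleftrightarrow> M = 2 * int A - 1 - Y \<and> 0 \<le> Y \<and> Y \<le> int A - 1"
  "HW Y M \<in> fibre A (Inl B3) \<longleftrightarrow> Y = - int A \<and> int A \<le> M \<and> M \<le> 2 * int A - 1"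
  "HW Y M \<in> fibre A (Inr (W y m)) \<longleftrightarrow> inner_white A y m \<and> Y = y \<and> M = m"
  "HW Y M \<in> fibre A (Inr W1) \<longleftrightarrow> Y = - M \<and> 1 \<le> M \<and> M \<le> int A - 1"
  "HW Y M \<in> fibre A (Inr W2) \<longleftrightarrow> Y = int A - 1 \<and> 1 \<le> M \<and> M \<le> int A - 1"
  "HW Y M \<in> fibre A (Inr W3) \<longleftrightarrow> M = 2 * int A - 1 \<and> - int A + 1 \<le> Y \<and> Y \<le> -1"
  "HB X N \<in> fibre A (Inr (W y m)) \<longleftrightarrow> False"
  "HB X N \<in> fibre A (Inr W1) \<longleftrightarrow> X = - N \<and> 2 \<le> N \<and> N \<le> int A - 1"
  "HB X N \<in> fibre A (Inr W2) \<longleftrightarrow> X = int A - 1 \<and> 2 \<le> N \<and> N \<le> int A - 1"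
  "HB X N \<in> fibre A (Inr W3) \<longleftrightarrow> N = 2 * int A \<and> - int A + 1 \<le> X \<and> X \<le> -2"
  by (auto simp: image_iff)

declare fibre.simps [simp del] on_left.simps [simp del]

lemma ex_less_6: "(\<exists>i<6. P i) \<longleftrightarrow> P 0 \<or> P 1 \<or> P 2 \<or> P 3 \<or> P 4 \<or> P (5 :: nat)"
  by (simp add: numeral_eq_Suc Ex_less_Suc2)

lemma on_left_Face_iff:
  "on_left A p q (Face x n) \<longleftrightarrow> (x, n) \<in> faces A \<and>
    (HW (x - 1) n \<in> fibre A p \<and> HB (x - 1) n \<in> fibre A q \<or>
     HB (x - 1) n \<in> fibre A p \<and> HW x (n - 1) \<in> fibre A q \<or>
     HW x (n - 1) \<in> fibre A p \<and> HB x n \<in> fibre A q \<or>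
     HB x n \<in> fibre A p \<and> HW x n \<in> fibre A q \<or>
     HW x n \<in> fibre A p \<and> HB (x - 1) (n + 1) \<in> fibre A q \<or>
     HB (x - 1) (n + 1) \<in> fibre A p \<and> HW (x - 1) n \<in> fibre A q)"
  unfolding on_left.simps ex_less_6 face_boundary_def by simp

lemma on_left_Outer_iff:
  "on_left A p q (Outer b w) \<longleftrightarrow> {p, q} = {Inl b, Inr w} \<and>
    (p = Inl B1 \<and> q = Inr W1 \<or> p = Inr W1 \<and> q = Inl B3 \<or> p = Inl B3 \<and> q = Inr W3 \<or>
     p = Inr W3 \<and> q = Inl B2 \<or> p = Inl B2 \<and> q = Inr W2 \<or> p = Inr W2 \<and> q = Inl B1)"
  unfolding on_left.simps ex_less_6 outer_boundary_def by auto

text \<open>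
  For the edge from \<open>b(X, N)\<close> to \<open>w(Y, M)\<close> of the hexagonal lattice, \<open>v\<close> is the face on the left when going
  from \<open>b\<close> to \<open>w\<close>, and \<open>v'\<close> is the face on the right.
\<close>

definition edge_faces :: "int \<Rightarrow> int \<Rightarrow> int \<Rightarrow> int \<Rightarrow> int \<times> int \<Rightarrow> int \<times> int \<Rightarrow> bool" where
  "edge_faces X N Y M v v' \<longleftrightarrow>
     Y = X \<and> M = N \<and> v = (X, N) \<and> v' = (X + 1, N) \<or>
     Y = X \<and> M = N - 1 \<and> v = (X + 1, N - 1) \<and> v' = (X, N) \<or>
     Y = X + 1 \<and> M = N - 1 \<and> v = (X + 1, N) \<and> v' = (X + 1, N - 1)"

definition fibre_edge :: "nat \<Rightarrow> black \<Rightarrow> white \<Rightarrow> int \<Rightarrow> int \<Rightarrow> int \<Rightarrow> int \<Rightarrow> bool" where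
  "fibre_edge A b w X N Y M \<longleftrightarrow> HB X N \<in> fibre A (Inl b) \<and> HW Y M \<in> fibre A (Inr w) \<and> hex_adj (X, N) (Y, M)"

lemma ex_edge_faces_left:
  "(\<exists>X N Y M v'. P X N Y M \<and> edge_faces X N Y M (x, n) v') \<longleftrightarrow>
    P x n x n \<or> P (x - 1) (n + 1) (x - 1) n \<or> P (x - 1) n x (n - 1)"
proof
  assume "\<exists>X N Y M v'. P X N Y M \<and> edge_faces X N Y M (x, n) v'"
  then obtain X N Y M v' where P: "P X N Y M" and e: "edge_faces X N Y M (x, n) v'" by blast
  from e have "X = x \<and> N = n \<and> Y = x \<and> M = n \<or> X = x - 1 \<and> N = n + 1 \<and> Y = x - 1 \<and> M = n \<or>
      X = x - 1 \<and> N = n \<and> Y = x \<and> M = n - 1"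
    unfolding edge_faces_def by auto
  then show "P x n x n \<or> P (x - 1) (n + 1) (x - 1) n \<or> P (x - 1) n x (n - 1)" using P by blast
next
  have "edge_faces x n x n (x, n) (x + 1, n)" "edge_faces (x - 1) (n + 1) (x - 1) n (x, n) (x - 1, n + 1)"
    "edge_faces (x - 1) n x (n - 1) (x, n) (x, n - 1)" by (simp_all add: edge_faces_def)
  then show "P x n x n \<or> P (x - 1) (n + 1) (x - 1) n \<or> P (x - 1) n x (n - 1) \<Longrightarrow>
      \<exists>X N Y M v'. P X N Y M \<and> edge_faces X N Y M (x, n) v'" by blast
qed

lemma ex_edge_faces_right:
  "(\<exists>X N Y M v. P X N Y M \<and> edge_faces X N Y M v (x, n)) \<longleftrightarrow>
    P (x - 1) n (x - 1) n \<or> P x n x (n - 1) \<or> P (x - 1) (n + 1) x n"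
proof
  assume "\<exists>X N Y M v. P X N Y M \<and> edge_faces X N Y M v (x, n)"
  then obtain X N Y M v where P: "P X N Y M" and e: "edge_faces X N Y M v (x, n)" by blast
  from e have "X = x - 1 \<and> N = n \<and> Y = x - 1 \<and> M = n \<or> X = x \<and> N = n \<and> Y = x \<and> M = n - 1 \<or>
      X = x - 1 \<and> N = n + 1 \<and> Y = x \<and> M = n"
    unfolding edge_faces_def by auto
  then show "P (x - 1) n (x - 1) n \<or> P x n x (n - 1) \<or> P (x - 1) (n + 1) x n" using P by blast
next
  have "edge_faces (x - 1) n (x - 1) n (x - 1, n) (x, n)" "edge_faces x n x (n - 1) (x + 1, n - 1) (x, n)"
    "edge_faces (x - 1) (n + 1) x n (x, n + 1) (x, n)" by (simp_all add: edge_faces_def)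
  then show "P (x - 1) n (x - 1) n \<or> P x n x (n - 1) \<or> P (x - 1) (n + 1) x n \<Longrightarrow>
      \<exists>X N Y M v. P X N Y M \<and> edge_faces X N Y M v (x, n)" by blast
qed

lemma on_left_black_white_iff:
  assumes "A \<ge> 2"
  shows "on_left A (Inl b) (Inr w) (Face x n) \<longleftrightarrow>
    (x, n) \<in> faces A \<and> (\<exists>X N Y M v'. fibre_edge A b w X N Y M \<and> edge_faces X N Y M (x, n) v')"
proof -
  have no: "\<not> (HW x (n - 1) \<in> fibre A (Inl b) \<and> HB x n \<in> fibre A (Inr w))"
    "\<not> (HW x n \<in> fibre A (Inl b) \<and> HB (x - 1) (n + 1) \<in> fibre A (Inr w))"
    "\<not> (HW (x - 1) n \<in> fibre A (Inl b) \<and> HB (x - 1) n \<in> fibre A (Inr w))" for x n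
    using assms by (cases b; cases w; auto simp: fibre_mem)+
  show ?thesis
    unfolding on_left_Face_iff ex_edge_faces_left fibre_edge_def hex_adj_def using no[of x n]
    by simp blast
qed

lemma on_left_white_black_iff:
  assumes "A \<ge> 2"
  shows "on_left A (Inr w) (Inl b) (Face x n) \<longleftrightarrow>
    (x, n) \<in> faces A \<and> (\<exists>X N Y M v. fibre_edge A b w X N Y M \<and> edge_faces X N Y M v (x, n))"
proof -
  have no: "\<not> (HB (x - 1) n \<in> fibre A (Inr w) \<and> HW x (n - 1) \<in> fibre A (Inl b))"
    "\<not> (HB x n \<in> fibre A (Inr w) \<and> HW x n \<in> fibre A (Inl b))"
    "\<not> (HB (x - 1) (n + 1) \<in> fibre A (Inr w) \<and> HW (x - 1) n \<in> fibre A (Inl b))" for x n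
    using assms by (cases b; cases w; auto simp: fibre_mem)+
  show ?thesis
    unfolding on_left_Face_iff ex_edge_faces_right fibre_edge_def hex_adj_def using no[of x n]
    by simp blast
qed

text \<open>
  The six edges of the outer face and the edges of the hexagon that they come from.
\<close>

lemma fibre_edge_boundary:
  assumes "A \<ge> 2" "fibre_edge A b w X N Y M" "b \<in> {B1, B2, B3}" "w \<in> {W1, W2, W3}"
  shows "b = B1 \<and> w = W1 \<and> X = -1 \<and> N = 1 \<and> Y = -1 \<and> M = 1 \<or>
    b = B1 \<and> w = W2 \<and> X = int A - 1 \<and> N = 1 \<and> Y = int A - 1 \<and> M = 1 \<or>
    b = B2 \<and> w = W2 \<and> X = int A - 1 \<and> N = int A \<and> Y = int A - 1 \<and> M = int A - 1 \<or>
    b = B2 \<and> w = W3 \<and> X = -1 \<and> N = 2 * int A \<and> Y = -1 \<and> M = 2 * int A - 1 \<or>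
    b = B3 \<and> w = W1 \<and> X = - int A \<and> N = int A \<and> Y = - int A + 1 \<and> M = int A - 1 \<or>
    b = B3 \<and> w = W3 \<and> X = - int A \<and> N = 2 * int A \<and> Y = - int A + 1 \<and> M = 2 * int A - 1"
proof -
  have adj: "Y = X \<and> M = N \<or> Y = X \<and> M = N - 1 \<or> Y = X + 1 \<and> M = N - 1"
    using assms(2) by (auto simp: fibre_edge_def hex_adj_def)
  have mem: "HB X N \<in> fibre A (Inl b)" "HW Y M \<in> fibre A (Inr w)"
    using assms(2) by (simp_all add: fibre_edge_def)
  from assms(3,4) show ?thesis
    by (elim insertE emptyE; simp only:)
      (use mem adj assms(1) in \<open>simp only: fibre_mem black.distinct white.distinct simp_thms; linarith\<close>)+
qed

lemma fibre_edge_inner_string: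
  "fibre_edge A (B x n) W1 X N Y M \<Longrightarrow> X = x \<and> N = n \<and> Y = x \<and> M = n - 1"
  "fibre_edge A (B x n) W2 X N Y M \<Longrightarrow> X = x \<and> N = n \<and> Y = x + 1 \<and> M = n - 1"
  "fibre_edge A (B x n) W3 X N Y M \<Longrightarrow> X = x \<and> N = n \<and> Y = x \<and> M = n"
  "fibre_edge A B1 (W y m) X N Y M \<Longrightarrow> X = y \<and> N = m \<and> Y = y \<and> M = m"
  "fibre_edge A B2 (W y m) X N Y M \<Longrightarrow> X = y \<and> N = m + 1 \<and> Y = y \<and> M = m"
  "fibre_edge A B3 (W y m) X N Y M \<Longrightarrow> X = y - 1 \<and> N = m + 1 \<and> Y = y \<and> M = m"
  unfolding fibre_edge_def hex_adj_def fibre_mem inner_black_iff inner_white_iff by auto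

text \<open>
  Contraction does not create multiple edges. Hence an edge of the reduced hexagon determines the faces on
  both of its sides.
\<close>

lemma fibre_edge_unique:
  assumes A: "A \<ge> 2" and e: "fibre_edge A b w X N Y M" and e': "fibre_edge A b w X' N' Y' M'"
  shows "X' = X \<and> N' = N \<and> Y' = Y \<and> M' = M"
proof -
  consider x n y m where "b = B x n" "w = W y m"
    | x n where "b = B x n" "w = W1" | x n where "b = B x n" "w = W2" | x n where "b = B x n" "w = W3"
    | y m where "b = B1" "w = W y m" | y m where "b = B2" "w = W y m" | y m where "b = B3" "w = W y m"
    | "b \<in> {B1, B2, B3}" "w \<in> {W1, W2, W3}"
    by (cases b; cases w) auto
  then show ?thesis
  proof cases
    case 1
    then show ?thesis using e e' by (simp add: fibre_edge_def fibre_mem)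
  next
    case 8
    then show ?thesis using fibre_edge_boundary[OF A e] fibre_edge_boundary[OF A e'] by auto
  qed (use e e' in \<open>auto dest!: fibre_edge_inner_string\<close>)
qed

lemma fibre_edge_boundary_exists:
  assumes "A \<ge> 2"
  shows "fibre_edge A B1 W1 (-1) 1 (-1) 1"
    "fibre_edge A B1 W2 (int A - 1) 1 (int A - 1) 1"
    "fibre_edge A B2 W2 (int A - 1) (int A) (int A - 1) (int A - 1)"
    "fibre_edge A B2 W3 (-1) (2 * int A) (-1) (2 * int A - 1)"
    "fibre_edge A B3 W1 (- int A) (int A) (- int A + 1) (int A - 1)"
    "fibre_edge A B3 W3 (- int A) (2 * int A) (- int A + 1) (2 * int A - 1)"
  using assms by (auto simp: fibre_edge_def hex_adj_def fibre_mem)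

lemma fibre_edge_vertices:
  assumes "fibre_edge A b w X N Y M"
  shows "b \<in> blacks A" "w \<in> whites A"
proof -
  have mem: "HB X N \<in> fibre A (Inl b)" "HW Y M \<in> fibre A (Inr w)"
    using assms by (simp_all add: fibre_edge_def)
  show "b \<in> blacks A"
    using mem(1) by (cases b) (simp_all only: fibre_mem, auto simp: blacks_def)
  show "w \<in> whites A"
    using mem(2) by (cases w) (simp_all only: fibre_mem, auto simp: whites_def)
qed

text \<open>
  If there are inner faces on both sides, then at least one end of the edge is an inner vertex, and the sign
  in \<open>Kred\<close> is the one of the lift. So the increments can be computed on the hexagon.
\<close>

lemma edge_weight:
  assumes A: "A \<ge> 2" "even A" and e: "fibre_edge A b w X N Y M" and ef: "edge_faces X N Y M v v'"
    and f: "v \<in> faces A" "v' \<in> faces A"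
  shows "t b * Kred A b w * s w = black_lift A t X N * white_lift A s Y M"
    and "black_dom A X N" "white_dom A Y M"
proof -
  have A0: "A > 0" using A by simp
  have F: "1 \<le> n \<and> n \<le> 2 * int A - 1 \<and> - n < x \<and> - int A < x \<and> x \<le> int A - 1 \<and> x \<le> 2 * int A - 1 - n"
    if "(x, n) \<in> faces A" for x n using that faces_iff[OF A0] by blast
  obtain x n x' n' where v: "v = (x, n)" "v' = (x', n')" by (cases v; cases v') blast
  have L: "Y = X \<and> M = N \<and> x = X \<and> n = N \<and> x' = X + 1 \<and> n' = N \<or>
      Y = X \<and> M = N - 1 \<and> x = X + 1 \<and> n = N - 1 \<and> x' = X \<and> n' = N \<or>
      Y = X + 1 \<and> M = N - 1 \<and> x = X + 1 \<and> n = N \<and> x' = X + 1 \<and> n' = N - 1"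
    using ef v by (auto simp: edge_faces_def)
  note Fv = F[OF f(1)[unfolded v]] and Fv' = F[OF f(2)[unfolded v]]
  show "black_dom A X N"
    unfolding black_dom_def using L Fv Fv' by (elim disjE) auto
  show "white_dom A Y M"
    unfolding white_dom_def using L Fv Fv' by (elim disjE) auto
  have nb: "\<not> (b \<in> {B1, B2, B3} \<and> w \<in> {W1, W2, W3})"
  proof
    assume "b \<in> {B1, B2, B3} \<and> w \<in> {W1, W2, W3}"
    then show False
      using fibre_edge_boundary[OF A(1) e] L by (elim disjE conjE; use Fv Fv' A in linarith)
  qed
  have adj: "Y = X \<and> M = N \<or> Y = X \<and> M = N - 1 \<or> Y = X + 1 \<and> M = N - 1"
    and mem: "HB X N \<in> fibre A (Inl b)" "HW Y M \<in> fibre A (Inr w)"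
    using e by (auto simp: fibre_edge_def hex_adj_def)
  note simps = fibre_mem black_lift_def white_lift_def inner_black_iff inner_white_iff Let_def
  consider x n y m where "b = B x n" "w = W y m"
    | x n where "b = B x n" "w = W1" | x n where "b = B x n" "w = W2" | x n where "b = B x n" "w = W3"
    | y m where "b = B1" "w = W y m" | y m where "b = B2" "w = W y m" | y m where "b = B3" "w = W y m"
    using nb by (cases b; cases w) auto
  then show "t b * Kred A b w * s w = black_lift A t X N * white_lift A s Y M"
  proof cases
    case (1 x n y m)
    then have "inner_black A X N" "inner_white A Y M" "b = B X N" "w = W Y M"
      using mem by (simp_all only: fibre_mem)
    then show ?thesis using adj by (auto simp: black_lift_def white_lift_def hex_adj_def)
  next
    case (2 x n)
    with fibre_edge_inner_string(1) e have "X = x" "N = n" "Y = x" "M = n - 1" by blast+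
    then show ?thesis using mem 2 by (auto simp: simps)
  next
    case (3 x n)
    with fibre_edge_inner_string(2) e have "X = x" "N = n" "Y = x + 1" "M = n - 1" by blast+
    then show ?thesis using mem 3 by (auto simp: simps)
  next
    case (4 x n)
    with fibre_edge_inner_string(3) e have "X = x" "N = n" "Y = x" "M = n" by blast+
    then show ?thesis using mem 4 by (auto simp: simps)
  next
    case (5 y m)
    with fibre_edge_inner_string(4) e have "X = y" "N = m" "Y = y" "M = m" by blast+
    then show ?thesis using mem 5 by (auto simp: simps)
  next
    case (6 y m)
    with fibre_edge_inner_string(5) e have "X = y" "N = m + 1" "Y = y" "M = m" by blast+
    then show ?thesis using mem 6 by (auto simp: simps)
  next
    case (7 y m)
    with fibre_edge_inner_string(6) e have "X = y - 1" "N = m + 1" "Y = y" "M = m" by blast+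
    then show ?thesis using mem 7 by (auto simp: simps)
  qed
qed


section \<open>The primitive on the dual graph\<close>

text \<open>
  Up to the factor \<open>1 / Delta A\<close>, the double integral with its prefactor, as a function on all faces of the lattice.
\<close>

definition face_value :: "complex \<Rightarrow> complex \<Rightarrow> nat \<Rightarrow> int \<times> int \<Rightarrow> complex" where
  "face_value \<alpha> \<beta> A = (\<lambda>(x, n). fact (2 * A - 1) * white_functional \<alpha> \<beta> A
     (\<lambda>z. newton (black_seq A) (nat (2 * int A - n)) (x - 1) z - newton (black_seq A) (2 * A - 1) (-1) z))"

lemma face_value_0_1: "A > 0 \<Longrightarrow> face_value \<alpha> \<beta> A (0, 1) = 0"
proof -
  have "nat (2 * int A - 1) = 2 * A - 1" by linarith
  then show ?thesis by (simp add: face_value_def white_functional_def)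
qed

text \<open>
  The three kinds of edges correspond to exchanging, removing and adding a node of the interpolation
  polynomial. The exchange is composed of the other two by the recursion of \<open>white_amp\<close>.
\<close>

lemma face_value_increment:
  assumes "N \<le> 2 * int A - 1" "edge_faces X N Y M v v'"
  shows "face_value \<alpha> \<beta> A v' - face_value \<alpha> \<beta> A v =
    ((-1) powi (X + N) * black_amp A X N) * ((-1) powi (Y + M) * white_amp \<alpha> \<beta> A Y M)"
proof -
  define m where "m = nat (2 * int A - N)"
  have m: "nat (2 * int A - (N - 1)) = Suc m" "nat (2 * int A - N) = m" "nat (2 * int A - 1 - (N - 1)) = m"
    using assms(1) by (simp_all add: m_def)
  let ?L = "white_functional \<alpha> \<beta> A" and ?p = "black_seq A" and ?F = "fact (2 * A - 1) :: complex"
  let ?V = "face_value \<alpha> \<beta> A"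
  have V: "?V (x, n) = ?F * (?L (newton ?p (nat (2 * int A - n)) (x - 1)) - ?L (newton ?p (2 * A - 1) (-1)))" for x n
    by (simp add: face_value_def white_functional_lin)
  have 1: "?V (X + 1, N - 1) - ?V (X + 1, N) = black_amp A X N * white_amp \<alpha> \<beta> A (X + 1) (N - 1)"
  proof -
    have "newton ?p (Suc m) X = (\<lambda>z. newton ?p m X z + pochhammer (z - of_int X) m * (diffs (-1) m ?p X / fact m))"
      by (simp add: newton_Suc fun_eq_iff)
    then have "?L (newton ?p (Suc m) X) = ?L (newton ?p m X) + ?L (\<lambda>z. pochhammer (z - of_int X) m) * (diffs (-1) m ?p X / fact m)"
      by (simp only: white_functional_lin)
    then show ?thesis unfolding V white_amp_def black_amp_def m by (simp add: algebra_simps)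
  qed
  have 2: "?V (X + 1, N - 1) - ?V (X, N) = black_amp A X N * white_amp \<alpha> \<beta> A X (N - 1)"
  proof -
    have "newton ?p (Suc m) X = (\<lambda>z. newton ?p m (X - 1) z + pochhammer (z - of_int X + 1) m * (diffs (-1) m ?p X / fact m))"
      by (simp add: newton_drop_first_node fun_eq_iff)
    then have "?L (newton ?p (Suc m) X) = ?L (newton ?p m (X - 1)) + ?L (\<lambda>z. pochhammer (z - of_int X + 1) m) * (diffs (-1) m ?p X / fact m)"
      by (simp only: white_functional_lin)
    then show ?thesis unfolding V white_amp_def black_amp_def m by (simp add: algebra_simps)
  qed
  have 3: "?V (X + 1, N) - ?V (X, N) = black_amp A X N * white_amp \<alpha> \<beta> A X N"
  proof -
    have "?V (X + 1, N) - ?V (X, N) = black_amp A X N * (white_amp \<alpha> \<beta> A X (N - 1) - white_amp \<alpha> \<beta> A (X + 1) (N - 1))"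
      using 1 2 by (simp add: algebra_simps)
    then show ?thesis using white_amp_rec[OF assms(1), of \<alpha> \<beta> X] by simp
  qed
  from assms(2) consider
      "Y = X" "M = N" "v = (X, N)" "v' = (X + 1, N)"
    | "Y = X" "M = N - 1" "v = (X + 1, N - 1)" "v' = (X, N)"
    | "Y = X + 1" "M = N - 1" "v = (X + 1, N)" "v' = (X + 1, N - 1)"
    unfolding edge_faces_def by blast
  then show ?thesis
  proof cases
    case 1
    then show ?thesis using 3 by (simp add: minus_one_powi)
  next
    case 2
    have "?V v' - ?V v = - (black_amp A X N * white_amp \<alpha> \<beta> A Y M)"
      using \<open>?V (X + 1, N - 1) - ?V (X, N) = _\<close> unfolding 2 by (simp add: algebra_simps)
    then show ?thesis using 2 by (simp add: minus_one_powi)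
  next
    case 3
    then show ?thesis using 1 by (simp add: minus_one_powi)
  qed
qed

definition is_dual_primitive ::
  "nat \<Rightarrow> complex \<Rightarrow> (black \<Rightarrow> white \<Rightarrow> complex) \<Rightarrow> (dual_vertex \<Rightarrow> complex) \<Rightarrow> bool" where
  "is_dual_primitive A c \<omega> T \<longleftrightarrow> T \<in> extensional (dual_vertices A) \<and> T (Outer B1 W1) = c \<and>
     (\<forall>b w v v'. Kred A b w \<noteq> 0 \<and> on_left A (Inl b) (Inr w) v \<and> on_left A (Inr w) (Inl b) v'
        \<longrightarrow> T v' - T v = \<omega> b w)"

lemma face_dual_edge:
  assumes A: "A \<ge> 2" and e: "fibre_edge A b w X N Y M" and ef: "edge_faces X N Y M (x, n) (x', n')"
  shows "(x, n) \<in> faces A \<Longrightarrow> on_left A (Inl b) (Inr w) (Face x n)"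
    "(x', n') \<in> faces A \<Longrightarrow> on_left A (Inr w) (Inl b) (Face x' n')"
  unfolding on_left_black_white_iff[OF A] on_left_white_black_iff[OF A] using e ef by blast+

lemma ex_fibre_edge:
  assumes "A \<ge> 2" "fibre_edge A b w X N Y M"
  shows "(\<exists>X N Y M v. fibre_edge A b w X N Y M \<and> Q X N Y M v) \<longleftrightarrow> (\<exists>v. Q X N Y M v)"
  using fibre_edge_unique[OF assms] assms(2) by blast

lemma on_left_boundary_faces:
  assumes A: "A \<ge> 2"
  shows "on_left A (Inr W1) (Inl B1) (Face x n) \<longleftrightarrow> x = 0 \<and> n = 1"
    "on_left A (Inr W3) (Inl B3) (Face x n) \<longleftrightarrow> x = - int A + 1 \<and> n = 2 * int A - 1"
    "on_left A (Inr W2) (Inl B2) (Face x n) \<longleftrightarrow> x = int A - 1 \<and> n = int A"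
    "on_left A (Inl B3) (Inr W1) (Face x n) \<longleftrightarrow> x = - int A + 1 \<and> n = int A"
    "on_left A (Inl B2) (Inr W3) (Face x n) \<longleftrightarrow> x = 0 \<and> n = 2 * int A - 1"
    "on_left A (Inl B1) (Inr W2) (Face x n) \<longleftrightarrow> x = int A - 1 \<and> n = 1"
  unfolding on_left_white_black_iff[OF A] on_left_black_white_iff[OF A] edge_faces_def
    fibre_edge_boundary_exists[OF A, THEN ex_fibre_edge[OF A]]
    faces_iff[OF order.strict_trans2[OF zero_less_numeral A]]
  using A by auto

lemma on_left_Outer_cases:
  assumes "on_left A (Inl b) (Inr w) (Outer b' w')"
  shows "b' = b" "w' = w" "(b, w) \<in> {(B1, W1), (B3, W3), (B2, W2)}"
  using assms unfolding on_left_Outer_iff doubleton_eq_iff by auto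

lemma on_left_Outer_cases':
  assumes "on_left A (Inr w) (Inl b) (Outer b' w')"
  shows "b' = b" "w' = w" "(b, w) \<in> {(B3, W1), (B2, W3), (B1, W2)}"
  using assms unfolding on_left_Outer_iff doubleton_eq_iff by auto

lemma on_left_OuterI:
  "on_left A (Inl B1) (Inr W1) (Outer B1 W1)" "on_left A (Inl B3) (Inr W3) (Outer B3 W3)"
  "on_left A (Inl B2) (Inr W2) (Outer B2 W2)" "on_left A (Inr W1) (Inl B3) (Outer B3 W1)"
  "on_left A (Inr W3) (Inl B2) (Outer B2 W3)" "on_left A (Inr W2) (Inl B1) (Outer B1 W2)"
  by (auto simp: on_left_Outer_iff)

text \<open>
  The rows of faces are intervals, connected through the edges between horizontal neighbours, and the
  faces \<open>(0, n)\<close> connect the rows. Each outer vertex is adjacent to one face.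
\<close>

lemma dual_primitive_unique:
  assumes A: "A \<ge> 2" and T: "is_dual_primitive A c \<omega> T" and T': "is_dual_primitive A c \<omega> T'"
  shows "T = T'"
proof -
  have A0: "A > 0" using A by simp
  define d where "d v = T v - T' v" for v
  have step: "d v' = d v" if "Kred A b w \<noteq> 0" "on_left A (Inl b) (Inr w) v" "on_left A (Inr w) (Inl b) v'" for b w v v'
  proof -
    have "T v' - T v = \<omega> b w" "T' v' - T' v = \<omega> b w"
      using T T' that unfolding is_dual_primitive_def by blast+
    then show ?thesis by (simp add: d_def algebra_simps)
  qed
  have horizontal: "d (Face (x + 1) n) = d (Face x n)" if "(x, n) \<in> faces A" "(x + 1, n) \<in> faces A" for x n
  proof -
    have f: "1 \<le> n" "n \<le> 2 * int A - 1" "- n < x" "- int A < x" "x < int A - 1" "x < 2 * int A - 1 - n"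
      using that unfolding faces_iff[OF A0] by auto
    define b where "b = (if n = 1 then B1 else B x n)"
    define w where "w = (if n = 2 * int A - 1 then W3 else W x n)"
    have e: "fibre_edge A b w x n x n"
      using f A by (auto simp: b_def w_def fibre_edge_def fibre_mem hex_adj_def inner_black_iff inner_white_iff)
    have ef: "edge_faces x n x n (x, n) (x + 1, n)" by (simp add: edge_faces_def)
    have "Kred A b w \<noteq> 0"
      using f A by (auto simp: b_def w_def inner_black_iff inner_white_iff hex_adj_def)
    from step[OF this] face_dual_edge[OF A e ef] that show ?thesis by simp
  qed
  have vertical: "d (Face 0 n) = d (Face 0 (n + 1))" if "1 \<le> n" "n + 1 \<le> 2 * int A - 1" for n
  proof -
    have e: "fibre_edge A (B (-1) (n + 1)) (W 0 n) (-1) (n + 1) 0 n"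
      using that A by (auto simp: fibre_edge_def fibre_mem hex_adj_def inner_black_iff inner_white_iff)
    have ef: "edge_faces (-1) (n + 1) 0 n (0, n + 1) (0, n)" by (simp add: edge_faces_def)
    have "Kred A (B (-1) (n + 1)) (W 0 n) \<noteq> 0"
      using that A by (auto simp: inner_black_iff inner_white_iff hex_adj_def)
    moreover have "(0, n) \<in> faces A" "(0, n + 1) \<in> faces A" using that A by (auto simp: faces_iff[OF A0])
    ultimately show ?thesis
      using step[OF _ face_dual_edge(1)[OF A e ef] face_dual_edge(2)[OF A e ef]] by blast
  qed
  have outer: "d (Outer B1 W1) = 0"
    using T T' by (simp add: d_def is_dual_primitive_def)
  have "d (Face 0 1) = d (Outer B1 W1)"
    using step[of B1 W1 "Outer B1 W1" "Face 0 1"] on_left_OuterI(1) on_left_boundary_faces(1)[OF A, of 0 1] by simp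
  then have base: "d (Face 0 1) = 0" using outer by simp
  have column: "d (Face 0 n) = 0" if "1 \<le> n" "n \<le> 2 * int A - 1" for n
    using that
  proof (induction n rule: int_ge_induct)
    case (step n)
    then show ?case using vertical[of n] by simp
  qed (use base in simp)
  have face: "d (Face x n) = 0" if f: "(x, n) \<in> faces A" for x n
  proof -
    have "(x, n) \<in> faces A \<Longrightarrow> d (Face x n) = 0" for x
    proof (induction x rule: int_induct[of _ 0])
      case base
      then show ?case using column[of n] by (simp add: faces_iff[OF A0])
    next
      case (step1 i)
      have "(i, n) \<in> faces A" using step1 by (auto simp: faces_iff[OF A0])
      then show ?case using step1 horizontal[of i n] by simp
    next
      case (step2 i)
      have "(i, n) \<in> faces A" using step2 A by (auto simp: faces_iff[OF A0])
      then show ?case using step2 horizontal[of "i - 1" n] by simp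
    qed
    then show ?thesis using f by blast
  qed
  have outer_left: "d (Outer b w) = 0" if "on_left A (Inl b) (Inr w) (Outer b w)" "on_left A (Inr w) (Inl b) (Face x n)" "Kred A b w \<noteq> 0" for b w x n
    using step[OF that(3,1,2)] face[of x n] that(2) by (simp add: on_left_Face_iff)
  have outer_right: "d (Outer b w) = 0" if "on_left A (Inr w) (Inl b) (Outer b w)" "on_left A (Inl b) (Inr w) (Face x n)" "Kred A b w \<noteq> 0" for b w x n
    using step[OF that(3,2,1)] face[of x n] that(2) by (simp add: on_left_Face_iff)
  have "d v = 0" if "v \<in> dual_vertices A" for v
  proof -
    note f = on_left_boundary_faces[OF A, THEN iffD2, OF conjI[OF refl refl]]
    have "d (Outer B3 W3) = 0" "d (Outer B2 W2) = 0"
      using outer_left[OF on_left_OuterI(2) f(2)] outer_left[OF on_left_OuterI(3) f(3)] by simp_all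
    moreover have "d (Outer B3 W1) = 0" "d (Outer B2 W3) = 0" "d (Outer B1 W2) = 0"
      using outer_right[OF on_left_OuterI(4) f(4)] outer_right[OF on_left_OuterI(5) f(5)]
        outer_right[OF on_left_OuterI(6) f(6)] by simp_all
    ultimately show ?thesis using that outer face by (auto simp: dual_vertices_def)
  qed
  then show "T = T'"
    using T T' by (intro extensionalityI[of T "dual_vertices A" T']) (auto simp: is_dual_primitive_def d_def)
qed

text \<open>
  The witness has the values prescribed by \<open>face_value\<close> on faces. An outer vertex lies on one dual edge only,
  so its value is obtained from the face at the other end.
\<close>

lemma dual_primitive_eq:
  assumes A: "A \<ge> 2" "even A"
    and \<omega>: "\<And>b w. \<omega> b w = F_black A b * Kred A b w * s w"
    and s: "\<And>w. w \<in> whites A \<Longrightarrow> s w = white_gauge \<alpha> \<beta> A w"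
  shows "dual_primitive A c \<omega> (Outer B1 W1) = c"
    and "(x, n) \<in> faces A \<Longrightarrow> dual_primitive A c \<omega> (Face x n) =
      c + F_black A B1 * s W1 + face_value \<alpha> \<beta> A (x, n) / of_real (Delta A)"
proof -
  have A0: "A > 0" using A by simp
  define t where "t p = c + \<omega> B1 W1 + face_value \<alpha> \<beta> A p / of_real (Delta A)" for p
  define T where "T v = (if v \<in> dual_vertices A then (case v of Face x n \<Rightarrow> t (x, n)
      | Outer b w \<Rightarrow>
          if b = B1 \<and> w = W1 then t (0, 1) - \<omega> b w
          else if b = B3 \<and> w = W3 then t (- int A + 1, 2 * int A - 1) - \<omega> b w
          else if b = B2 \<and> w = W2 then t (int A - 1, int A) - \<omega> b w
          else if b = B3 \<and> w = W1 then t (- int A + 1, int A) + \<omega> b w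
          else if b = B2 \<and> w = W3 then t (0, 2 * int A - 1) + \<omega> b w
          else t (int A - 1, 1) + \<omega> b w) else undefined)" for v
  have TF: "T (Face x n) = t (x, n)" if "(x, n) \<in> faces A" for x n
    using that by (force simp: T_def dual_vertices_def)
  have TO: "T (Outer B1 W1) = t (0, 1) - \<omega> B1 W1" "T (Outer B3 W3) = t (- int A + 1, 2 * int A - 1) - \<omega> B3 W3"
    "T (Outer B2 W2) = t (int A - 1, int A) - \<omega> B2 W2" "T (Outer B3 W1) = t (- int A + 1, int A) + \<omega> B3 W1"
    "T (Outer B2 W3) = t (0, 2 * int A - 1) + \<omega> B2 W3" "T (Outer B1 W2) = t (int A - 1, 1) + \<omega> B1 W2"
    by (simp_all add: T_def dual_vertices_def)
  have "is_dual_primitive A c \<omega> T"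
    unfolding is_dual_primitive_def
  proof (intro conjI allI impI)
    show "T \<in> extensional (dual_vertices A)" by (auto simp: T_def extensional_def)
    show "T (Outer B1 W1) = c" using face_value_0_1[OF A0, of \<alpha> \<beta>] TO by (simp add: t_def)
    fix b w v v'
    assume "Kred A b w \<noteq> 0 \<and> on_left A (Inl b) (Inr w) v \<and> on_left A (Inr w) (Inl b) v'"
    then have l: "on_left A (Inl b) (Inr w) v" and r: "on_left A (Inr w) (Inl b) v'" by auto
    show "T v' - T v = \<omega> b w"
    proof (cases v)
      case v: (Outer b1 w1)
      have bw: "b1 = b" "w1 = w" "(b, w) \<in> {(B1, W1), (B3, W3), (B2, W2)}"
        using on_left_Outer_cases l v by metis+
      obtain x n where v': "v' = Face x n"
      proof (cases v')
        case (Outer b2 w2)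
        then show thesis using on_left_Outer_cases'(3)[of A w b b2 w2] r bw(3) by fast
      qed
      then have "(x, n) \<in> faces A" using r by (simp add: on_left_Face_iff)
      then show ?thesis
        using bw r v v' TF on_left_boundary_faces[OF A(1)] TO by auto
    next
      case v: (Face x n)
      have f: "(x, n) \<in> faces A" using l v by (simp add: on_left_Face_iff)
      show ?thesis
      proof (cases v')
        case v': (Outer b1 w1)
        have "b1 = b" "w1 = w" "(b, w) \<in> {(B3, W1), (B2, W3), (B1, W2)}"
          using on_left_Outer_cases' r v' by metis+
        then show ?thesis
          using l v v' f TF on_left_boundary_faces[OF A(1)] TO by auto
      next
        case v': (Face x' n')
        have f': "(x', n') \<in> faces A" using r v' by (simp add: on_left_Face_iff)
        obtain X N Y M p where e: "fibre_edge A b w X N Y M" and ef1: "edge_faces X N Y M (x, n) p"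
          using l unfolding v on_left_black_white_iff[OF A(1)] by blast
        obtain X' N' Y' M' p' where e': "fibre_edge A b w X' N' Y' M'" and ef2: "edge_faces X' N' Y' M' p' (x', n')"
          using r unfolding v' on_left_white_black_iff[OF A(1)] by blast
        have "edge_faces X N Y M (x, n) (x', n')"
          using fibre_edge_unique[OF A(1) e e'] ef1 ef2 unfolding edge_faces_def by auto
        note ef = this
        have "N \<le> 2 * int A - 1"
          using edge_weight(2)[OF A e ef f f'] by (simp add: black_dom_def)
        then have "face_value \<alpha> \<beta> A (x', n') - face_value \<alpha> \<beta> A (x, n) =
            black_lift A (black_gauge A) X N * white_lift A (white_gauge \<alpha> \<beta> A) Y M"
          using face_value_increment[OF _ ef] black_gauge_lift[OF A edge_weight(2)[OF A e ef f f']]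
            white_gauge_lift[OF A edge_weight(3)[OF A e ef f f']] by simp
        also have "\<dots> = black_gauge A b * Kred A b w * white_gauge \<alpha> \<beta> A w"
          using edge_weight(1)[OF A e ef f f'] by simp
        finally have "(face_value \<alpha> \<beta> A (x', n') - face_value \<alpha> \<beta> A (x, n)) / of_real (Delta A) = \<omega> b w"
          using fibre_edge_vertices[OF e] by (simp add: \<omega> s F_black_eq[OF A])
        then show ?thesis using v v' TF[OF f] TF[OF f'] by (simp add: t_def diff_divide_distrib)
      qed
    qed
  qed
  then have "dual_primitive A c \<omega> = T"
    unfolding dual_primitive_def is_dual_primitive_def [symmetric]
    using dual_primitive_unique[OF A(1)] by (intro the_equality) auto
  moreover have "\<omega> B1 W1 = F_black A B1 * s W1" by (simp add: \<omega>)
  ultimately show "dual_primitive A c \<omega> (Outer B1 W1) = c"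
    "(x, n) \<in> faces A \<Longrightarrow> dual_primitive A c \<omega> (Face x n) =
      c + F_black A B1 * s W1 + face_value \<alpha> \<beta> A (x, n) / of_real (Delta A)"
    using TO(1) TF[of x n] face_value_0_1[OF A0, of \<alpha> \<beta>] by (simp_all add: t_def)
qed

theorem theorem1p3:
  fixes A :: nat and x n :: int and \<gamma>\<^sub>1 \<gamma>\<^sub>2 :: "real \<Rightarrow> complex"
  assumes "A > 0" and "even A"
    and "(x, n) \<in> faces A"
    and "z1_contour A x \<gamma>\<^sub>1" and "z2_contour A \<gamma>\<^sub>1 \<gamma>\<^sub>2"
  shows "t_embedding A (Face x n) =
           t_embedding A (Outer B1 W1) + F_black A B1 * F_white A W1
           + fact (2 * A - 1) / of_real (Delta A) * (1 / (2 * of_real pi * \<i>)\<^sup>2) *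
             contour_integral \<gamma>\<^sub>1 (\<lambda>z\<^sub>1. contour_integral \<gamma>\<^sub>2 (\<lambda>z\<^sub>2. integrand A x n (g_fun A) z\<^sub>1 z\<^sub>2)) \<and>
         origami A (Face x n) =
           origami A (Outer B1 W1) + F_black A B1 * cnj (F_white A W1)
           + fact (2 * A - 1) / of_real (Delta A) * (1 / (2 * of_real pi * \<i>)\<^sup>2) *
             contour_integral \<gamma>\<^sub>1 (\<lambda>z\<^sub>1. contour_integral \<gamma>\<^sub>2 (\<lambda>z\<^sub>2. integrand A x n (g_bar A) z\<^sub>1 z\<^sub>2))"
proof -
  have A: "A \<ge> 2" "even A" using assms(1,2) by (auto elim!: evenE)
  have formula: "dual_primitive A c (\<lambda>b w. F_black A b * Kred A b w * s w) (Face x n) =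
      dual_primitive A c (\<lambda>b w. F_black A b * Kred A b w * s w) (Outer B1 W1) + F_black A B1 * s W1
      + fact (2 * A - 1) / of_real (Delta A) * (1 / (2 * of_real pi * \<i>)\<^sup>2) *
        contour_integral \<gamma>\<^sub>1 (\<lambda>z\<^sub>1. contour_integral \<gamma>\<^sub>2 (\<lambda>z\<^sub>2. integrand A x n g z\<^sub>1 z\<^sub>2))"
    if s: "\<And>w. w \<in> whites A \<Longrightarrow> s w = white_gauge \<alpha> \<beta> A w"
      and g: "g = (\<lambda>z. white_factor \<alpha> \<beta> A z)" for c s g \<alpha> \<beta>
  proof -
    let ?\<omega> = "\<lambda>b w. F_black A b * Kred A b w * s w"
    have 1: "dual_primitive A c ?\<omega> (Outer B1 W1) = c"
      by (rule dual_primitive_eq(1)[OF A refl]) (rule s)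
    have 2: "dual_primitive A c ?\<omega> (Face x n) = c + F_black A B1 * s W1 + face_value \<alpha> \<beta> A (x, n) / of_real (Delta A)"
      by (rule dual_primitive_eq(2)[OF A refl _ assms(3)]) (rule s)
    show ?thesis
      unfolding 1 2 mult.assoc[of "fact (2 * A - 1) / of_real (Delta A)"]
        double_contour_integral[OF A(1) assms(3-5) g]
      by (simp add: face_value_def)
  qed
  have g: "g_fun A = (\<lambda>z. -1 + of_nat A / (1 + z) * cis (pi / 3) + of_nat A / (- of_nat A - z) * cis (- pi / 3))"
    by (simp add: g_fun_def fun_eq_iff)
  have g': "g_bar A = (\<lambda>z. -1 + of_nat A / (1 + z) * cis (- pi / 3) + of_nat A / (- of_nat A - z) * cis (pi / 3))"
    by (simp add: g_bar_def g_fun_def fun_eq_iff cis_cnj)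
  show ?thesis
    unfolding t_embedding_def origami_def
    using formula[OF F_white_eq[OF A] g] formula[OF cnj_F_white_eq[OF A] g'] by blast
qed

end
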